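(* Let $(M,\mathcal F)$ be a compact minimal lamination by hyperbolic surfaces for which the right action of the affine group $B$ on the laminated unit tangent bundle $\hat M$ is minimal (every $B$-orbit is dense in $\hat M$). If $\mathcal F$ has a leaf which is not simply connected, then the laminated horocycle flow $h^t$ is topologically transitive on $\hat M$.
   Context: A compact lamination by hyperbolic surfaces $(M,\mathcal F)$ is a compact metrizable space $M$ with a family $\{(U_\alpha,\varphi_\alpha)\}$ such that $\{U_\alpha\}$ is an open covering of $M$; $\varphi_\alpha:U_\alpha\to D_\alpha\times T_\alpha$ is a homeomorphism, with $D_\alpha$ a bounded open disk in the Poincaré upper half plane $\mathbb H$ and $T_\alpha$ a topological space; and for $(y,t)\in\varphi_\beta(U_\alpha\cap U_\beta)$, $\varphi_\alpha\circ\varphi_\beta^{-1}(y,t)=(g_{\alpha\beta}(t)y,h_{\alpha\beta}(t))$ with $g_{\alpha\beta}(t)\in PSL(2,\mathbb R)$. (Then $h_{\alpha\beta}$ is a homeomorphism between open subsets of $T_\beta$ and $T_\alpha$, and $g_{\alpha\beta}$ is continuous in $t$.) The plaques $\varphi_\alpha^{-1}(D_\alpha\times\{t\})$ glue together to form maximal connected hyperbolic surfaces called leaves; $\mathcal F$ is the partition of $M$ into leaves. The lamination is minimal if all leaves are dense in $M$. The laminated unit tangent bundle is $\hat M=\bigcup_{x\in M}T^1_x\mathcal F$, where $T^1_x\mathcal F$ is the set of unit vectors at $x$ tangent to the leaf through $x$. It is topologized by the charts $\psi_\alpha$, with values in $T^1D_\alpha\times T_\alpha$, given by the leafwise differentials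 of $\varphi_\alpha$. Identify $T^1\mathbb H$ with $PSL(2,\mathbb R)$ as usual ($g\leftrightarrow g_*w_0$, $w_0$ the upward unit vector at $i$). Then the transition maps are $(g,t)\mapsto(g_{\alpha\beta}(t)g,h_{\alpha\beta}(t))$, so right multiplication in the charts defines a continuous right action of $PSL(2,\mathbb R)$ on $\hat M$, whose orbits are the unit tangent bundles $T^1L$ of the leaves $L$. The affine group is the subgroup $B=\left\{\begin{pmatrix}a&b\\0&a^{-1}\end{pmatrix}: a>0,\ b\in\mathbb R\right\}$ of $PSL(2,\mathbb R)$, acting on $\hat M$ by restriction. The laminated horocycle flow $h^t$ is the right action of the one-parameter subgroup $\begin{pmatrix}1&t\\0&1\end{pmatrix}$, $t\in\mathbb R$; on each $T^1L$ it is the usual horocycle flow. A flow is topologically transitive if it has a dense orbit (equivalently here, for any two nonempty open sets some time-$t$ map, $t\in\mathbb R$, sends the first to a set meeting the second). *)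

theory Defs
  imports "HOL-Analysis.Analysis"
begin

section \<open>The group \<open>PSL(2,\<real>)\<close> and the unit tangent bundle of the upper half plane\<close>

definition SL2 :: "(real^2^2) set" where
  "SL2 = {A. det A = 1}"

definition psl2_rel :: "real^2^2 \<Rightarrow> real^2^2 \<Rightarrow> bool" where
  "psl2_rel A B \<longleftrightarrow> A \<in> SL2 \<and> B \<in> SL2 \<and> (A = B \<or> A = - B)"

lemma det_uminus_2: "det (- A :: real^2^2) = det A"
  by (simp add: det_2)

quotient_type psl2 = "real^2^2" / partial: psl2_rel
proof (rule part_equivpI)
  show "\<exists>A. psl2_rel A A"
    by (rule exI[of _ "mat 1"]) (simp add: psl2_rel_def SL2_def)
  show "symp psl2_rel"
    by (auto simp: symp_def psl2_rel_def)
  show "transp psl2_rel"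
    by (auto simp: transp_def psl2_rel_def)
qed

lemma matrix_mult_uminus:
  fixes A B :: "real^2^2"
  shows "(- A) ** B = - (A ** B)" "A ** (- B) = - (A ** B)"
  by (simp_all add: matrix_matrix_mult_def vec_eq_iff sum_negf)

instantiation psl2 :: monoid_mult
begin

lift_definition one_psl2 :: psl2 is "mat 1"
  by (simp add: psl2_rel_def SL2_def)

lift_definition times_psl2 :: "psl2 \<Rightarrow> psl2 \<Rightarrow> psl2" is "(**)"
  by (auto simp: psl2_rel_def SL2_def det_mul det_uminus_2 matrix_mult_uminus)

instance
  by standard (transfer; auto simp: psl2_rel_def SL2_def det_mul matrix_mul_assoc det_uminus_2 matrix_mult_uminus)+

end

definition upper_half_plane :: "complex set" where
  "upper_half_plane = {z. 0 < Im z}"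

definition mob :: "real^2^2 \<Rightarrow> complex \<Rightarrow> complex" where
  "mob A = moebius (of_real (A$1$1)) (of_real (A$1$2)) (of_real (A$2$1)) (of_real (A$2$2))"

lemma mob_uminus: "mob (- A) = mob A"
proof
  fix z :: complex
  have "(- (p * z) - q) / (- (r * z) - u) = (p * z + q) / (r * z + u)" for p q r u :: complex
    using minus_divide_divide[of "p * z + q" "r * z + u"] by simp
  then show "mob (- A) z = mob A z"
    by (simp add: mob_def moebius_def)
qed

lift_definition psl_act :: "psl2 \<Rightarrow> complex \<Rightarrow> complex" is mob
  by (auto simp: psl2_rel_def mob_uminus)

text \<open>The Poincare metric at \<^term>\<open>z\<close> is the Euclidean one divided by \<^term>\<open>Im z\<close>, so the unit
  vectors at \<^term>\<open>z\<close> are those of Euclidean length \<^term>\<open>Im z\<close>.\<close>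

definition unit_tangent :: "complex set \<Rightarrow> (complex \<times> complex) set" where
  "unit_tangent D = {(z, v). z \<in> D \<and> cmod v = Im z}"

definition psl_differential :: "psl2 \<Rightarrow> complex \<times> complex \<Rightarrow> complex \<times> complex" where
  "psl_differential g = (\<lambda>(z, v). (psl_act g z, deriv (psl_act g) z * v))"

text \<open>The identification \<open>g \<mapsto> g\<^sub>*w\<^sub>0\<close> of \<open>PSL(2,\<real>)\<close> with \<open>T\<^sup>1\<H>\<close>, where \<open>w\<^sub>0\<close>
  is the upward unit vector at \<^term>\<open>\<i>\<close>; see \<open>bij_betw_psl_frame\<close> below.\<close>

definition psl_frame :: "psl2 \<Rightarrow> complex \<times> complex" where
  "psl_frame g = psl_differential g (\<i>, \<i>)"

definition psl_of :: "real \<Rightarrow> real \<Rightarrow> real \<Rightarrow> real \<Rightarrow> psl2" where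
  "psl_of a b c d = abs_psl2 (vector [vector [a, b], vector [c, d]])"

definition affine_group :: "psl2 set" where
  "affine_group = {psl_of a b 0 (inverse a) | a b. 0 < a}"

definition horocycle_subgroup :: "real \<Rightarrow> psl2" where
  "horocycle_subgroup t = psl_of 1 t 0 1"

lemma psl2_cases:
  obtains a b c d where "a * d - b * c = 1" "g = psl_of a b c d"
proof -
  define A where "A = rep_psl2 g"
  have "psl2_rel A A" "g = abs_psl2 A"
    using Quotient3_rel_rep[OF Quotient3_psl2] Quotient3_abs_rep[OF Quotient3_psl2]
    by (auto simp: A_def)
  moreover have "A = vector [vector [A$1$1, A$1$2], vector [A$2$1, A$2$2]]"
    by (simp add: vec_eq_iff forall_2)
  ultimately show ?thesis
    using that[of "A$1$1" "A$2$2" "A$1$2" "A$2$1"]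
    by (simp add: psl_of_def psl2_rel_def SL2_def det_2)
qed

lemma psl_of_eq_iff:
  assumes "a * d - b * c = 1" "a' * d' - b' * c' = 1"
  shows "psl_of a b c d = psl_of a' b' c' d' \<longleftrightarrow>
    (a, b, c, d) = (a', b', c', d') \<or> (a, b, c, d) = (- a', - b', - c', - d')"
proof -
  let ?A = "vector [vector [a, b], vector [c, d]] :: real^2^2"
  let ?B = "vector [vector [a', b'], vector [c', d']] :: real^2^2"
  have *: "psl2_rel ?A ?A" "psl2_rel ?B ?B"
    using assms by (auto simp: psl2_rel_def SL2_def det_2)
  have "psl_of a b c d = psl_of a' b' c' d' \<longleftrightarrow> psl2_rel ?A ?B"
    unfolding psl_of_def using Quotient3_rel[OF Quotient3_psl2, of ?A ?B] * by simp
  also have "\<dots> \<longleftrightarrow> ?A = ?B \<or> ?A = - ?B"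
    using * by (auto simp: psl2_rel_def)
  finally show ?thesis
    by (simp add: vec_eq_iff forall_2)
qed

lemma psl_of_mult:
  assumes "a * d - b * c = 1" "a' * d' - b' * c' = 1"
  shows "psl_of a b c d * psl_of a' b' c' d' =
    psl_of (a * a' + b * c') (a * b' + b * d') (c * a' + d * c') (c * b' + d * d')"
proof -
  let ?A = "vector [vector [a, b], vector [c, d]] :: real^2^2"
  let ?B = "vector [vector [a', b'], vector [c', d']] :: real^2^2"
  have *: "psl2_rel ?A ?A" "psl2_rel ?B ?B"
    using assms by (auto simp: psl2_rel_def SL2_def det_2)
  have "?A ** ?B = vector [vector [a * a' + b * c', a * b' + b * d'],
                           vector [c * a' + d * c', c * b' + d * d']]"
    by (simp add: vec_eq_iff forall_2 matrix_matrix_mult_def sum_2)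
  with * show ?thesis
    by (simp add: psl_of_def times_psl2.abs_eq)
qed

lemma psl_act_psl_of:
  assumes "a * d - b * c = 1"
  shows "psl_act (psl_of a b c d) = moebius (of_real a) (of_real b) (of_real c) (of_real d)"
  using assms by (simp add: psl_of_def psl_act.abs_eq psl2_rel_def SL2_def det_2 mob_def)

lemma psl_frame_psl_of:
  assumes "a * d - b * c = 1"
  shows "psl_frame (psl_of a b c d) = ((a * \<i> + b) / (c * \<i> + d), \<i> / (c * \<i> + d)\<^sup>2)"
proof -
  have nz: "c * \<i> + d \<noteq> 0"
    using assms by (auto simp: complex_eq_iff)
  have det: "complex_of_real a * d - b * c = 1"
    using assms by (metis of_real_1 of_real_diff of_real_mult)
  have num: "a * (c * \<i> + d) - (a * \<i> + b) * c = 1"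
    using det by (simp add: algebra_simps)
  have "((\<lambda>z. (a * z + b) / (c * z + d)) has_field_derivative 1 / (c * \<i> + d)\<^sup>2) (at \<i>)"
    by (rule derivative_eq_intros refl nz | simp add: num power2_eq_square)+
  then have "deriv (moebius (of_real a) (of_real b) (of_real c) (of_real d)) \<i> = 1 / (c * \<i> + d)\<^sup>2"
    by (intro DERIV_imp_deriv) (simp add: moebius_def)
  then show ?thesis
    by (simp add: psl_frame_def psl_differential_def psl_act_psl_of assms moebius_def)
qed

lemma bij_betw_psl_frame: "bij_betw psl_frame UNIV (unit_tangent upper_half_plane)"
  unfolding bij_betw_def
proof
  show "inj psl_frame"
  proof (rule injI)
    fix g h assume eq: "psl_frame g = psl_frame h"
    obtain a b c d where g: "a * d - b * c = 1" "g = psl_of a b c d" by (rule psl2_cases)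
    obtain a' b' c' d' where h: "a' * d' - b' * c' = 1" "h = psl_of a' b' c' d'" by (rule psl2_cases)
    define s s' where "s = c * \<i> + d" and "s' = c' * \<i> + d'"
    have nz: "s \<noteq> 0" "s' \<noteq> 0"
      using g h by (auto simp: s_def s'_def complex_eq_iff)
    have e: "(a * \<i> + b) / s = (a' * \<i> + b') / s'" "\<i> / s\<^sup>2 = \<i> / s'\<^sup>2"
      using eq g h by (simp_all add: psl_frame_psl_of s_def s'_def)
    then have "s\<^sup>2 = s'\<^sup>2"
      using nz by (simp add: field_simps)
    then consider "s = s'" | "s = - s'"
      by (auto simp: power2_eq_iff)
    then show "g = h"
    proof cases
      case 1
      then have "a * \<i> + b = a' * \<i> + b'" using e nz by simp
      with 1 show ?thesis
        unfolding g h psl_of_eq_iff[OF g(1) h(1)] by (auto simp: s_def s'_def complex_eq_iff)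
    next
      case 2
      have "- (a * \<i> + b) / s' = (a * \<i> + b) / s"
        unfolding 2 by (metis minus_divide_left minus_divide_right)
      then have "- (a * \<i> + b) / s' = (a' * \<i> + b') / s'"
        using e(1) by (rule trans)
      then have "- (a * \<i> + b) = a' * \<i> + b'"
        using nz(2) divide_cancel_right by blast
      then have "a * \<i> + b = - (a' * \<i> + b')"
        by (metis minus_minus)
      with 2 show ?thesis
        unfolding g h psl_of_eq_iff[OF g(1) h(1)] by (auto simp: s_def s'_def complex_eq_iff)
    qed
  qed
  show "range psl_frame = unit_tangent upper_half_plane"
  proof (intro equalityI subsetI)
    fix p assume "p \<in> range psl_frame"
    then obtain g where p: "p = psl_frame g" by auto
    obtain a b c d where g: "a * d - b * c = 1" "g = psl_of a b c d" by (rule psl2_cases)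
    have pos: "c\<^sup>2 + d\<^sup>2 > 0"
      using g(1) by (auto simp: sum_power2_gt_zero_iff)
    have "Im ((a * \<i> + b) / (c * \<i> + d)) = 1 / (c\<^sup>2 + d\<^sup>2)"
      using g(1) by (simp add: Im_divide add.commute)
    moreover have "cmod (\<i> / (c * \<i> + d)\<^sup>2) = 1 / (c\<^sup>2 + d\<^sup>2)"
      by (simp add: norm_divide norm_power cmod_power2 add.commute)
    ultimately show "p \<in> unit_tangent upper_half_plane"
      using pos by (simp add: p g psl_frame_psl_of unit_tangent_def upper_half_plane_def)
  next
    fix p assume "p \<in> unit_tangent upper_half_plane"
    then obtain z v where p: "p = (z, v)" "Im z > 0" "cmod v = Im z"
      by (auto simp: unit_tangent_def upper_half_plane_def)
    then have v: "v \<noteq> 0" by auto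
    define s where "s = csqrt (\<i> / v)"
    have s2: "s\<^sup>2 = \<i> / v" by (simp add: s_def)
    then have s: "s \<noteq> 0" using v by auto
    have "(cmod s)\<^sup>2 = 1 / Im z"
      using arg_cong[OF s2, of cmod] p by (simp add: norm_power norm_divide)
    then have "Im z * ((Re s)\<^sup>2 + (Im s)\<^sup>2) = 1"
      using p by (simp add: cmod_power2)
    then have det: "Im (z * s) * Re s - Re (z * s) * Im s = 1"
      by (simp add: algebra_simps power2_eq_square)
    have eqs: "Im s * \<i> + Re s = s" "Im (z * s) * \<i> + Re (z * s) = z * s"
      by (simp_all add: complex_eq_iff)
    have "psl_frame (psl_of (Im (z * s)) (Re (z * s)) (Im s) (Re s)) = (z, v)"
      unfolding psl_frame_psl_of[OF det] eqs using s v by (simp add: s2)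
    then show "p \<in> range psl_frame"
      using p by (metis rangeI)
  qed
qed

definition hyp_dist :: "complex \<Rightarrow> complex \<Rightarrow> real" where
  "hyp_dist z w = arcosh (1 + (cmod (z - w))\<^sup>2 / (2 * Im z * Im w))"

definition is_hyp_disk :: "complex set \<Rightarrow> bool" where
  "is_hyp_disk D \<longleftrightarrow>
    (\<exists>c r. c \<in> upper_half_plane \<and> 0 < r \<and> D = {z \<in> upper_half_plane. hyp_dist c z < r})"


section \<open>Laminations by hyperbolic surfaces\<close>

record ('a, 'i, 't) lamination =
  lam_space :: "'a topology"
  lam_index :: "'i set"
  lam_dom :: "'i \<Rightarrow> 'a set"
  lam_disk :: "'i \<Rightarrow> complex set"
  lam_transversal :: "'i \<Rightarrow> 't topology"
  lam_chart :: "'i \<Rightarrow> 'a \<Rightarrow> complex \<times> 't"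

definition lam_transition ::
    "('a, 'i, 't) lamination \<Rightarrow> 'i \<Rightarrow> 'i \<Rightarrow> complex \<times> 't \<Rightarrow> complex \<times> 't" where
  "lam_transition L \<alpha> \<beta> p = lam_chart L \<alpha> (inv_into (lam_dom L \<beta>) (lam_chart L \<beta>) p)"

definition compact_hyperbolic_lamination :: "('a, 'i, 't) lamination \<Rightarrow> bool" where
  "compact_hyperbolic_lamination L \<longleftrightarrow>
    compact_space (lam_space L) \<and> metrizable_space (lam_space L) \<and>
    (\<forall>\<alpha>\<in>lam_index L. openin (lam_space L) (lam_dom L \<alpha>)) \<and>
    topspace (lam_space L) = (\<Union>\<alpha>\<in>lam_index L. lam_dom L \<alpha>) \<and>
    (\<forall>\<alpha>\<in>lam_index L. is_hyp_disk (lam_disk L \<alpha>) \<and>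
       homeomorphic_map (subtopology (lam_space L) (lam_dom L \<alpha>))
         (prod_topology (top_of_set (lam_disk L \<alpha>)) (lam_transversal L \<alpha>)) (lam_chart L \<alpha>)) \<and>
    (\<forall>\<alpha>\<in>lam_index L. \<forall>\<beta>\<in>lam_index L. \<exists>(g :: 't \<Rightarrow> psl2) (h :: 't \<Rightarrow> 't).
       \<forall>(y, t) \<in> lam_chart L \<beta> ` (lam_dom L \<alpha> \<inter> lam_dom L \<beta>).
         lam_transition L \<alpha> \<beta> (y, t) = (psl_act (g t) y, h t))"

text \<open>The leaf topology is generated by the open subsets of the plaques; a leaf is a maximal
  connected set for it, and carries it as its surface topology.\<close>

definition leaf_topology :: "('a, 'i, 't) lamination \<Rightarrow> 'a topology" where
  "leaf_topology L = topology_generated_by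
    {{x \<in> lam_dom L \<alpha>. fst (lam_chart L \<alpha> x) \<in> V \<and> snd (lam_chart L \<alpha> x) = t} | \<alpha> V t.
       \<alpha> \<in> lam_index L \<and> openin (top_of_set (lam_disk L \<alpha>)) V \<and> t \<in> topspace (lam_transversal L \<alpha>)}"

definition leaves :: "('a, 'i, 't) lamination \<Rightarrow> 'a set set" where
  "leaves L = connected_components_of (leaf_topology L)"

definition minimal_lamination :: "('a, 'i, 't) lamination \<Rightarrow> bool" where
  "minimal_lamination L \<longleftrightarrow>
    (\<forall>F\<in>leaves L. lam_space L closure_of F = topspace (lam_space L))"

text \<open>The counterpart for abstract topologies of \<^const>\<open>simply_connected\<close>.\<close>

definition simply_connected_space :: "'a topology \<Rightarrow> bool" where
  "simply_connected_space X \<longleftrightarrow>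
    (\<forall>p q. pathin X p \<and> p 1 = p 0 \<and> pathin X q \<and> q 1 = q 0 \<longrightarrow>
       homotopic_with (\<lambda>r. r 1 = r 0) (top_of_set {0..1}) X p q)"

lemma simply_connected_space_top_of_set:
  "simply_connected_space (top_of_set S) \<longleftrightarrow> simply_connected S"
proof -
  have "pathin (top_of_set S) p \<longleftrightarrow> path p \<and> path_image p \<subseteq> S" for p
    by (auto simp: pathin_def path_def path_image_def)
  then show ?thesis
    unfolding simply_connected_space_def simply_connected_def homotopic_loops_def
      pathstart_def pathfinish_def by blast
qed


section \<open>The laminated unit tangent bundle\<close>

text \<open>A leafwise tangent vector at \<^term>\<open>x\<close> is given by its coordinates in all charts around
  \<^term>\<open>x\<close>, which are related by the derivatives of the leafwise transition maps
  \<open>y \<mapsto> fst (\<phi>\<^sub>\<alpha> (\<phi>\<^sub>\<beta>\<^sup>-\<^sup>1 (y, t)))\<close>.\<close>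

definition unit_tangent_vectors :: "('a, 'i, 't) lamination \<Rightarrow> 'a \<Rightarrow> ('i \<Rightarrow> complex) set" where
  "unit_tangent_vectors L x =
    {\<xi> \<in> extensional {\<alpha> \<in> lam_index L. x \<in> lam_dom L \<alpha>}.
      (\<forall>\<alpha>\<in>lam_index L. x \<in> lam_dom L \<alpha> \<longrightarrow>
         (fst (lam_chart L \<alpha> x), \<xi> \<alpha>) \<in> unit_tangent (lam_disk L \<alpha>)) \<and>
      (\<forall>\<alpha>\<in>lam_index L. \<forall>\<beta>\<in>lam_index L. x \<in> lam_dom L \<alpha> \<inter> lam_dom L \<beta> \<longrightarrow>
         \<xi> \<alpha> = deriv (\<lambda>y. fst (lam_transition L \<alpha> \<beta> (y, snd (lam_chart L \<beta> x))))
                  (fst (lam_chart L \<beta> x)) * \<xi> \<beta>)}"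

definition unit_bundle :: "('a, 'i, 't) lamination \<Rightarrow> ('a \<times> ('i \<Rightarrow> complex)) set" where
  "unit_bundle L = Sigma (topspace (lam_space L)) (unit_tangent_vectors L)"

definition unit_bundle_dom :: "('a, 'i, 't) lamination \<Rightarrow> 'i \<Rightarrow> ('a \<times> ('i \<Rightarrow> complex)) set" where
  "unit_bundle_dom L \<alpha> = {(x, \<xi>) \<in> unit_bundle L. x \<in> lam_dom L \<alpha>}"

definition unit_bundle_chart ::
    "('a, 'i, 't) lamination \<Rightarrow> 'i \<Rightarrow> 'a \<times> ('i \<Rightarrow> complex) \<Rightarrow> (complex \<times> complex) \<times> 't" where
  "unit_bundle_chart L \<alpha> = (\<lambda>(x, \<xi>). ((fst (lam_chart L \<alpha> x), \<xi> \<alpha>), snd (lam_chart L \<alpha> x)))"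

definition unit_bundle_topology ::
    "('a, 'i, 't) lamination \<Rightarrow> ('a \<times> ('i \<Rightarrow> complex)) topology" where
  "unit_bundle_topology L = topology_generated_by
    {{w \<in> unit_bundle_dom L \<alpha>. unit_bundle_chart L \<alpha> w \<in> W} | \<alpha> W. \<alpha> \<in> lam_index L \<and>
       openin (prod_topology (top_of_set (unit_tangent (lam_disk L \<alpha>))) (lam_transversal L \<alpha>)) W}"

lemma topspace_unit_bundle_topology:
  assumes "compact_hyperbolic_lamination L"
  shows "topspace (unit_bundle_topology L) = unit_bundle L"
proof
  show "topspace (unit_bundle_topology L) \<subseteq> unit_bundle L"
    by (auto simp: unit_bundle_topology_def unit_bundle_dom_def)
  show "unit_bundle L \<subseteq> topspace (unit_bundle_topology L)"
  proof
    fix w assume "w \<in> unit_bundle L"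
    then obtain x \<xi> where w: "w = (x, \<xi>)" "x \<in> topspace (lam_space L)" "\<xi> \<in> unit_tangent_vectors L x"
      by (auto simp: unit_bundle_def)
    with assms obtain \<alpha> where \<alpha>: "\<alpha> \<in> lam_index L" "x \<in> lam_dom L \<alpha>"
      by (auto simp: compact_hyperbolic_lamination_def)
    let ?P = "prod_topology (top_of_set (unit_tangent (lam_disk L \<alpha>))) (lam_transversal L \<alpha>)"
    have "homeomorphic_map (subtopology (lam_space L) (lam_dom L \<alpha>))
        (prod_topology (top_of_set (lam_disk L \<alpha>)) (lam_transversal L \<alpha>)) (lam_chart L \<alpha>)"
      using assms \<alpha> by (simp add: compact_hyperbolic_lamination_def)
    from homeomorphic_imp_surjective_map[OF this]
    have "lam_chart L \<alpha> x \<in> lam_disk L \<alpha> \<times> topspace (lam_transversal L \<alpha>)"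
      using w \<alpha> by auto
    moreover have "(fst (lam_chart L \<alpha> x), \<xi> \<alpha>) \<in> unit_tangent (lam_disk L \<alpha>)"
      using w(3) \<alpha> unfolding unit_tangent_vectors_def by blast
    ultimately have "unit_bundle_chart L \<alpha> w \<in> topspace ?P"
      by (simp add: w unit_bundle_chart_def mem_Times_iff)
    moreover have "w \<in> unit_bundle_dom L \<alpha>"
      using w \<alpha> by (auto simp: unit_bundle_dom_def unit_bundle_def)
    ultimately show "w \<in> topspace (unit_bundle_topology L)"
      unfolding unit_bundle_topology_def topology_generated_by_topspace
      using \<alpha> openin_topspace[of ?P] by blast
  qed
qed

text \<open>The right action is generated by right multiplication in the charts.  A chart only sees a
  piece of \<open>T\<^sup>1\<H> = PSL(2,\<real>)\<close>, so a general group element acts through finitely many such steps.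
  The result does not depend on the steps chosen, because it can be computed in the universal
  cover \<open>\<H>\<close> of the leaf, and every element can be reached, because the leaves of a compact
  lamination are complete.\<close>

inductive right_action_rel ::
    "('a, 'i, 't) lamination \<Rightarrow> 'a \<times> ('i \<Rightarrow> complex) \<Rightarrow> psl2 \<Rightarrow> 'a \<times> ('i \<Rightarrow> complex) \<Rightarrow> bool"
  for L where
  chart: "right_action_rel L w g w'"
    if "\<alpha> \<in> lam_index L" "w \<in> unit_bundle_dom L \<alpha>" "w' \<in> unit_bundle_dom L \<alpha>"
       "unit_bundle_chart L \<alpha> w = (psl_frame k, t)"
       "unit_bundle_chart L \<alpha> w' = (psl_frame (k * g), t)"
| comp: "right_action_rel L w (g * h) w''"
    if "right_action_rel L w g w'" "right_action_rel L w' h w''"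

definition right_action ::
    "('a, 'i, 't) lamination \<Rightarrow> 'a \<times> ('i \<Rightarrow> complex) \<Rightarrow> psl2 \<Rightarrow> 'a \<times> ('i \<Rightarrow> complex)" where
  "right_action L w g = (THE w'. right_action_rel L w g w')"

definition minimal_affine_action :: "('a, 'i, 't) lamination \<Rightarrow> bool" where
  "minimal_affine_action L \<longleftrightarrow>
    (\<forall>w\<in>unit_bundle L. unit_bundle_topology L closure_of (right_action L w ` affine_group) = unit_bundle L)"

definition horocycle_flow ::
    "('a, 'i, 't) lamination \<Rightarrow> real \<Rightarrow> 'a \<times> ('i \<Rightarrow> complex) \<Rightarrow> 'a \<times> ('i \<Rightarrow> complex)" where
  "horocycle_flow L t w = right_action L w (horocycle_subgroup t)"

definition topologically_transitive_flow :: "'a topology \<Rightarrow> (real \<Rightarrow> 'a \<Rightarrow> 'a) \<Rightarrow> bool" where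
  "topologically_transitive_flow X f \<longleftrightarrow>
    (\<exists>w\<in>topspace X. X closure_of (range (\<lambda>t. f t w)) = topspace X)"

end

theory Submission
  imports Defs
begin

text \<open>The horocycle orbit that turns out to be dense is that of a unit vector \<open>w\<close> tangent to a closed
geodesic: \<open>w a\<^sub>l = w\<close> for some \<open>l > 0\<close>, where \<open>a\<^sub>r\<close> is \<open>geodesic_subgroup r\<close>.

Let \<open>Y\<close> be the closure of that orbit. The geodesic flow normalizes the horocycle flow, so \<open>Y\<close> is
invariant under \<open>a\<^sub>l\<close>, the union of the \<open>Y a\<^sub>r\<close> with \<open>0 \<le> r \<le> l\<close> is closed and invariant under the
affine group, and hence it is everything (\<open>geodesic_translates_cover\<close>). The \<open>r\<close> with \<open>Y a\<^sub>r = Y\<close> form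
a closed subgroup of \<open>\<real>\<close>. If it is \<open>\<real>\<close>, then \<open>Y\<close> is everything. Otherwise it is \<open>s\<int>\<close> with
\<open>s > 0\<close>, and the translates partition the space: there is a continuous map \<open>\<theta>\<close> to the circle
\<open>\<real>/s\<int>\<close> which is constant along horocycle orbits and satisfies \<open>\<theta>(x a\<^sub>r) = \<theta>(x) + r\<close>. This is
incompatible with the periodicity of \<open>w\<close>. Follow \<open>\<theta>\<close> along a path \<open>w g\<close> that turns \<open>w\<close> into the
opposite vector. Since \<open>w = w a\<^sub>l\<close>, the vectors \<open>w g\<close> and \<open>w a\<^sub>l g\<close> coincide, and \<open>a\<^sub>l g\<close> is again
a point of the path up to an affine factor, whose effect on \<open>\<theta>\<close> is \<open>l\<close> at the start of the path and
\<open>-l\<close> at its end, because the opposite vector runs along the closed geodesic backwards. After lifting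
\<open>\<theta>\<close> to \<open>\<real>\<close> this makes a continuous function with values in \<open>s\<int>\<close> change from \<open>-l\<close> to \<open>l\<close>
(\<open>horocycle_orbit_dense\<close>).

The closed geodesic comes from the leaf that is not simply connected. Let \<open>P\<close> be the universal
covering of this leaf by the hyperbolic plane. It is not injective, so \<open>P \<circ> \<gamma> = P\<close> for some isometry
\<open>\<gamma> \<noteq> 1\<close>. It is not elliptic, as \<open>P\<close> is injective near a fixed point. It is not parabolic: a parabolic
\<open>\<gamma>\<close> moves some points by arbitrarily small hyperbolic distances, whereas compactness makes \<open>P\<close>
injective on all balls of one fixed hyperbolic radius. So \<open>\<gamma>\<close> is hyperbolic, and its axis covers a
closed geodesic (\<open>ex_closed_geodesic\<close>).

What makes all this precise are the coverings \<open>P\<close>. They are maps from the hyperbolic plane that are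
given in each chart by an element of \<open>PSL(2,\<real>)\<close>, here called developing maps. By analytic
continuation a developing map on a connected set is determined by its germ at one point
(\<open>developing_identity\<close>), and by compactness of the lamination each germ extends over a
ball of definite size, hence over the whole plane (\<open>global_extension\<close>). Therefore every unit tangent
vector \<open>w\<close> is the image of the base vector under exactly one developing map \<open>P\<close>, and the right action
is \<open>w g = dP (g w\<^sub>0)\<close> for the base vector \<open>w\<^sub>0\<close> (\<open>right_action_eq\<close>): independence of the choice of
steps, the group law and continuity all follow from this description.\<close>

section \<open>The upper half plane and its isometries\<close>

abbreviation "\<H> \<equiv> upper_half_plane"

lemma open_upper_half_plane: "open \<H>"
  by (simp add: upper_half_plane_def open_halfspace_Im_gt)

lemma convex_upper_half_plane: "convex \<H>"
  by (simp add: upper_half_plane_def convex_halfspace_Im_gt)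

lemma psl_denominator_nonzero:
  assumes "a * d - b * c = 1" "Im z > 0"
  shows "of_real c * z + of_real d \<noteq> 0"
proof
  assume eq: "of_real c * z + of_real d = 0"
  then have "c * Im z = 0" by (auto simp: complex_eq_iff)
  with assms have "c = 0" by simp
  with eq have "d = 0" by simp
  with \<open>c = 0\<close> assms show False by simp
qed

lemma psl_act_of:
  assumes "a * d - b * c = 1"
  shows "psl_act (psl_of a b c d) z = (of_real a * z + of_real b) / (of_real c * z + of_real d)"
  by (simp add: psl_act_psl_of[OF assms] moebius_def)

lemma Im_psl_act_of:
  assumes "a * d - b * c = 1" "Im z > 0"
  shows "Im (psl_act (psl_of a b c d) z) = Im z / (cmod (of_real c * z + of_real d))\<^sup>2"
proof -
  have nz: "of_real c * z + of_real d \<noteq> 0" by (rule psl_denominator_nonzero[OF assms])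
  have "Im ((of_real a * z + of_real b) / (of_real c * z + of_real d)) =
      ((a * d - b * c) * Im z) / (cmod (of_real c * z + of_real d))\<^sup>2"
    unfolding Im_divide cmod_power2 by (simp add: algebra_simps)
  then show ?thesis using assms by (simp add: psl_act_of)
qed

lemma psl_act_upper: "z \<in> \<H> \<Longrightarrow> psl_act g z \<in> \<H>"
  by (rule psl2_cases[of g])
     (auto simp: upper_half_plane_def Im_psl_act_of psl_denominator_nonzero)

lemma one_psl2_eq: "(1::psl2) = psl_of 1 0 0 1"
  unfolding one_psl2_def psl_of_def
  by (rule arg_cong[of _ _ abs_psl2]) (simp add: vec_eq_iff forall_2 mat_def)

lemma psl_act_one [simp]: "psl_act 1 z = z"
  by (simp add: one_psl2_eq psl_act_of)

lemma psl_det_mult: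
  fixes a :: real
  assumes "a * d - b * c = 1" "a' * d' - b' * c' = 1"
  shows "(a * a' + b * c') * (c * b' + d * d') - (a * b' + b * d') * (c * a' + d * c') = 1"
proof -
  have "(a * a' + b * c') * (c * b' + d * d') - (a * b' + b * d') * (c * a' + d * c')
      = (a * d - b * c) * (a' * d' - b' * c')" by (simp add: algebra_simps)
  with assms show ?thesis by simp
qed

lemma psl_act_mult:
  assumes "z \<in> \<H>"
  shows "psl_act (g * h) z = psl_act g (psl_act h z)"
proof -
  obtain a b c d where g: "a * d - b * c = 1" "g = psl_of a b c d" by (rule psl2_cases)
  obtain a' b' c' d' where h: "a' * d' - b' * c' = 1" "h = psl_of a' b' c' d'" by (rule psl2_cases)
  define n where "n = complex_of_real c' * z + of_real d'"
  define m where "m = complex_of_real a' * z + of_real b'"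
  have z: "Im z > 0" using assms by (simp add: upper_half_plane_def)
  have n: "n \<noteq> 0" unfolding n_def by (rule psl_denominator_nonzero[OF h(1) z])
  have "psl_act g (psl_act h z) = (of_real a * (m / n) + of_real b) / (of_real c * (m / n) + of_real d)"
    by (simp add: g h psl_act_of m_def n_def)
  also have "\<dots> = ((of_real a * m + of_real b * n) / n) / ((of_real c * m + of_real d * n) / n)"
    using n by (simp add: add_divide_distrib)
  also have "\<dots> = (of_real a * m + of_real b * n) / (of_real c * m + of_real d * n)"
    using n by simp
  also have "\<dots> = psl_act (g * h) z"
    unfolding g h psl_of_mult[OF g(1) h(1)] psl_act_of[OF psl_det_mult[OF g(1) h(1)]] m_def n_def
    by (simp add: algebra_simps)
  finally show ?thesis ..
qed

definition psl_inv :: "psl2 \<Rightarrow> psl2" where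
  "psl_inv g = (SOME h. g * h = 1 \<and> h * g = 1)"

lemma psl_inv: "g * psl_inv g = 1" "psl_inv g * g = 1"
proof -
  obtain a b c d where g: "a * d - b * c = 1" "g = psl_of a b c d" by (rule psl2_cases)
  have h: "d * a - (- b) * (- c) = 1" using g(1) by (simp add: algebra_simps)
  have "g * psl_of d (- b) (- c) a = 1 \<and> psl_of d (- b) (- c) a * g = 1"
    unfolding g(2) psl_of_mult[OF g(1) h] psl_of_mult[OF h g(1)] one_psl2_eq
    using g(1) by (simp add: algebra_simps)
  then have "g * psl_inv g = 1 \<and> psl_inv g * g = 1" unfolding psl_inv_def by (rule someI)
  then show "g * psl_inv g = 1" "psl_inv g * g = 1" by auto
qed

lemma psl_inv_cancel [simp]:
  "g * (psl_inv g * h) = h" "psl_inv g * (g * h) = h" "h * g * psl_inv g = h" "h * psl_inv g * g = h"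
  by (simp_all flip: mult.assoc add: psl_inv) (simp_all add: mult.assoc psl_inv)

lemma psl_act_inv:
  assumes "z \<in> \<H>"
  shows "psl_act g (psl_act (psl_inv g) z) = z" "psl_act (psl_inv g) (psl_act g z) = z"
  using assms by (simp_all flip: psl_act_mult add: psl_inv)

lemma DERIV_psl_act_of:
  assumes "a * d - b * c = 1" "Im z > 0"
  shows "(psl_act (psl_of a b c d) has_field_derivative 1 / (of_real c * z + of_real d)\<^sup>2) (at z)"
proof -
  have nz: "of_real c * z + of_real d \<noteq> 0" by (rule psl_denominator_nonzero[OF assms])
  have "complex_of_real a * d - b * c = 1"
    using assms(1) by (metis of_real_1 of_real_diff of_real_mult)
  then have num: "a * (c * z + d) - (a * z + b) * c = 1" by (simp add: algebra_simps)
  have "((\<lambda>z. (a * z + b) / (c * z + d)) has_field_derivative 1 / (c * z + d)\<^sup>2) (at z)"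
    by (rule derivative_eq_intros refl nz | simp add: num power2_eq_square)+
  moreover have "psl_act (psl_of a b c d) = (\<lambda>z::complex. (a * z + b) / (c * z + d))"
    by (simp add: psl_act_of[OF assms(1)] fun_eq_iff)
  ultimately show ?thesis by simp
qed

lemma psl_act_differentiable: "z \<in> \<H> \<Longrightarrow> psl_act g field_differentiable at z"
  by (rule psl2_cases[of g]) (auto simp: upper_half_plane_def field_differentiable_def intro: DERIV_psl_act_of)

lemma deriv_psl_act_of:
  assumes "a * d - b * c = 1" "Im z > 0"
  shows "deriv (psl_act (psl_of a b c d)) z = 1 / (of_real c * z + of_real d)\<^sup>2"
  by (rule DERIV_imp_deriv[OF DERIV_psl_act_of[OF assms]])

lemma cmod_deriv_psl_act:
  "z \<in> \<H> \<Longrightarrow> cmod (deriv (psl_act g) z) = Im (psl_act g z) / Im z"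
  by (rule psl2_cases[of g])
     (auto simp: upper_half_plane_def deriv_psl_act_of Im_psl_act_of norm_divide norm_power)

lemma deriv_psl_act_mult:
  assumes "z \<in> \<H>"
  shows "deriv (psl_act (g * h)) z = deriv (psl_act g) (psl_act h z) * deriv (psl_act h) z"
proof -
  have "(psl_act g \<circ> psl_act h has_field_derivative deriv (psl_act g) (psl_act h z) * deriv (psl_act h) z) (at z)"
    by (intro DERIV_chain field_differentiable_derivI[THEN DERIV_subset] psl_act_differentiable
          field_differentiable_derivI[OF psl_act_differentiable] psl_act_upper assms subset_UNIV)
  moreover have "eventually (\<lambda>z. z \<in> \<H>) (nhds z)"
    using assms by (intro eventually_nhds_in_open open_upper_half_plane)
  then have "eventually (\<lambda>z. (psl_act g \<circ> psl_act h) z = psl_act (g * h) z) (nhds z)"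
    by (rule eventually_mono) (simp add: psl_act_mult)
  ultimately have "(psl_act (g * h) has_field_derivative deriv (psl_act g) (psl_act h z) * deriv (psl_act h) z) (at z)"
    using DERIV_cong_ev by blast
  then show ?thesis by (rule DERIV_imp_deriv)
qed

lemma i_in_upper [simp]: "\<i> \<in> \<H>"
  by (simp add: upper_half_plane_def)

abbreviation unit_tangent_plane :: "(complex \<times> complex) set" where
  "unit_tangent_plane \<equiv> unit_tangent \<H>"

lemma psl_differential_in:
  "p \<in> unit_tangent_plane \<Longrightarrow> psl_differential g p \<in> unit_tangent_plane"
  by (auto simp: unit_tangent_def psl_differential_def psl_act_upper norm_mult cmod_deriv_psl_act)
     (auto simp: upper_half_plane_def)

lemma psl_differential_mult:
  "p \<in> unit_tangent_plane \<Longrightarrow> psl_differential (g * h) p = psl_differential g (psl_differential h p)"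
  by (auto simp: unit_tangent_def psl_differential_def psl_act_mult deriv_psl_act_mult)

lemma base_frame [simp]: "(\<i>, \<i>) \<in> unit_tangent_plane"
  by (simp add: unit_tangent_def)

lemma psl_frame_mult: "psl_frame (g * h) = psl_differential g (psl_frame h)"
  by (simp add: psl_frame_def psl_differential_mult)

lemma psl_frame_in [simp]: "psl_frame g \<in> unit_tangent_plane"
  by (simp add: psl_frame_def psl_differential_in)

lemma psl_frame_eq_iff [simp]: "psl_frame g = psl_frame h \<longleftrightarrow> g = h"
  using bij_betw_psl_frame by (auto simp: bij_betw_def inj_eq)

lemma psl_frame_cases:
  assumes "p \<in> unit_tangent_plane"
  obtains g where "p = psl_frame g"
  using assms bij_betw_psl_frame by (auto simp: bij_betw_def)

lemma psl_mult_right_cancel: "g * k = h * k \<longleftrightarrow> g = (h::psl2)"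
  by (metis psl_inv_cancel(3))

lemma psl_differential_eq_iff:
  assumes "p \<in> unit_tangent_plane"
  shows "psl_differential g p = psl_differential h p \<longleftrightarrow> g = h"
proof -
  obtain k where "p = psl_frame k" using assms by (rule psl_frame_cases)
  then show ?thesis by (simp flip: psl_frame_mult add: psl_mult_right_cancel)
qed

lemma fst_psl_frame: "fst (psl_frame g) = psl_act g \<i>"
  by (simp add: psl_frame_def psl_differential_def)

lemma frame_one: "psl_frame 1 = (\<i>, \<i>)"
proof -
  have "deriv (psl_act 1) \<i> = 1"
    by (simp add: one_psl2_eq deriv_psl_act_of)
  then show ?thesis by (simp add: psl_frame_def psl_differential_def)
qed

lemma psl_eq_germ:
  assumes z: "z \<in> \<H>"
    and eq: "eventually (\<lambda>z'. psl_act g z' = psl_act h z') (nhds z)"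
  shows "g = h"
proof -
  have "deriv (psl_act g) z = deriv (psl_act h) z" by (rule deriv_cong_ev[OF eq refl])
  moreover have "psl_act g z = psl_act h z" using eq by (rule eventually_nhds_x_imp_x)
  moreover have "(z, of_real (Im z)) \<in> unit_tangent_plane"
    using z by (simp add: unit_tangent_def upper_half_plane_def)
  ultimately show ?thesis
    using psl_differential_eq_iff[of "(z, of_real (Im z))" g h] by (simp add: psl_differential_def)
qed

lemma isCont_psl_act: "z \<in> \<H> \<Longrightarrow> isCont (psl_act g) z"
  by (rule field_differentiable_imp_continuous_at[OF psl_act_differentiable])

lemma continuous_on_psl_act: "S \<subseteq> \<H> \<Longrightarrow> continuous_on S (psl_act g)"
  by (auto intro!: continuous_at_imp_continuous_on isCont_psl_act)

lemma eventually_psl_act: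
  assumes "z \<in> \<H>" "eventually P (nhds (psl_act g z))"
  shows "eventually (\<lambda>z. P (psl_act g z)) (nhds z)"
proof -
  have "filterlim (psl_act g) (nhds (psl_act g z)) (nhds z)"
    using isCont_psl_act[OF assms(1), of g] by (simp add: continuous_at tendsto_at_iff_tendsto_nhds)
  with assms(2) show ?thesis by (rule eventually_compose_filterlim)
qed

lemma open_psl_vimage:
  assumes "open V"
  shows "open {z \<in> \<H>. psl_act g z \<in> V}"
  using continuous_on_open_vimage[OF open_upper_half_plane, of "psl_act g"] assms
    continuous_on_psl_act[of \<H> g]
  by (simp add: vimage_def Collect_conj_eq Int_commute)

lemma psl_act_image_eq:
  assumes "V \<subseteq> \<H>"
  shows "psl_act g ` V = {z \<in> \<H>. psl_act (psl_inv g) z \<in> V}"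
  using assms by (force simp: psl_act_inv psl_act_upper image_iff dest: subsetD)

lemma open_psl_image:
  assumes "open V" "V \<subseteq> \<H>"
  shows "open (psl_act g ` V)"
  by (simp add: psl_act_image_eq assms open_psl_vimage)

lemma connected_psl_vimage:
  assumes "connected V" "V \<subseteq> \<H>"
  shows "connected {z \<in> \<H>. psl_act g z \<in> V}"
proof -
  have "{z \<in> \<H>. psl_act g z \<in> V} = psl_act (psl_inv g) ` V"
    using assms(2) by (force simp: psl_act_inv psl_act_upper image_iff dest: subsetD)
  then show ?thesis
    using assms by (simp add: connected_continuous_image continuous_on_psl_act)
qed


text \<open>Measured in units of the imaginary part, distances from \<open>z\<close> up to \<open>1 / 2\<close> are at most doubled by an
isometry, because \<open>\<bar>c z' + d\<bar>\<close> is at least half of \<open>\<bar>c z + d\<bar>\<close>. Euclidean balls whose radius is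
proportional to the height of the center can therefore take the place of hyperbolic balls.\<close>

lemma psl_act_dist_le:
  assumes z: "z \<in> \<H>" and d: "dist z z' \<le> Im z / 2"
  shows "z' \<in> \<H>" "dist (psl_act g z) (psl_act g z') \<le> 2 * dist z z' * (Im (psl_act g z) / Im z)"
proof -
  obtain a b c e where g: "a * e - b * c = 1" "g = psl_of a b c e" by (rule psl2_cases)
  have y: "Im z > 0" using z by (simp add: upper_half_plane_def)
  have "\<bar>Im (z - z')\<bar> \<le> Im z / 2"
    using abs_Im_le_cmod[of "z - z'"] d by (simp add: dist_norm)
  then have "\<bar>Im z - Im z'\<bar> \<le> Im z / 2" by simp
  then have y': "Im z' > 0" using y by linarith
  then show "z' \<in> \<H>" by (simp add: upper_half_plane_def)
  define n n' where "n = complex_of_real c * z + of_real e" and "n' = complex_of_real c * z' + of_real e"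
  have nz: "n \<noteq> 0" "n' \<noteq> 0"
    unfolding n_def n'_def by (rule psl_denominator_nonzero[OF g(1)]; fact)+
  have det: "complex_of_real a * e - b * c = 1"
    using g(1) by (metis of_real_1 of_real_diff of_real_mult)
  have "psl_act g z - psl_act g z' = ((a * z + b) * n' - (a * z' + b) * n) / (n * n')"
    using nz by (simp add: g psl_act_of n_def n'_def diff_frac_eq)
  also have "(a * z + b) * n' - (a * z' + b) * n = (complex_of_real a * e - b * c) * (z - z')"
    by (simp add: n_def n'_def algebra_simps)
  finally have diff: "psl_act g z - psl_act g z' = (z - z') / (n * n')" unfolding det mult_1_left .
  have "cmod (n - n') = \<bar>c\<bar> * dist z z'"
    by (simp add: n_def n'_def dist_norm flip: norm_mult right_diff_distrib)
       (simp add: norm_mult flip: right_diff_distrib)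
  also have "\<dots> \<le> \<bar>c\<bar> * (Im z / 2)" by (intro mult_left_mono d) simp
  also have "\<bar>c\<bar> * Im z = \<bar>Im n\<bar>" using y by (simp add: n_def abs_mult)
  then have "\<bar>c\<bar> * (Im z / 2) \<le> cmod n / 2" using abs_Im_le_cmod[of n] by simp
  finally have "cmod n / 2 \<le> cmod n'" using norm_triangle_sub[of n n'] by simp
  then have "cmod n * (cmod n / 2) \<le> cmod n * cmod n'" by (intro mult_left_mono) auto
  then have "cmod (z - z') / (cmod n * cmod n') \<le> cmod (z - z') / (cmod n * (cmod n / 2))"
    using nz by (intro divide_left_mono mult_pos_pos) auto
  also have "\<dots> = 2 * dist z z' * (Im (psl_act g z) / Im z)"
    unfolding g Im_psl_act_of[OF g(1) y] n_def[symmetric] using y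
    by (simp add: dist_norm power2_eq_square)
  finally show "dist (psl_act g z) (psl_act g z') \<le> 2 * dist z z' * (Im (psl_act g z) / Im z)"
    by (simp add: dist_norm diff norm_divide norm_mult)
qed

text \<open>The action of \<open>g\<close> depends continuously on the frame \<open>psl_frame g\<close>, although a matrix of \<open>g\<close> can be
recovered from the frame only up to sign. With \<open>s = c \<i> + d\<close> for the bottom row \<open>(c, d)\<close>, the
frame is \<open>(z, \<i> / s\<^sup>2)\<close>, the top row satisfies \<open>a \<i> + b = z s\<close>, and
\<open>2 (a z' + b) = z s (1 - \<i> z') + cnj (z s) (1 + \<i> z')\<close>. Dividing numerator and denominator of
\<open>g z'\<close> by \<open>s\<close> leaves only \<open>z\<close> and \<open>cnj s / s\<close>, which are functions of the frame. In this form
\<open>frame_mult\<close> computes \<open>psl_differential g\<close>.\<close>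

definition frame_denominator :: "complex \<times> complex \<Rightarrow> complex \<Rightarrow> complex" where
  "frame_denominator p z' = (1 - \<i> * z') + snd p / (\<i> * of_real (Im (fst p))) * (1 + \<i> * z')"

definition frame_mult :: "complex \<times> complex \<Rightarrow> complex \<times> complex \<Rightarrow> complex \<times> complex" where
  "frame_mult p q =
     ((fst p * (1 - \<i> * fst q) + cnj (fst p) * (snd p / (\<i> * of_real (Im (fst p)))) * (1 + \<i> * fst q))
        / frame_denominator p (fst q),
      4 * snd p / (\<i> * (frame_denominator p (fst q))\<^sup>2) * snd q)"

lemma psl_differential_eq_frame_mult:
  assumes q: "q \<in> unit_tangent_plane"
  shows "psl_differential g q = frame_mult (psl_frame g) q"
    and "frame_denominator (psl_frame g) (fst q) \<noteq> 0"
proof -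
  obtain a b c d where g: "a * d - b * c = 1" "g = psl_of a b c d" by (rule psl2_cases)
  define w where "w = fst q"
  have w: "Im w > 0" using q by (auto simp: w_def unit_tangent_def upper_half_plane_def)
  define s where "s = c * \<i> + complex_of_real d"
  define r where "r = a * \<i> + complex_of_real b"
  have s: "s \<noteq> 0" using psl_denominator_nonzero[OF g(1), of \<i>] by (simp add: s_def)
  have p: "psl_frame g = (r / s, \<i> / s\<^sup>2)"
    unfolding g psl_frame_psl_of[OF g(1)] s_def r_def ..
  have "Im (r / s) = 1 / (cmod s)\<^sup>2"
    using Im_psl_act_of[OF g(1), of \<i>] by (simp add: psl_act_of g r_def s_def)
  then have "\<i> / s\<^sup>2 / (\<i> * of_real (Im (r / s))) = of_real ((cmod s)\<^sup>2) / s\<^sup>2"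
    using s by simp
  also have "\<dots> = cnj s / s"
    unfolding complex_norm_square using s by (simp add: power2_eq_square)
  finally have e: "\<i> / s\<^sup>2 / (\<i> * of_real (Im (r / s))) = cnj s / s" .
  have den: "frame_denominator (psl_frame g) w = 2 * (c * w + d) / s"
  proof -
    have "frame_denominator (psl_frame g) w = ((1 - \<i> * w) * s + cnj s * (1 + \<i> * w)) / s"
      using s unfolding frame_denominator_def p fst_conv snd_conv e by (simp add: field_simps)
    also have "(1 - \<i> * w) * s + cnj s * (1 + \<i> * w) = 2 * (c * w + d)"
      by (simp add: s_def algebra_simps)
    finally show ?thesis .
  qed
  have nz: "complex_of_real c * w + d \<noteq> 0" by (rule psl_denominator_nonzero[OF g(1) w])
  then show "frame_denominator (psl_frame g) (fst q) \<noteq> 0"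
    using s by (simp only: den w_def[symmetric] divide_eq_0_iff mult_eq_0_iff) simp
  have num: "r / s * (1 - \<i> * w) + cnj (r / s) * (cnj s / s) * (1 + \<i> * w) = 2 * (a * w + b) / s"
  proof -
    have "r / s * (1 - \<i> * w) + cnj (r / s) * (cnj s / s) * (1 + \<i> * w)
        = (r * (1 - \<i> * w) + cnj r * (1 + \<i> * w)) / s"
      using s by (simp add: add_divide_distrib)
    also have "r * (1 - \<i> * w) + cnj r * (1 + \<i> * w) = 2 * (a * w + b)"
      by (simp add: r_def algebra_simps)
    finally show ?thesis .
  qed
  have "frame_mult (psl_frame g) q =
      ((2 * (a * w + b) / s) / (2 * (c * w + d) / s),
       4 * (\<i> / s\<^sup>2) / (\<i> * (2 * (c * w + d) / s)\<^sup>2) * snd q)"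
    unfolding frame_mult_def w_def[symmetric] den unfolding p fst_conv snd_conv e num ..
  also have "\<dots> = ((a * w + b) / (c * w + d), 1 / (c * w + d)\<^sup>2 * snd q)"
  proof -
    have "(2 * m / s) / (2 * n / s) = m / n \<and>
        4 * (\<i> / s\<^sup>2) / (\<i> * (2 * n / s)\<^sup>2) * snd q = 1 / n\<^sup>2 * snd q" if "n \<noteq> 0" for m n
      using s that by (simp add: field_simps power2_eq_square)
    from this[OF nz] show ?thesis by blast
  qed
  also have "\<dots> = psl_differential g q"
    by (simp add: psl_differential_def case_prod_unfold g psl_act_of deriv_psl_act_of w w_def[symmetric])
  finally show "psl_differential g q = frame_mult (psl_frame g) q" ..
qed

lemma continuous_on_frame_mult:
  "continuous_on (unit_tangent_plane \<times> unit_tangent_plane) (\<lambda>(p, q). frame_mult p q)"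
proof -
  have nz: "frame_denominator p (fst q) \<noteq> 0" "Im (fst p) \<noteq> 0"
    if "p \<in> unit_tangent_plane" "q \<in> unit_tangent_plane" for p q
  proof -
    obtain g where "p = psl_frame g" using \<open>p \<in> _\<close> by (rule psl_frame_cases)
    then show "frame_denominator p (fst q) \<noteq> 0"
      using psl_differential_eq_frame_mult(2) that by blast
    show "Im (fst p) \<noteq> 0" using that by (auto simp: unit_tangent_def upper_half_plane_def)
  qed
  define e where "e p = snd p / (\<i> * complex_of_real (Im (fst p)))" for p :: "complex \<times> complex"
  let ?S = "unit_tangent_plane \<times> unit_tangent_plane"
  have e: "continuous_on ?S (\<lambda>x. e (fst x))"
    unfolding e_def by (intro continuous_intros) (auto dest: nz)
  have den: "continuous_on ?S (\<lambda>x. frame_denominator (fst x) (fst (snd x)))"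
    unfolding frame_denominator_def e_def[symmetric] by (intro continuous_intros e)
  have "continuous_on ?S (\<lambda>x. frame_mult (fst x) (snd x))"
    unfolding frame_mult_def e_def[symmetric]
    by (rule continuous_intros e den ballI | use nz in force)+
  then show ?thesis by (simp add: case_prod_unfold)
qed

text \<open>The derivative is an algebraic expression in two values of the isometry, because
\<open>(g y' - g y) / (g y' - cnj (g y))\<close> differs from the same expression without \<open>g\<close> only by the factor
\<open>(c (cnj y) + d) / (c y + d)\<close>. So a family of isometries that is jointly continuous has jointly
continuous derivatives.\<close>

lemma deriv_psl_act_two_points:
  assumes y: "y \<in> \<H>" and y': "y' \<in> \<H>" "y' \<noteq> y"
  shows "deriv (psl_act g) y = of_real (Im (psl_act g y) / Im y) *
    ((psl_act g y' - psl_act g y) / (psl_act g y' - cnj (psl_act g y))) * ((y' - cnj y) / (y' - y))"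
proof -
  obtain a b c d where g: "a * d - b * c = 1" "g = psl_of a b c d" by (rule psl2_cases)
  have i: "Im y > 0" "Im y' > 0" using y y' by (auto simp: upper_half_plane_def)
  define n n' where "n = complex_of_real c * y + of_real d" and "n' = complex_of_real c * y' + of_real d"
  have nz: "n \<noteq> 0" "n' \<noteq> 0" "cnj n \<noteq> 0" 
    unfolding n_def n'_def using psl_denominator_nonzero[OF g(1)] i by (auto simp: complex_cnj_zero_iff simp del: complex_cnj_add)
  have det: "complex_of_real a * d - b * c = 1"
    using g(1) by (metis of_real_1 of_real_diff of_real_mult)
  have act: "psl_act g y = (a * y + b) / n" "psl_act g y' = (a * y' + b) / n'"
    by (simp_all add: g psl_act_of n_def n'_def)
  have act_cnj: "cnj (psl_act g y) = (a * cnj y + b) / cnj n"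
    by (simp add: act)
  have "(a * y' + b) / n' - (a * y + b) / n = ((a * y' + b) * n - (a * y + b) * n') / (n' * n)"
    using nz by (simp add: diff_frac_eq)
  also have "(a * y' + b) * n - (a * y + b) * n' = (complex_of_real a * d - b * c) * (y' - y)"
    by (simp add: n_def n'_def algebra_simps)
  finally have 1: "psl_act g y' - psl_act g y = (y' - y) / (n' * n)" unfolding act det mult_1_left .
  have "(a * y' + b) / n' - (a * cnj y + b) / cnj n = ((a * y' + b) * cnj n - (a * cnj y + b) * n') / (n' * cnj n)"
    using nz by (simp add: diff_frac_eq)
  also have "(a * y' + b) * cnj n - (a * cnj y + b) * n' = (complex_of_real a * d - b * c) * (y' - cnj y)"
    by (simp add: n_def n'_def algebra_simps)
  finally have 2: "psl_act g y' - cnj (psl_act g y) = (y' - cnj y) / (n' * cnj n)"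
    unfolding act(2) act_cnj det mult_1_left .
  have ne: "y' - y \<noteq> 0" "y' - cnj y \<noteq> 0" using y' i by (auto simp: complex_eq_iff)
  have 3: "Im (psl_act g y) / Im y = 1 / (cmod n)\<^sup>2"
    using i by (simp add: g Im_psl_act_of n_def)
  have 4: "complex_of_real (1 / (cmod n)\<^sup>2) = 1 / (n * cnj n)"
    by (metis complex_norm_square of_real_1 of_real_divide)
  have "of_real (Im (psl_act g y) / Im y) *
    ((psl_act g y' - psl_act g y) / (psl_act g y' - cnj (psl_act g y))) * ((y' - cnj y) / (y' - y))
     = 1 / (n * cnj n) * (((y' - y) / (n' * n)) / ((y' - cnj y) / (n' * cnj n))) * ((y' - cnj y) / (y' - y))"
    unfolding 1 2 3 4 ..
  also have "\<dots> = 1 / n\<^sup>2"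
    using nz ne by (simp add: power2_eq_square)
  also have "\<dots> = deriv (psl_act g) y"
    using i by (simp add: g deriv_psl_act_of n_def)
  finally show ?thesis ..
qed

abbreviation psl_of_frame :: "complex \<times> complex \<Rightarrow> psl2" where
  "psl_of_frame \<equiv> inv psl_frame"

lemma psl_of_frame [simp]: "psl_of_frame (psl_frame g) = g"
  using bij_betw_psl_frame by (simp add: bij_betw_def)

lemma psl_frame_of_frame: "p \<in> unit_tangent_plane \<Longrightarrow> psl_frame (psl_of_frame p) = p"
  by (erule psl_frame_cases) simp

text \<open>Stands for the topology of \<open>PSL(2,\<real>)\<close>, with \<open>g\<close> represented by \<open>psl_frame g\<close>.\<close>

abbreviation psl_topology :: "(complex \<times> complex) topology" where
  "psl_topology \<equiv> top_of_set unit_tangent_plane"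

section \<open>Subgroups and conjugacy classes of \<open>PSL(2,\<real>)\<close>\<close>

definition geodesic_subgroup :: "real \<Rightarrow> psl2" where
  "geodesic_subgroup r = psl_of (exp r) 0 0 (exp (- r))"

lemma geodesic_subgroup_add:
  "geodesic_subgroup (r + s) = geodesic_subgroup r * geodesic_subgroup s"
  unfolding geodesic_subgroup_def
  by (subst psl_of_mult) (simp_all flip: exp_add)

lemma geodesic_subgroup_0 [simp]: "geodesic_subgroup 0 = 1"
  by (simp add: geodesic_subgroup_def one_psl2_eq)

lemma horocycle_subgroup_add:
  "horocycle_subgroup (s + t) = horocycle_subgroup s * horocycle_subgroup t"
  unfolding horocycle_subgroup_def by (subst psl_of_mult) (simp_all add: algebra_simps)

lemma horocycle_subgroup_0 [simp]: "horocycle_subgroup 0 = 1"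
  by (simp add: horocycle_subgroup_def one_psl2_eq)

lemma horocycle_geodesic_commute:
  "horocycle_subgroup t * geodesic_subgroup r = geodesic_subgroup r * horocycle_subgroup (t * exp (- 2 * r))"
proof -
  have 1: "exp r * (t * exp (- 2 * r)) = t * exp (- r)"
    by (simp add: mult_ac flip: exp_add)
  have 2: "horocycle_subgroup t * geodesic_subgroup r = psl_of (exp r) (t * exp (- r)) 0 (exp (- r))"
    unfolding horocycle_subgroup_def geodesic_subgroup_def
    by (subst psl_of_mult) (simp_all flip: exp_add)
  have "geodesic_subgroup r * horocycle_subgroup s = psl_of (exp r) (exp r * s) 0 (exp (- r))" for s
    unfolding horocycle_subgroup_def geodesic_subgroup_def
    by (subst psl_of_mult) (simp_all flip: exp_add)
  then show ?thesis by (simp only: 1 2)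
qed

lemma affine_group_eq:
  "affine_group = {horocycle_subgroup t * geodesic_subgroup r | t r. True}"
proof (intro equalityI subsetI)
  fix g assume "g \<in> affine_group"
  then obtain a b where g: "g = psl_of a b 0 (inverse a)" "a > 0" by (auto simp: affine_group_def)
  have "g = horocycle_subgroup (a * b) * geodesic_subgroup (ln a)"
    unfolding horocycle_subgroup_def geodesic_subgroup_def using g
    by (subst psl_of_mult) (simp_all add: exp_minus field_simps)
  then show "g \<in> {horocycle_subgroup t * geodesic_subgroup r | t r. True}" by blast
next
  fix g assume "g \<in> {horocycle_subgroup t * geodesic_subgroup r | t r. True}"
  then obtain t r where g: "g = horocycle_subgroup t * geodesic_subgroup r" by blast
  have "g = psl_of (exp r) (t * exp (- r)) 0 (inverse (exp r))"
    unfolding g horocycle_subgroup_def geodesic_subgroup_def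
    by (subst psl_of_mult) (simp_all add: exp_minus)
  moreover have "0 < exp r" by simp
  ultimately show "g \<in> affine_group" unfolding affine_group_def by blast
qed

lemma psl_act_horocycle: "psl_act (horocycle_subgroup t) z = z + of_real t"
  by (simp add: horocycle_subgroup_def psl_act_of)

lemma psl_act_geodesic: "psl_act (geodesic_subgroup r) z = of_real (exp (2 * r)) * z"
proof -
  have "psl_act (geodesic_subgroup r) z = of_real (exp r) * z / of_real (exp (- r))"
    unfolding geodesic_subgroup_def by (subst psl_act_of) (simp_all flip: exp_add)
  also have "\<dots> = of_real (exp r / exp (- r)) * z" by simp
  also have "exp r / exp (- r) = exp (2 * r)" by (simp flip: exp_diff)
  finally show ?thesis .
qed

lemma one_parameter_closed:
  fixes f :: "real \<Rightarrow> psl2"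
  assumes add: "\<And>s t. f (s + t) = f s * f t" and "f 0 = 1"
    and mult: "\<And>g h. P g \<Longrightarrow> P h \<Longrightarrow> P (g * h)"
    and small: "e > 0" "\<And>t. \<bar>t\<bar> < e \<Longrightarrow> P (f t)"
  shows "P (f t)"
proof -
  obtain n :: nat where n: "\<bar>t\<bar> / e < n" using reals_Archimedean2 by blast
  have "\<bar>t\<bar> / e \<ge> 0" using small(1) by simp
  with n have npos: "real n > 0" by linarith
  have "\<bar>t / n\<bar> < e" using n npos small(1) by (simp add: field_simps)
  then have 1: "P (f (t / n))" by (rule small(2))
  have "P (f (real m * (t / n)))" for m
  proof (induction m)
    case 0
    then show ?case using small(2)[of 0] small(1) by simp
  next
    case (Suc m)
    have "f (real (Suc m) * (t / n)) = f (t / n + real m * (t / n))" by (simp add: algebra_simps add_divide_distrib)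
    also have "\<dots> = f (t / n) * f (real m * (t / n))" by (rule add)
    finally show ?case using mult[OF 1 Suc] by simp
  qed
  from this[of n] show ?thesis using npos by simp
qed

lemma upper_affine_transitive:
  assumes "z \<in> \<H>"
  obtains t r where "psl_act (horocycle_subgroup t * geodesic_subgroup r) \<i> = z"
proof
  have "Im z > 0" using assms by (simp add: upper_half_plane_def)
  then show "psl_act (horocycle_subgroup (Re z) * geodesic_subgroup (ln (Im z) / 2)) \<i> = z"
    by (simp add: psl_act_mult psl_act_horocycle psl_act_geodesic complex_eq_iff)
qed

text \<open>The set of all \<open>g\<close> that move \<open>\<i>\<close> by less than \<open>e\<close> contains the rotations about \<open>\<i>\<close>, and powers of
its elements exhaust the horocycle and geodesic subgroups. These subgroups act transitively on the
plane, so together with the rotations they generate the group.\<close>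

lemma psl2_generated_near_stabilizer:
  assumes mult: "\<And>g h. P g \<Longrightarrow> P h \<Longrightarrow> P (g * h)"
    and small: "e > 0" "\<And>g. dist \<i> (psl_act g \<i>) < e \<Longrightarrow> P g"
  shows "P g"
proof -
  have 1: "P (horocycle_subgroup t)" for t
  proof (rule one_parameter_closed[of horocycle_subgroup P e])
    show "P (horocycle_subgroup t)" if "\<bar>t\<bar> < e" for t
      using that by (intro small(2)) (simp add: psl_act_horocycle dist_norm)
  qed (simp_all add: horocycle_subgroup_add mult small(1))
  have "((\<lambda>r. of_real (exp (2 * r)) * \<i>) \<longlongrightarrow> of_real (exp (2 * 0)) * \<i>) (at (0::real))"
    by (intro tendsto_intros)
  then have "eventually (\<lambda>r. dist (of_real (exp (2 * r)) * \<i>) (of_real (exp (2 * 0)) * \<i>) < e) (at (0::real))"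
    using small(1) by (rule tendstoD)
  then obtain d where d: "d > 0"
    "\<And>r. r \<noteq> 0 \<Longrightarrow> dist r 0 < d \<Longrightarrow> dist (of_real (exp (2 * r)) * \<i>) (of_real (exp (2 * 0)) * \<i>) < e"
    unfolding eventually_at by blast
  have "P (geodesic_subgroup r)" if "\<bar>r\<bar> < d" for r
  proof (rule small(2))
    show "dist \<i> (psl_act (geodesic_subgroup r) \<i>) < e"
      using d(2)[of r] that small(1) by (cases "r = 0") (auto simp: psl_act_geodesic dist_commute)
  qed
  note near_1 = this
  have 2: "P (geodesic_subgroup r)" for r
    by (rule one_parameter_closed[of geodesic_subgroup P d])
       (simp_all add: geodesic_subgroup_add mult d(1) near_1)
  obtain t r where "psl_act (horocycle_subgroup t * geodesic_subgroup r) \<i> = psl_act g \<i>"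
    using upper_affine_transitive[OF psl_act_upper[OF i_in_upper]] .
  then obtain b where b: "P b" "psl_act b \<i> = psl_act g \<i>" using mult 1 2 by blast
  have "psl_act (psl_inv b * g) \<i> = \<i>"
    by (simp add: psl_act_mult psl_act_inv flip: b(2))
  then have "P (psl_inv b * g)" using small by simp
  from mult[OF b(1) this] show ?thesis by simp
qed

lemma psl_of_minus:
  assumes "a * d - b * c = 1"
  shows "psl_of (- a) (- b) (- c) (- d) = psl_of a b c d"
  using assms by (subst psl_of_eq_iff) auto

lemma upper_triangular_conjugate:
  assumes ad: "a * d = 1" and ne: "psl_of a b 0 d \<noteq> 1"
  obtains (translation) t where "t \<noteq> 0" "psl_of a b 0 d = horocycle_subgroup t"
  | (dilation) k r where "r \<noteq> 0" "psl_inv k * psl_of a b 0 d * k = geodesic_subgroup r"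
proof -
  obtain a' b' d' where g: "a' * d' = 1" "a' > 0" "psl_of a b 0 d = psl_of a' b' 0 d'"
  proof (cases "a > 0")
    case True
    with ad that show ?thesis by blast
  next
    case False
    then have "- a > 0" using ad by (cases "a = 0") auto
    moreover have "psl_of a b 0 d = psl_of (- a) (- b) 0 (- d)"
      using psl_of_minus[of a d b 0] ad by simp
    ultimately show ?thesis using ad that[of "- a" "- d" "- b"] by simp
  qed
  have d': "d' = exp (- ln a')" using g by (simp add: exp_minus field_simps)
  show ?thesis
  proof (cases "a' = 1")
    case True
    then have eq: "psl_of a b 0 d = horocycle_subgroup b'"
      using g by (simp add: horocycle_subgroup_def)
    with ne have "b' \<noteq> 0" by auto
    with eq show ?thesis by (rule translation[rotated])
  next
    case False
    have "a' + 1 \<noteq> 0" "a' - 1 \<noteq> 0" using False g(2) by auto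
    then have "(a' - 1) * (a' + 1) \<noteq> 0" by simp
    then have a2: "1 - a' * a' \<noteq> 0" by (simp add: algebra_simps)
    define x where "x = a' * b' / (1 - a' * a')"
    have x: "x * (1 - a' * a') = a' * b'" using a2 by (simp add: x_def)
    have "a' * (a' * x + b') = x" using x by (simp add: algebra_simps)
    also have "x = a' * (x * d')" using g(1) by (metis mult.left_commute mult.right_neutral)
    finally have "a' * (a' * x + b') = a' * (x * d')" .
    then have x': "a' * x + b' = x * d'" using g(2) by simp
    have "psl_of a' b' 0 d' * psl_of 1 x 0 1 = psl_of a' (x * d') 0 d'"
      using g(1) x' by (subst psl_of_mult) simp_all
    also have "\<dots> = psl_of 1 x 0 1 * psl_of a' 0 0 d'"
      using g(1) by (subst psl_of_mult) simp_all
    also have "psl_of a' 0 0 d' = geodesic_subgroup (ln a')"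
      using g by (simp add: geodesic_subgroup_def d')
    finally have "psl_inv (psl_of 1 x 0 1) * psl_of a b 0 d * psl_of 1 x 0 1 = geodesic_subgroup (ln a')"
      by (simp add: g(3) mult.assoc)
    moreover have "ln a' \<noteq> 0" using False g(2) by simp
    ultimately show ?thesis by (intro dilation)
  qed
qed

text \<open>The fixed points of \<open>g\<close> are the roots of \<open>c z\<^sup>2 + (d - a) z - b\<close>. If \<open>c \<noteq> 0\<close> and they are not
real, one of them lies in the upper half plane. A real root is moved to infinity by conjugation, which
makes \<open>g\<close> affine, as it is from the start if \<open>c = 0\<close>. An affine map is a translation or, after moving its other fixed point to \<open>0\<close>, a dilation.\<close>

lemma psl2_trichotomy:
  assumes "g \<noteq> 1"
  obtains (elliptic) z where "z \<in> \<H>" "psl_act g z = z"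
  | (parabolic) k t where "t \<noteq> 0" "psl_inv k * g * k = horocycle_subgroup t"
  | (hyperbolic) k r where "r \<noteq> 0" "psl_inv k * g * k = geodesic_subgroup r"
proof -
  obtain a b c d where g: "a * d - b * c = 1" "g = psl_of a b c d" by (rule psl2_cases)
  have triangular: thesis if "a * d = 1" "psl_inv k * g * k = psl_of a b 0 d" for k a b d
  proof -
    have "psl_of a b 0 d \<noteq> 1"
    proof
      assume "psl_of a b 0 d = 1"
      then have "k * (psl_inv k * g * k) * psl_inv k = 1" using that by (simp add: psl_inv)
      then have "g = 1" by (simp add: mult.assoc psl_inv)
      with assms show False by simp
    qed
    from that(1) this show thesis
    proof (cases rule: upper_triangular_conjugate)
      case (translation t)
      then show ?thesis using that by (intro parabolic[of t k]) auto
    next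
      case (dilation k' r)
      have "psl_inv (k * k') = psl_inv k' * psl_inv k"
        by (metis mult.assoc mult_1_left psl_inv(2) psl_inv_cancel(3) psl_inv_cancel(4))
      then have "psl_inv (k * k') * g * (k * k') = psl_inv k' * (psl_inv k * g * k) * k'"
        by (simp only: mult.assoc)
      also have "\<dots> = geodesic_subgroup r" unfolding that(2) by (rule dilation(2))
      finally show ?thesis using dilation(1) by (intro hyperbolic)
    qed
  qed
  show thesis
  proof (cases "c = 0")
    case True
    then have "psl_inv 1 * g * 1 = psl_of a b 0 d" using psl_inv(2)[of 1] g(2) by simp
    then show ?thesis using g True by (intro triangular[of a d 1 b]) auto
  next
    case c: False
    define D where "D = (d - a)\<^sup>2 + 4 * b * c"
    show ?thesis
    proof (cases "D \<ge> 0")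
      case True
      define x where "x = (a - d + sqrt D) / (2 * c)"
      have cx: "2 * c * x = a - d + sqrt D" using c by (simp add: x_def)
      have "4 * c * (c * x\<^sup>2 + (d - a) * x - b) = (2 * c * x)\<^sup>2 + 2 * (d - a) * (2 * c * x) - 4 * b * c"
        by (simp add: algebra_simps power2_eq_square)
      also have "\<dots> = (sqrt D)\<^sup>2 - D"
        unfolding cx D_def by (simp add: algebra_simps power2_eq_square)
      also have "\<dots> = 0" using True by simp
      finally have "c * x\<^sup>2 + (d - a) * x - b = 0" using c by simp
      then have x: "x * (c * x + d) = a * x + b" by (simp add: algebra_simps power2_eq_square)
      define k where "k = psl_of x (- 1) 1 0"
      have "(c * x + d) * (a - c * x) = a * d + c * (a * x) - c * (x * (c * x + d))"
        by (simp add: algebra_simps)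
      then have det: "(c * x + d) * (a - c * x) = 1"
        unfolding x using g(1) by (simp add: algebra_simps)
      have "k * psl_of (c * x + d) (- c) 0 (a - c * x) = psl_of (x * (c * x + d)) (- a) (c * x + d) (- c)"
        unfolding k_def using det by (subst psl_of_mult) simp_all
      also have "\<dots> = g * k"
        unfolding k_def g(2) x using g(1) by (subst psl_of_mult) simp_all
      finally have "psl_inv k * g * k = psl_of (c * x + d) (- c) 0 (a - c * x)"
        by (metis mult.assoc psl_inv_cancel(2))
      with det show ?thesis by (rule triangular)
    next
      case False
      define z where "z = Complex ((a - d) / (2 * c)) (sqrt (- D) / (2 * \<bar>c\<bar>))"
      have z: "Im z > 0" using False c by (simp add: z_def)
      have "(Im z)\<^sup>2 = - D / (4 * c\<^sup>2)"
        using False by (simp add: z_def power_divide power_mult_distrib)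
      then have im2: "4 * c\<^sup>2 * (Im z)\<^sup>2 = - D" using c by simp
      have re: "2 * c * Re z = a - d" using c by (simp add: z_def)
      have "4 * c * (c * ((Re z)\<^sup>2 - (Im z)\<^sup>2) + (d - a) * Re z - b)
          = (2 * c * Re z)\<^sup>2 - 4 * c\<^sup>2 * (Im z)\<^sup>2 + 2 * (d - a) * (2 * c * Re z) - 4 * b * c"
        by (simp add: algebra_simps power2_eq_square)
      also have "\<dots> = 0" unfolding re im2 D_def by (simp add: algebra_simps power2_eq_square)
      finally have 1: "c * ((Re z)\<^sup>2 - (Im z)\<^sup>2) + (d - a) * Re z - b = 0" using c by simp
      have 2: "2 * c * Re z * Im z + (d - a) * Im z = 0" unfolding re by (simp add: algebra_simps)
      have "z * (c * z + d) = a * z + b"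
        using 1 2 by (simp add: complex_eq_iff algebra_simps power2_eq_square)
      then have "psl_act g z = z"
        unfolding g(2) psl_act_of[OF g(1)]
        by (metis nonzero_mult_div_cancel_right psl_denominator_nonzero[OF g(1) z])
      then show ?thesis using z by (intro elliptic[of z]) (auto simp: upper_half_plane_def)
    qed
  qed
qed

section \<open>Developing maps of leaves\<close>

text \<open>A hyperbolic disk is a Euclidean one with another center.\<close>

lemma is_hyp_disk_imp:
  assumes "is_hyp_disk D"
  shows "open D" "convex D" "D \<subseteq> \<H>"
proof -
  obtain c r where c: "Im c > 0" and r: "0 < r" and D: "D = {z. Im z > 0 \<and> hyp_dist c z < r}"
    using assms by (auto simp: is_hyp_disk_def upper_half_plane_def)
  define k where "k = Im c * (cosh r - 1)"
  have k: "k > 0" using c r cosh_real_ge_1[of r] cosh_real_one_iff[of r] by (simp add: k_def less_le)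
  define R where "R = sqrt (k\<^sup>2 + 2 * k * Im c)"
  have pos: "k\<^sup>2 + 2 * k * Im c > 0" using k c by (intro add_pos_pos) auto
  have R2: "R\<^sup>2 = k\<^sup>2 + 2 * k * Im c" unfolding R_def using pos by simp
  have R: "R > 0" unfolding R_def using pos by simp
  have "R\<^sup>2 = (Im c + k)\<^sup>2 - (Im c)\<^sup>2" unfolding R2 by algebra
  moreover have "(Im c)\<^sup>2 > 0" using c by simp
  ultimately have "R\<^sup>2 < (Im c + k)\<^sup>2" by linarith
  then have Rc: "R < Im c + k" by (rule power2_less_imp_less) (use c k in simp)
  have iff: "Im z > 0 \<and> hyp_dist c z < r \<longleftrightarrow> z \<in> ball (c + \<i> * k) R" for z
  proof (cases "Im z > 0")
    case True
    define q where "q = (cmod (c - z))\<^sup>2 / (2 * Im c * Im z)"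
    have q: "q \<ge> 0" using c True by (simp add: q_def)
    have "hyp_dist c z = arcosh (1 + q)" by (simp add: hyp_dist_def q_def)
    moreover have "r = arcosh (cosh r)" using r by (simp add: arcosh_cosh_real)
    ultimately have "hyp_dist c z < r \<longleftrightarrow> arcosh (1 + q) < arcosh (cosh r)" by simp
    also have "\<dots> \<longleftrightarrow> 1 + q < cosh r"
      using q cosh_real_ge_1[of r] by (intro arcosh_less_iff_real) auto
    also have "\<dots> \<longleftrightarrow> (cmod (c - z))\<^sup>2 < 2 * k * Im z"
    proof -
      have p: "2 * Im c * Im z > 0" using c True by simp
      have "1 + q < cosh r \<longleftrightarrow> q < cosh r - 1" by linarith
      also have "\<dots> \<longleftrightarrow> (cmod (c - z))\<^sup>2 < (cosh r - 1) * (2 * Im c * Im z)"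
        unfolding q_def by (rule pos_divide_less_eq[OF p])
      finally show ?thesis by (simp add: k_def mult_ac)
    qed
    also have "\<dots> \<longleftrightarrow> (cmod (c + \<i> * k - z))\<^sup>2 < R\<^sup>2"
    proof -
      have "(cmod (c + \<i> * k - z))\<^sup>2 - R\<^sup>2 = (cmod (c - z))\<^sup>2 - 2 * k * Im z"
        unfolding R2 cmod_power2 by (simp add: algebra_simps power2_eq_square)
      then show ?thesis by (intro iffI; linarith)
    qed
    also have "\<dots> \<longleftrightarrow> cmod (c + \<i> * k - z) < R"
      using R power2_less_imp_less[of "cmod (c + \<i> * k - z)" R]
        power_strict_mono[of "cmod (c + \<i> * k - z)" R 2] by (intro iffI) simp_all
    finally show ?thesis using True by (simp add: dist_norm)
  next
    case False
    have "\<bar>Im (c + \<i> * k - z)\<bar> \<ge> Im c + k" using False c k by simp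
    then have "\<not> cmod (c + \<i> * k - z) < R" using Rc abs_Im_le_cmod[of "c + \<i> * k - z"] by linarith
    with False show ?thesis by (simp add: dist_norm)
  qed
  have "D = ball (c + \<i> * k) R" unfolding D by (simp only: iff Collect_mem_eq)
  then show "open D" "convex D" by simp_all
  show "D \<subseteq> \<H>" unfolding D upper_half_plane_def by auto
qed

text \<open>The least parameter of a finite subcover serves all points.\<close>

lemma finite_cover_uniform:
  fixes Q :: "real \<Rightarrow> 'a \<Rightarrow> bool"
  assumes comp: "compact_space X"
    and loc: "\<And>x. x \<in> topspace X \<Longrightarrow> \<exists>V d. openin X V \<and> x \<in> V \<and> d > 0 \<and> (\<forall>y\<in>V. Q d y)"
    and mono: "\<And>d d' x. Q d x \<Longrightarrow> 0 < d' \<Longrightarrow> d' \<le> d \<Longrightarrow> Q d' x"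
    and e: "0 < (e::real)"
  obtains d where "0 < d" "d \<le> e" "\<And>x. x \<in> topspace X \<Longrightarrow> Q d x"
proof -
  obtain V d where Vd: "\<And>x. x \<in> topspace X \<Longrightarrow> openin X (V x) \<and> x \<in> V x \<and> d x > 0 \<and> (\<forall>y\<in>V x. Q (d x) y)"
    using loc by metis
  have "\<forall>W\<in>V ` topspace X. openin X W" using Vd by simp
  moreover have "topspace X \<subseteq> \<Union> (V ` topspace X)" using Vd by force
  ultimately obtain \<F> where F: "finite \<F>" "\<F> \<subseteq> V ` topspace X" "topspace X \<subseteq> \<Union>\<F>"
    using comp[unfolded compact_space_alt, rule_format, of "V ` topspace X"] by metis
  obtain A where A: "finite A" "A \<subseteq> topspace X" "\<F> = V ` A"
    using finite_subset_image[OF F(1,2)] by blast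
  define m where "m = Min (insert e (d ` A))"
  have "m > 0" unfolding m_def using A e Vd by (subst Min_gr_iff) auto
  moreover have "m \<le> e" unfolding m_def using A by (intro Min_le) auto
  moreover have "Q m x" if x: "x \<in> topspace X" for x
  proof -
    obtain a where a: "a \<in> A" "x \<in> V a" using F(3) A(3) x by blast
    have "m \<le> d a" unfolding m_def using A a by (intro Min_le) auto
    moreover have "a \<in> topspace X" using a(1) A(2) by (rule subsetD[rotated])
    then have "Q (d a) x" using Vd a(2) by simp
    ultimately show ?thesis using mono[of "d a" x m] \<open>m > 0\<close> by simp
  qed
  ultimately show ?thesis by (rule that)
qed

lemma open_eventually_nhds: "open {z. eventually P (nhds z)}"
proof (subst open_subopen, intro ballI)
  fix z assume "z \<in> {z. eventually P (nhds z)}"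
  then obtain S where S: "open S" "z \<in> S" "\<forall>y\<in>S. P y" by (metis mem_Collect_eq eventually_nhds)
  have "eventually P (nhds y)" if "y \<in> S" for y
    using S(1,3) that unfolding eventually_nhds by metis
  with S(1,2) show "\<exists>T. open T \<and> z \<in> T \<and> T \<subseteq> {z. eventually P (nhds z)}"
    by (intro exI[of _ S]) auto
qed

locale hyperbolic_lamination =
  fixes L :: "('a, 'i, 't) lamination"
  assumes lam: "compact_hyperbolic_lamination L"
begin

abbreviation "M \<equiv> lam_space L"
abbreviation "I \<equiv> lam_index L"
abbreviation "U \<equiv> lam_dom L"
abbreviation "D \<equiv> lam_disk L"
abbreviation "T \<equiv> lam_transversal L"
abbreviation "\<phi> \<equiv> lam_chart L"

lemma compact: "compact_space M"
  using lam by (simp add: compact_hyperbolic_lamination_def)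

lemma Hausdorff: "Hausdorff_space M"
  using lam by (simp add: compact_hyperbolic_lamination_def metrizable_imp_Hausdorff_space)

lemma openin_dom: "\<alpha> \<in> I \<Longrightarrow> openin M (U \<alpha>)"
  using lam by (simp add: compact_hyperbolic_lamination_def)

lemma dom_cover: "x \<in> topspace M \<Longrightarrow> \<exists>\<alpha>\<in>I. x \<in> U \<alpha>"
  using lam by (auto simp: compact_hyperbolic_lamination_def)

lemma dom_subset: "\<alpha> \<in> I \<Longrightarrow> U \<alpha> \<subseteq> topspace M"
  using openin_dom openin_subset by blast

lemma disk: "\<alpha> \<in> I \<Longrightarrow> open (D \<alpha>)" "\<alpha> \<in> I \<Longrightarrow> convex (D \<alpha>)" "\<alpha> \<in> I \<Longrightarrow> D \<alpha> \<subseteq> \<H>"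
  using lam is_hyp_disk_imp by (auto simp: compact_hyperbolic_lamination_def)

lemma chart_homeo:
  "\<alpha> \<in> I \<Longrightarrow> homeomorphic_map (subtopology M (U \<alpha>)) (prod_topology (top_of_set (D \<alpha>)) (T \<alpha>)) (\<phi> \<alpha>)"
  using lam by (simp add: compact_hyperbolic_lamination_def)

definition point :: "'i \<Rightarrow> complex \<times> 't \<Rightarrow> 'a" where
  "point \<alpha> = inv_into (U \<alpha>) (\<phi> \<alpha>)"

lemma topspace_dom: "\<alpha> \<in> I \<Longrightarrow> topspace (subtopology M (U \<alpha>)) = U \<alpha>"
  using dom_subset by auto

lemma chart_bij: "\<alpha> \<in> I \<Longrightarrow> bij_betw (\<phi> \<alpha>) (U \<alpha>) (D \<alpha> \<times> topspace (T \<alpha>))"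
  using homeomorphic_imp_surjective_map[OF chart_homeo, of \<alpha>]
    homeomorphic_imp_injective_map[OF chart_homeo, of \<alpha>]
  by (simp only: topspace_dom bij_betw_def) (simp add: Times_Int_Times)

lemma chart_in: "\<alpha> \<in> I \<Longrightarrow> x \<in> U \<alpha> \<Longrightarrow> \<phi> \<alpha> x \<in> D \<alpha> \<times> topspace (T \<alpha>)"
  using chart_bij bij_betwE by blast

lemma chart_inj: "\<alpha> \<in> I \<Longrightarrow> x \<in> U \<alpha> \<Longrightarrow> y \<in> U \<alpha> \<Longrightarrow> \<phi> \<alpha> x = \<phi> \<alpha> y \<Longrightarrow> x = y"
  using chart_bij by (meson bij_betw_imp_inj_on inj_onD)

lemma point_in:
  assumes "\<alpha> \<in> I" "y \<in> D \<alpha>" "t \<in> topspace (T \<alpha>)"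
  shows "point \<alpha> (y, t) \<in> U \<alpha>" "\<phi> \<alpha> (point \<alpha> (y, t)) = (y, t)"
proof -
  have "(y, t) \<in> \<phi> \<alpha> ` U \<alpha>" using assms bij_betw_imp_surj_on[OF chart_bij] by auto
  then show "point \<alpha> (y, t) \<in> U \<alpha>" "\<phi> \<alpha> (point \<alpha> (y, t)) = (y, t)"
    unfolding point_def by (rule inv_into_into, rule f_inv_into_f)
qed

lemma point_chart: "\<alpha> \<in> I \<Longrightarrow> x \<in> U \<alpha> \<Longrightarrow> point \<alpha> (\<phi> \<alpha> x) = x"
  unfolding point_def by (rule bij_betw_inv_into_left[OF chart_bij])

lemma continuous_chart:
  "\<alpha> \<in> I \<Longrightarrow> continuous_map (subtopology M (U \<alpha>)) (prod_topology (top_of_set (D \<alpha>)) (T \<alpha>)) (\<phi> \<alpha>)"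
  using chart_homeo homeomorphic_imp_continuous_map by blast

lemma continuous_point:
  assumes "\<alpha> \<in> I"
  shows "continuous_map (prod_topology (top_of_set (D \<alpha>)) (T \<alpha>)) M (point \<alpha>)"
proof -
  obtain g where g: "homeomorphic_maps (subtopology M (U \<alpha>)) (prod_topology (top_of_set (D \<alpha>)) (T \<alpha>)) (\<phi> \<alpha>) g"
    using chart_homeo[OF assms] homeomorphic_map_maps by blast
  then have "continuous_map (prod_topology (top_of_set (D \<alpha>)) (T \<alpha>)) (subtopology M (U \<alpha>)) g"
    by (simp add: homeomorphic_maps_def)
  moreover have "g p = point \<alpha> p" if "p \<in> topspace (prod_topology (top_of_set (D \<alpha>)) (T \<alpha>))" for p
  proof -
    have "p \<in> D \<alpha> \<times> topspace (T \<alpha>)" using that by simp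
    then have "point \<alpha> p \<in> U \<alpha>" "\<phi> \<alpha> (point \<alpha> p) = p" using point_in[OF assms] by (cases p; simp)+
    with g show ?thesis
      by (metis homeomorphic_maps_def topspace_dom[OF assms])
  qed
  ultimately show ?thesis
    by (meson continuous_map_eq continuous_map_into_fulltopology)
qed

lemma open_point_vimage:
  assumes "\<alpha> \<in> I" "openin M V" "t \<in> topspace (T \<alpha>)"
  shows "open {y \<in> D \<alpha>. point \<alpha> (y, t) \<in> V}"
proof -
  have "continuous_map (top_of_set (D \<alpha>)) (prod_topology (top_of_set (D \<alpha>)) (T \<alpha>)) (\<lambda>y. (y, t))"
    using assms(3) by (simp add: continuous_map_pairedI)
  from continuous_map_compose[OF this continuous_point[OF assms(1)]]
  have "continuous_map (top_of_set (D \<alpha>)) M (\<lambda>y. point \<alpha> (y, t))" by (simp add: o_def)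
  from openin_continuous_map_preimage[OF this assms(2)]
  show ?thesis using disk(1)[OF assms(1)] by (simp add: openin_open_eq)
qed

lemma transition:
  assumes "\<alpha> \<in> I" "\<beta> \<in> I"
  obtains g h where "\<And>x. x \<in> U \<alpha> \<Longrightarrow> x \<in> U \<beta> \<Longrightarrow> \<phi> \<alpha> x = (psl_act (g (snd (\<phi> \<beta> x))) (fst (\<phi> \<beta> x)), h (snd (\<phi> \<beta> x)))"
proof -
  obtain g :: "'t \<Rightarrow> psl2" and h :: "'t \<Rightarrow> 't" where gh:
    "\<forall>(y, t) \<in> \<phi> \<beta> ` (U \<alpha> \<inter> U \<beta>). lam_transition L \<alpha> \<beta> (y, t) = (psl_act (g t) y, h t)"
    using lam assms unfolding compact_hyperbolic_lamination_def by blast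
  have "\<phi> \<alpha> x = (psl_act (g (snd (\<phi> \<beta> x))) (fst (\<phi> \<beta> x)), h (snd (\<phi> \<beta> x)))" if x: "x \<in> U \<alpha>" "x \<in> U \<beta>" for x
  proof -
    have "lam_transition L \<alpha> \<beta> (\<phi> \<beta> x) = \<phi> \<alpha> x"
      using point_chart[OF assms(2) x(2)] by (simp add: lam_transition_def point_def)
    moreover have "\<phi> \<beta> x \<in> \<phi> \<beta> ` (U \<alpha> \<inter> U \<beta>)" using x by blast
    moreover have "lam_transition L \<alpha> \<beta> p = (psl_act (g (snd p)) (fst p), h (snd p))"
      if "p \<in> \<phi> \<beta> ` (U \<alpha> \<inter> U \<beta>)" for p
      using bspec[OF gh that] by (simp add: case_prod_unfold)
    ultimately show ?thesis by simp
  qed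
  then show ?thesis using that[of g h] by blast
qed

text \<open>The germ of \<open>s\<close> at \<open>z\<close> is, in the chart \<open>\<alpha>\<close>, the isometry \<open>g\<close> into the plaque \<open>t\<close>. So
\<open>developing \<Omega> s\<close> is a statement about the germs of \<open>s\<close> at the points of \<open>\<Omega>\<close>, and makes sense even
if \<open>\<Omega>\<close> is a single point.\<close>

definition coord :: "(complex \<Rightarrow> 'a) \<Rightarrow> complex \<Rightarrow> 'i \<Rightarrow> psl2 \<Rightarrow> 't \<Rightarrow> bool" where
  "coord s z \<alpha> g t \<longleftrightarrow> z \<in> \<H> \<and> \<alpha> \<in> I \<and>
     (\<forall>\<^sub>F z' in nhds z. s z' \<in> U \<alpha> \<and> \<phi> \<alpha> (s z') = (psl_act g z', t))"

definition developing :: "complex set \<Rightarrow> (complex \<Rightarrow> 'a) \<Rightarrow> bool" where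
  "developing \<Omega> s \<longleftrightarrow> (\<forall>z\<in>\<Omega>. \<exists>\<alpha> g t. coord s z \<alpha> g t)"

lemma coord_at:
  assumes "coord s z \<alpha> g t"
  shows "s z \<in> U \<alpha>" "\<phi> \<alpha> (s z) = (psl_act g z, t)" "z \<in> \<H>" "\<alpha> \<in> I"
    "t \<in> topspace (T \<alpha>)" "psl_act g z \<in> D \<alpha>" "s z \<in> topspace M"
proof -
  have "s z \<in> U \<alpha> \<and> \<phi> \<alpha> (s z) = (psl_act g z, t)"
    using assms eventually_nhds_x_imp_x unfolding coord_def by fast
  then show *: "s z \<in> U \<alpha>" "\<phi> \<alpha> (s z) = (psl_act g z, t)" by auto
  show "z \<in> \<H>" "\<alpha> \<in> I" using assms by (auto simp: coord_def)
  then show "t \<in> topspace (T \<alpha>)" "psl_act g z \<in> D \<alpha>" "s z \<in> topspace M"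
    using chart_in[of \<alpha> "s z"] * dom_subset by auto
qed

lemma eventually_upper: "z \<in> \<H> \<Longrightarrow> \<forall>\<^sub>F z' in nhds z. z' \<in> \<H>"
  by (rule eventually_nhds_in_open[OF open_upper_half_plane])

lemma coord_eventually:
  assumes "coord s z \<alpha> g t"
  shows "\<forall>\<^sub>F z' in nhds z. coord s z' \<alpha> g t"
proof -
  have "\<forall>\<^sub>F z' in nhds z. \<forall>\<^sub>F z'' in nhds z'. s z'' \<in> U \<alpha> \<and> \<phi> \<alpha> (s z'') = (psl_act g z'', t)"
    using assms by (simp add: coord_def eventually_eventually)
  with eventually_upper[OF coord_at(3)[OF assms]] show ?thesis
    by eventually_elim (use assms in \<open>simp add: coord_def\<close>)
qed

lemma coord_cong:
  assumes "coord s z \<alpha> g t" "\<forall>\<^sub>F z' in nhds z. s' z' = s z'"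
  shows "coord s' z \<alpha> g t"
proof -
  have "\<forall>\<^sub>F z' in nhds z. s z' \<in> U \<alpha> \<and> \<phi> \<alpha> (s z') = (psl_act g z', t)"
    using assms by (simp add: coord_def)
  with assms(2) have "\<forall>\<^sub>F z' in nhds z. s' z' \<in> U \<alpha> \<and> \<phi> \<alpha> (s' z') = (psl_act g z', t)"
    by eventually_elim simp
  then show ?thesis using assms by (simp add: coord_def)
qed

lemma coord_same_germ:
  assumes "coord s z \<alpha> g t" "coord s' z \<alpha> g t"
  shows "\<forall>\<^sub>F z' in nhds z. s z' = s' z'"
  using coord_eventually[OF assms(1)] coord_eventually[OF assms(2)]
proof eventually_elim
  case (elim z')
  then show ?case using coord_at[OF elim(1)] coord_at[OF elim(2)] by (intro chart_inj[of \<alpha>]) auto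
qed

lemma coord_unique:
  assumes "coord s z \<alpha> g t" "coord s z \<alpha> g' t'"
  shows "g = g'" "t = t'"
proof -
  have "\<forall>\<^sub>F z' in nhds z. psl_act g z' = psl_act g' z'"
    using coord_eventually[OF assms(1)] coord_eventually[OF assms(2)]
    by eventually_elim (metis coord_at(2) prod.inject)
  then show "g = g'" using coord_at(3)[OF assms(1)] psl_eq_germ by blast
  show "t = t'" using assms by (metis coord_at(2) prod.inject)
qed

lemma coord_openin:
  assumes "coord s z \<alpha> g t" "openin M V" "s z \<in> V"
  shows "\<forall>\<^sub>F z' in nhds z. s z' \<in> V"
proof -
  note c = coord_at[OF assms(1)]
  have "s z = point \<alpha> (psl_act g z, t)" using point_chart[OF c(4,1)] c(2) by simp
  then have "psl_act g z \<in> {y \<in> D \<alpha>. point \<alpha> (y, t) \<in> V}" using c assms(3) by simp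
  then have "\<forall>\<^sub>F y in nhds (psl_act g z). y \<in> {y \<in> D \<alpha>. point \<alpha> (y, t) \<in> V}"
    by (intro eventually_nhds_in_open open_point_vimage c assms)
  then have "\<forall>\<^sub>F z' in nhds z. psl_act g z' \<in> {y \<in> D \<alpha>. point \<alpha> (y, t) \<in> V}"
    by (rule eventually_psl_act[OF c(3)])
  with coord_eventually[OF assms(1)] show ?thesis
  proof eventually_elim
    case (elim z')
    show ?case using point_chart[of \<alpha> "s z'"] coord_at[OF elim(1)] elim(2) by simp
  qed
qed

text \<open>Whether a map is developing at a point can be tested in any chart around the image, because the
transition maps are isometries on plaques and send plaques into plaques.\<close>

lemma coord_change:
  assumes "coord s z \<alpha> g t" "\<beta> \<in> I" "s z \<in> U \<beta>"
  obtains h t' where "coord s z \<beta> h t'"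
proof -
  note c = coord_at[OF assms(1)]
  obtain k h where kh: "\<And>x. x \<in> U \<beta> \<Longrightarrow> x \<in> U \<alpha> \<Longrightarrow>
      \<phi> \<beta> x = (psl_act (k (snd (\<phi> \<alpha> x))) (fst (\<phi> \<alpha> x)), h (snd (\<phi> \<alpha> x)))"
    using transition[OF assms(2) c(4)] by blast
  have "\<forall>\<^sub>F z' in nhds z. s z' \<in> U \<beta>"
    by (rule coord_openin[OF assms(1) openin_dom[OF assms(2)] assms(3)])
  with coord_eventually[OF assms(1)]
  have "\<forall>\<^sub>F z' in nhds z. s z' \<in> U \<beta> \<and> \<phi> \<beta> (s z') = (psl_act (k t * g) z', h t)"
  proof eventually_elim
    case (elim z')
    note c' = coord_at[OF elim(1)]
    show ?case using kh[OF elim(2) c'(1)] elim(2) c'(2,3) by (simp add: psl_act_mult)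
  qed
  with assms(2) c(3) have "coord s z \<beta> (k t * g) (h t)" by (simp add: coord_def)
  then show ?thesis by (rule that)
qed

text \<open>Analytic continuation. The points where the two germs agree form an open set. Where they
differ, either the values differ, and then they do so nearby because the lamination is Hausdorff, or,
in a common chart, the maps are two different isometries, and then their germs agree nowhere.\<close>

lemma developing_identity:
  assumes conn: "connected \<Omega>" and dev: "developing \<Omega> s" "developing \<Omega> s'"
    and z0: "z0 \<in> \<Omega>" "\<forall>\<^sub>F z in nhds z0. s z = s' z" and z: "z \<in> \<Omega>"
  shows "\<forall>\<^sub>F z' in nhds z. s z' = s' z'"
proof -
  define E where "E = {z. \<forall>\<^sub>F z' in nhds z. s z' = s' z'}"
  define B where "B = {z. \<forall>\<^sub>F z' in nhds z. z' \<notin> E}"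
  have oE: "open E"
    unfolding E_def by (rule open_eventually_nhds)
  have oB: "open B"
    unfolding B_def by (rule open_eventually_nhds)
  have disj: "E \<inter> B = {}"
    unfolding B_def by (auto dest: eventually_nhds_x_imp_x)
  have "z \<in> B" if z: "z \<in> \<Omega>" "z \<notin> E" for z
  proof (cases "s z = s' z")
    case True
    obtain \<alpha> g t where c: "coord s z \<alpha> g t" using dev(1) z by (auto simp: developing_def)
    obtain \<beta> g1 t1 where c1: "coord s' z \<beta> g1 t1" using dev(2) z by (auto simp: developing_def)
    obtain g' t' where c': "coord s' z \<alpha> g' t'"
      using coord_change[OF c1, of \<alpha>] coord_at(1,4)[OF c] True by auto
    have t: "t = t'" using coord_at(2)[OF c] coord_at(2)[OF c'] True by simp
    have "g \<noteq> g'" using z(2) coord_same_germ[OF c] c' t by (auto simp: E_def)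
    \<comment> \<open>Near \<open>z\<close>, an agreement of the germs at any point would identify the two
      isometries.\<close>
    have "\<forall>\<^sub>F z' in nhds z. z' \<notin> E"
      using coord_eventually[OF c] coord_eventually[OF c']
    proof eventually_elim
      case (elim z')
      show ?case
      proof
        assume "z' \<in> E"
        then have "coord s z' \<alpha> g' t'"
          using coord_cong[OF elim(2), of s] by (simp add: E_def)
        with elim(1) have "g = g'" using coord_unique by blast
        with \<open>g \<noteq> g'\<close> show False ..
      qed
    qed
    then show ?thesis by (simp add: B_def)
  next
    case False
    obtain \<alpha> g t where c: "coord s z \<alpha> g t" using dev(1) z by (auto simp: developing_def)
    obtain \<beta> g1 t1 where c1: "coord s' z \<beta> g1 t1" using dev(2) z by (auto simp: developing_def)
    obtain V W where VW: "openin M V" "openin M W" "s z \<in> V" "s' z \<in> W" "disjnt V W"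
      using Hausdorff False coord_at(7)[OF c] coord_at(7)[OF c1] unfolding Hausdorff_space_def by meson
    have "\<forall>\<^sub>F z' in nhds z. z' \<notin> E"
      using coord_openin[OF c VW(1,3)] coord_openin[OF c1 VW(2,4)]
      by eventually_elim (use VW(5) in \<open>auto simp: E_def disjnt_iff dest!: eventually_nhds_x_imp_x\<close>)
    then show ?thesis by (simp add: B_def)
  qed
  then have "\<Omega> \<subseteq> E \<union> B" by blast
  with connectedD[OF conn oE oB] disj have "E \<inter> \<Omega> = {} \<or> B \<inter> \<Omega> = {}" by blast
  moreover have "z0 \<in> E" using z0 by (simp add: E_def)
  ultimately have "z \<in> E" using z0(1) z \<open>\<Omega> \<subseteq> E \<union> B\<close> by blast
  then show ?thesis by (simp add: E_def)
qed

lemma coord_plaque: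
  assumes "\<alpha> \<in> I" "t \<in> topspace (T \<alpha>)" "z \<in> \<H>" "psl_act g z \<in> D \<alpha>"
  shows "coord (\<lambda>z. point \<alpha> (psl_act g z, t)) z \<alpha> g t"
proof -
  have "\<forall>\<^sub>F z' in nhds z. psl_act g z' \<in> D \<alpha>"
    by (intro eventually_psl_act assms eventually_nhds_in_open disk)
  then have "\<forall>\<^sub>F z' in nhds z. point \<alpha> (psl_act g z', t) \<in> U \<alpha> \<and> \<phi> \<alpha> (point \<alpha> (psl_act g z', t)) = (psl_act g z', t)"
    by eventually_elim (use point_in assms in auto)
  then show ?thesis using assms by (simp add: coord_def)
qed

text \<open>Some chart around \<open>x\<close> contains the plaque through \<open>x\<close> up to a hyperbolic distance of the order of
\<open>d\<close>. The factor 2 is the distortion in \<open>psl_act_dist_le\<close>.\<close>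

definition wide_plaque :: "real \<Rightarrow> 'a \<Rightarrow> bool" where
  "wide_plaque d x \<longleftrightarrow> (\<exists>\<alpha>\<in>I. x \<in> U \<alpha> \<and> ball (fst (\<phi> \<alpha> x)) (2 * d * Im (fst (\<phi> \<alpha> x))) \<subseteq> D \<alpha>)"

lemma wide_plaque_nearby:
  assumes "x \<in> topspace M"
  shows "\<exists>V d. openin M V \<and> x \<in> V \<and> d > 0 \<and> (\<forall>x'\<in>V. wide_plaque d x')"
proof -
  obtain \<alpha> where \<alpha>: "\<alpha> \<in> I" "x \<in> U \<alpha>" using dom_cover[OF assms] by blast
  define y where "y = fst (\<phi> \<alpha> x)"
  have yD: "y \<in> D \<alpha>" using chart_in[OF \<alpha>] by (auto simp: y_def)
  then have y: "Im y > 0" using disk(3)[OF \<alpha>(1)] by (auto simp: upper_half_plane_def)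
  obtain r where r: "r > 0" "ball y r \<subseteq> D \<alpha>"
    using disk(1)[OF \<alpha>(1)] yD by (auto simp: open_contains_ball)
  \<comment> \<open>For \<open>y'\<close> within \<open>r / 2\<close> of \<open>y\<close> this choice gives \<open>2 * d * Im y' \<le> r / 2\<close>.\<close>
  define d where "d = r / (4 * (Im y + r))"
  have d: "d > 0" using r y by (simp add: d_def)
  have cancel: "2 * (r / (4 * W)) * W = r / 2" if "W > 0" for W using that by simp
  define V where "V = {x' \<in> topspace (subtopology M (U \<alpha>)). \<phi> \<alpha> x' \<in> (D \<alpha> \<inter> ball y (r / 2)) \<times> topspace (T \<alpha>)}"
  have "openin (subtopology M (U \<alpha>)) V" unfolding V_def
    by (rule openin_continuous_map_preimage[OF continuous_chart[OF \<alpha>(1)]])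
       (simp add: openin_prod_Times_iff openin_open_Int)
  then have "openin M V" using openin_trans_full openin_dom[OF \<alpha>(1)] by blast
  moreover have "x \<in> V"
    using \<alpha> chart_in[OF \<alpha>] r dom_subset by (auto simp: V_def y_def mem_Times_iff)
  moreover have "wide_plaque d x'" if "x' \<in> V" for x'
  proof -
    define y' where "y' = fst (\<phi> \<alpha> x')"
    have dy: "dist y y' < r / 2" using that by (auto simp: V_def y'_def mem_Times_iff)
    then have "\<bar>Im y' - Im y\<bar> < r / 2" using abs_Im_le_cmod[of "y' - y"] by (simp add: dist_norm norm_minus_commute)
    then have "Im y' \<le> Im y + r" using r by linarith
    then have "2 * d * Im y' \<le> 2 * d * (Im y + r)" using d by (intro mult_left_mono) auto
    also have "\<dots> = r / 2" unfolding d_def by (rule cancel) (use y r in simp)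
    finally have "ball y' (2 * d * Im y') \<subseteq> ball y r"
      using dy by (intro ball_subset_ball_iff[THEN iffD2]) (auto simp: dist_commute)
    then show ?thesis using r \<alpha> that unfolding wide_plaque_def
      by (intro bexI[of _ \<alpha>]) (auto simp: y'_def V_def)
  qed
  ultimately show ?thesis using d by blast
qed

lemma wide_plaque_mono:
  assumes "wide_plaque d x" "0 < d'" "d' \<le> d"
  shows "wide_plaque d' x"
proof -
  obtain \<alpha> where \<alpha>: "\<alpha> \<in> I" "x \<in> U \<alpha>" "ball (fst (\<phi> \<alpha> x)) (2 * d * Im (fst (\<phi> \<alpha> x))) \<subseteq> D \<alpha>"
    using assms(1) unfolding wide_plaque_def by blast
  have "Im (fst (\<phi> \<alpha> x)) > 0"
    using chart_in[OF \<alpha>(1,2)] disk(3)[OF \<alpha>(1)] by (auto simp: upper_half_plane_def)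
  then have "2 * d' * Im (fst (\<phi> \<alpha> x)) \<le> 2 * d * Im (fst (\<phi> \<alpha> x))"
    using assms by (intro mult_right_mono) auto
  then have "ball (fst (\<phi> \<alpha> x)) (2 * d' * Im (fst (\<phi> \<alpha> x))) \<subseteq> D \<alpha>" using \<alpha>(3) by (auto simp: subset_iff)
  with \<alpha> show ?thesis unfolding wide_plaque_def by blast
qed

definition plaque_size :: real where
  "plaque_size = (SOME d. 0 < d \<and> d \<le> 1 / 2 \<and> (\<forall>x \<in> topspace M. wide_plaque d x))"

lemma plaque_size:
  shows plaque_size_bounds: "0 < plaque_size" "plaque_size \<le> 1 / 2"
    and wide_plaque_size: "x \<in> topspace M \<Longrightarrow> wide_plaque plaque_size x"
proof -
  have "\<exists>d. 0 < d \<and> d \<le> 1 / 2 \<and> (\<forall>x \<in> topspace M. wide_plaque d x)"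
  proof (rule finite_cover_uniform[OF compact, where Q = wide_plaque and e = "1 / 2"])
    show "\<exists>V d. openin M V \<and> x \<in> V \<and> 0 < d \<and> (\<forall>y\<in>V. wide_plaque d y)" if "x \<in> topspace M" for x
      using that by (rule wide_plaque_nearby)
    show "wide_plaque d' x" if "wide_plaque d x" "0 < d'" "d' \<le> d" for d d' x
      using that by (rule wide_plaque_mono)
    show "\<exists>d. 0 < d \<and> d \<le> 1 / 2 \<and> (\<forall>x \<in> topspace M. wide_plaque d x)"
      if "0 < d" "d \<le> 1 / 2" "\<And>x. x \<in> topspace M \<Longrightarrow> wide_plaque d x" for d
      using that by blast
  qed simp
  then have "0 < plaque_size \<and> plaque_size \<le> 1 / 2 \<and> (\<forall>x \<in> topspace M. wide_plaque plaque_size x)"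
    unfolding plaque_size_def by (rule someI_ex)
  then show "0 < plaque_size" "plaque_size \<le> 1 / 2"
    "x \<in> topspace M \<Longrightarrow> wide_plaque plaque_size x" by auto
qed

lemma plaque_size_ball: "z \<in> \<H> \<Longrightarrow> z' \<in> ball z (plaque_size * Im z) \<Longrightarrow> z' \<in> \<H>"
proof -
  assume z: "z \<in> \<H>" "z' \<in> ball z (plaque_size * Im z)"
  have "plaque_size * Im z \<le> 1 / 2 * Im z" using plaque_size_bounds z by (intro mult_right_mono) (auto simp: upper_half_plane_def)
  then show ?thesis using z by (intro psl_act_dist_le(1)[OF z(1)]) auto
qed

text \<open>The size of the plaque around a point of a leaf carries over to the domain of a developing map.\<close>

lemma coord_wide:
  assumes "coord s z \<beta> k u"
  obtains \<alpha> g t where "coord s z \<alpha> g t" "\<And>z'. z' \<in> ball z (plaque_size * Im z) \<Longrightarrow> psl_act g z' \<in> D \<alpha>"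
proof -
  note c = coord_at[OF assms]
  have z: "Im z > 0" using c by (simp add: upper_half_plane_def)
  obtain \<alpha> where \<alpha>: "\<alpha>\<in>I" "s z \<in> U \<alpha>" "ball (fst (\<phi> \<alpha> (s z))) (2 * plaque_size * Im (fst (\<phi> \<alpha> (s z)))) \<subseteq> D \<alpha>"
    using wide_plaque_size[OF c(7)] unfolding wide_plaque_def by blast
  obtain g t where g: "coord s z \<alpha> g t" using coord_change[OF assms \<alpha>(1,2)] .
  have "psl_act g z' \<in> D \<alpha>" if z': "z' \<in> ball z (plaque_size * Im z)" for z'
  proof -
    have "plaque_size * Im z \<le> 1 / 2 * Im z" using plaque_size_bounds z by (intro mult_right_mono) auto
    then have "dist (psl_act g z) (psl_act g z') \<le> 2 * dist z z' * (Im (psl_act g z) / Im z)"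
      using z' by (intro psl_act_dist_le(2)[OF c(3)]) auto
    also have "\<dots> < 2 * (plaque_size * Im z) * (Im (psl_act g z) / Im z)"
      using z' z psl_act_upper[OF c(3), of g] by (intro mult_strict_right_mono) (auto simp: upper_half_plane_def)
    also have "\<dots> = 2 * plaque_size * Im (psl_act g z)" using z by simp
    finally show ?thesis using \<alpha>(3) coord_at(2)[OF g] by auto
  qed
  with g show ?thesis by (rule that)
qed

end

section \<open>Completeness of the leaves\<close>

text \<open>For small \<open>e\<close>, comparable with the hyperbolic neighborhood of \<open>C\<close> of radius \<open>e\<close>. The radius of the Euclidean
balls is a linear function of the center, which preserves convexity.\<close>

definition hyp_thicken :: "real \<Rightarrow> complex set \<Rightarrow> complex set" where
  "hyp_thicken e C = (\<Union>z\<in>C. ball z (e * Im z))"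

lemma open_hyp_thicken: "open (hyp_thicken e C)"
  by (auto simp: hyp_thicken_def)

lemma hyp_thicken_superset: "0 < e \<Longrightarrow> C \<subseteq> \<H> \<Longrightarrow> C \<subseteq> hyp_thicken e C"
  by (force simp: hyp_thicken_def upper_half_plane_def)

lemma convex_hyp_thicken:
  assumes "convex C"
  shows "convex (hyp_thicken e C)"
proof (rule convexI)
  fix p q and u v :: real
  assume "p \<in> hyp_thicken e C" "q \<in> hyp_thicken e C" and uv: "0 \<le> u" "0 \<le> v" "u + v = 1"
  then obtain z w where zw: "z \<in> C" "w \<in> C" "dist z p < e * Im z" "dist w q < e * Im w"
    by (auto simp: hyp_thicken_def)
  have "u *\<^sub>R z + v *\<^sub>R w \<in> C" using assms zw uv by (simp add: convexD)
  moreover have "dist (u *\<^sub>R z + v *\<^sub>R w) (u *\<^sub>R p + v *\<^sub>R q) < e * Im (u *\<^sub>R z + v *\<^sub>R w)"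
  proof -
    have "u *\<^sub>R z + v *\<^sub>R w - (u *\<^sub>R p + v *\<^sub>R q) = u *\<^sub>R (z - p) + v *\<^sub>R (w - q)"
      by (simp add: algebra_simps)
    then have "dist (u *\<^sub>R z + v *\<^sub>R w) (u *\<^sub>R p + v *\<^sub>R q) \<le> u * dist z p + v * dist w q"
      using norm_triangle_ineq[of "u *\<^sub>R (z - p)" "v *\<^sub>R (w - q)"] uv by (simp add: dist_norm)
    also have "\<dots> < u * (e * Im z) + v * (e * Im w)"
    proof (cases "u = 0")
      case False
      then have "u * dist z p < u * (e * Im z)" using uv zw by simp
      moreover have "v * dist w q \<le> v * (e * Im w)" using uv zw by (intro mult_left_mono) auto
      ultimately show ?thesis by simp
    qed (use uv zw in simp)
    finally show ?thesis by (simp add: algebra_simps)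
  qed
  ultimately show "u *\<^sub>R p + v *\<^sub>R q \<in> hyp_thicken e C"
    unfolding hyp_thicken_def by (intro UN_I) auto
qed

text \<open>A limit point \<open>z\<close> of \<open>C\<close> in the half plane lies in the ball around any point of \<open>C\<close> sufficiently
near to \<open>z\<close>. So \<open>C\<close> is both open and closed in the half plane.\<close>

lemma hyp_thicken_stable:
  assumes C: "open C" "C \<noteq> {}" "C \<subseteq> \<H>"
    and stable: "hyp_thicken e C \<subseteq> C" and e: "0 < e"
  shows "C = \<H>"
proof (rule ccontr)
  assume ne: "C \<noteq> \<H>"
  have "z \<in> C" if z: "z \<in> closure C" "z \<in> \<H>" for z
  proof -
    have y: "Im z > 0" using z by (simp add: upper_half_plane_def)
    have "((\<lambda>z'. e * Im z' - dist z' z) \<longlongrightarrow> e * Im z - dist z z) (nhds z)"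
      by (intro tendsto_intros) (auto simp: filterlim_ident)
    then have "\<forall>\<^sub>F z' in nhds z. 0 < e * Im z' - dist z' z"
      by (rule order_tendstoD(1)) (use y e in simp)
    then obtain S where S: "open S" "z \<in> S" "\<And>z'. z' \<in> S \<Longrightarrow> dist z' z < e * Im z'"
      by (auto simp: eventually_nhds)
    then obtain z' where "z' \<in> C" "z' \<in> S" using z(1) open_Int_closure_eq_empty[OF S(1), of C] by blast
    then have "z \<in> hyp_thicken e C" using S(3) by (auto simp: hyp_thicken_def)
    then show ?thesis using stable by blast
  qed
  then have "\<H> \<subseteq> C \<union> - closure C" by blast
  moreover have "C \<inter> - closure C \<inter> \<H> = {}" using closure_subset[of C] by blast
  ultimately have "C \<inter> \<H> = {} \<or> - closure C \<inter> \<H> = {}"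
    using C(1) by (intro connectedD[OF convex_connected[OF convex_upper_half_plane]]) auto
  then show False
    using C ne \<open>\<H> \<subseteq> C \<union> - closure C\<close> by blast
qed

context hyperbolic_lamination
begin

lemma developing_subset: "developing \<Omega> s \<Longrightarrow> \<Omega>' \<subseteq> \<Omega> \<Longrightarrow> developing \<Omega>' s"
  by (auto simp: developing_def)

lemma developing_upper: "developing \<Omega> s \<Longrightarrow> \<Omega> \<subseteq> \<H>"
  by (auto simp: developing_def coord_def)

lemma local_extension:
  assumes "coord s z \<beta> k u"
  obtains s' where "developing (ball z (plaque_size * Im z)) s'" "\<forall>\<^sub>F z' in nhds z. s' z' = s z'"
proof -
  obtain \<alpha> g t where g: "coord s z \<alpha> g t" "\<And>z'. z' \<in> ball z (plaque_size * Im z) \<Longrightarrow> psl_act g z' \<in> D \<alpha>"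
    using coord_wide[OF assms] by blast
  note c = coord_at[OF g(1)]
  define s' where "s' = (\<lambda>z'. point \<alpha> (psl_act g z', t))"
  have s': "coord s' z' \<alpha> g t" if "z' \<in> ball z (plaque_size * Im z)" for z'
    unfolding s'_def using plaque_size_ball[OF c(3) that] g(2)[OF that] c by (intro coord_plaque)
  have "developing (ball z (plaque_size * Im z)) s'"
    unfolding developing_def using s' by blast
  moreover have "z \<in> ball z (plaque_size * Im z)" using c(3) plaque_size_bounds by (simp add: upper_half_plane_def)
  then have "\<forall>\<^sub>F z' in nhds z. s' z' = s z'"
    using coord_same_germ[OF s' g(1)] by blast
  ultimately show ?thesis by (rule that)
qed

text \<open>Every germ of \<open>s\<close> extends to a ball of radius \<open>plaque_size\<close> (times the height of its center). Over the
balls of a quarter of this size these extensions fit together: if two small balls meet, the center of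
each lies in the large ball of the other, where the extensions agree near this center and hence on
the intersection of the large balls, which is convex.\<close>

lemma extension_step:
  assumes C: "convex C" "open C" and dev: "developing C s"
  obtains s' where "developing (hyp_thicken (plaque_size / 4) C) s'" "\<And>z. z \<in> C \<Longrightarrow> s' z = s z"
proof -
  note CH = developing_upper[OF dev]
  let ?B = "\<lambda>z. ball z (plaque_size * Im z)" and ?b = "\<lambda>z. ball z (plaque_size / 4 * Im z)"
  have "\<exists>s'. developing (?B z) s' \<and> (\<forall>\<^sub>F z' in nhds z. s' z' = s z')" if zC: "z \<in> C" for z
  proof -
    obtain \<alpha> g t where "coord s z \<alpha> g t" using dev zC unfolding developing_def by blast
    from local_extension[OF this] show ?thesis by blast
  qed
  then obtain \<sigma> where \<sigma>: "\<And>z. z \<in> C \<Longrightarrow> developing (?B z) (\<sigma> z)"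
      "\<And>z. z \<in> C \<Longrightarrow> \<forall>\<^sub>F z' in nhds z. \<sigma> z z' = s z'"
    by metis
  have pos: "Im z > 0" if "z \<in> C" for z using CH that by (auto simp: upper_half_plane_def)
  have cen: "z \<in> ?B z" "z \<in> ?b z" if "z \<in> C" for z using pos[OF that] plaque_size_bounds by auto
  have sub: "?b z \<subseteq> ?B z" if "z \<in> C" for z using pos[OF that] plaque_size_bounds by (auto simp: subset_ball)
  have agree: "\<sigma> z p = s p" if z: "z \<in> C" and p: "p \<in> ?B z" "p \<in> C" for z p
  proof -
    have "\<forall>\<^sub>F p in nhds p. \<sigma> z p = s p"
    proof (rule developing_identity)
      show "connected (?B z \<inter> C)" by (intro convex_connected convex_Int C convex_ball)
      show "developing (?B z \<inter> C) (\<sigma> z)" "developing (?B z \<inter> C) s"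
        using \<sigma>(1)[OF z] dev by (auto intro: developing_subset)
      show "z \<in> ?B z \<inter> C" using cen z by blast
      show "\<forall>\<^sub>F z' in nhds z. \<sigma> z z' = s z'" by (rule \<sigma>(2)[OF z])
    qed (use p in auto)
    then show ?thesis by (rule eventually_nhds_x_imp_x)
  qed
  have overlap: "\<sigma> z p = \<sigma> w p" if z: "z \<in> C" "w \<in> C" and p: "p \<in> ?b z" "p \<in> ?b w" for z w p
  proof -
    have "dist w z < plaque_size * Im w"
    proof -
      have dz: "dist z p < plaque_size / 4 * Im z" and dw: "dist w p < plaque_size / 4 * Im w" using p by auto
      have "plaque_size / 4 * Im z \<le> 1 / 8 * Im z" "plaque_size / 4 * Im w \<le> 1 / 8 * Im w"
        using plaque_size_bounds(2) pos[OF z(1)] pos[OF z(2)] by (intro mult_right_mono; simp)+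
      with dz dw have "dist z p < 1 / 8 * Im z" "dist w p < 1 / 8 * Im w" by linarith+
      then have "\<bar>Im z - Im p\<bar> < 1 / 8 * Im z" "\<bar>Im w - Im p\<bar> < 1 / 8 * Im w"
        using abs_Im_le_cmod[of "z - p"] abs_Im_le_cmod[of "w - p"] by (auto simp: dist_norm)
      then have "Im z \<le> 3 * Im w" using pos[OF z(1)] pos[OF z(2)] unfolding abs_less_iff by linarith
      have "dist w z \<le> dist w p + dist z p" by (metis dist_commute dist_triangle)
      also have "\<dots> < plaque_size / 4 * Im w + plaque_size / 4 * Im z" using dz dw by linarith
      also have "\<dots> \<le> plaque_size / 4 * Im w + plaque_size / 4 * (3 * Im w)"
        using \<open>Im z \<le> 3 * Im w\<close> plaque_size_bounds(1) by (intro add_left_mono mult_left_mono) auto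
      finally show ?thesis by (simp add: mult.commute)
    qed
    then have zB: "z \<in> ?B z \<inter> ?B w \<inter> C" using z cen by simp
    have "\<forall>\<^sub>F p in nhds p. \<sigma> z p = \<sigma> w p"
    proof (rule developing_identity)
      show "connected (?B z \<inter> ?B w)" by (intro convex_connected convex_Int convex_ball)
      show "developing (?B z \<inter> ?B w) (\<sigma> z)" "developing (?B z \<inter> ?B w) (\<sigma> w)"
        using \<sigma>(1) z by (auto intro: developing_subset)
      show "z \<in> ?B z \<inter> ?B w" using zB by blast
      have "\<forall>\<^sub>F z' in nhds z. z' \<in> ?B z \<inter> ?B w \<inter> C"
        using zB C(2) by (intro eventually_nhds_in_open open_Int open_ball)
      then show "\<forall>\<^sub>F z' in nhds z. \<sigma> z z' = \<sigma> w z'"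
        by eventually_elim (use agree z in auto)
      show "p \<in> ?B z \<inter> ?B w" using subsetD[OF sub[OF z(1)] p(1)] subsetD[OF sub[OF z(2)] p(2)] by (rule IntI)
    qed
    then show ?thesis by (rule eventually_nhds_x_imp_x)
  qed
  define s' where "s' p = \<sigma> (SOME z. z \<in> C \<and> p \<in> ?b z) p" for p
  have s': "s' p = \<sigma> z p" if "z \<in> C" "p \<in> ?b z" for z p
  proof -
    have "(SOME z. z \<in> C \<and> p \<in> ?b z) \<in> C \<and> p \<in> ?b (SOME z. z \<in> C \<and> p \<in> ?b z)"
      by (rule someI[of _ z]) (use that in auto)
    then show ?thesis unfolding s'_def using that by (intro overlap) auto
  qed
  have "developing (hyp_thicken (plaque_size / 4) C) s'"
    unfolding developing_def
  proof
    fix p assume "p \<in> hyp_thicken (plaque_size / 4) C"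
    then obtain z where z: "z \<in> C" "p \<in> ?b z" by (auto simp: hyp_thicken_def)
    have "p \<in> ?B z" using sub[OF z(1)] z(2) by (rule subsetD)
    then obtain \<alpha> g t where c: "coord (\<sigma> z) p \<alpha> g t" using \<sigma>(1)[OF z(1)] unfolding developing_def by blast
    have "\<forall>\<^sub>F p' in nhds p. p' \<in> ?b z" using z by (intro eventually_nhds_in_open) auto
    then have "\<forall>\<^sub>F p' in nhds p. s' p' = \<sigma> z p'" by eventually_elim (rule s'[OF z(1)])
    from coord_cong[OF c this] show "\<exists>\<alpha> g t. coord s' p \<alpha> g t" by blast
  qed
  moreover have "s' z = s z" if "z \<in> C" for z
    using s'[OF that cen(2)[OF that]] agree[OF that cen(1)[OF that] that] by simp
  ultimately show ?thesis by (rule that)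
qed

text \<open>Thickening a ball again and again exhausts the half plane. The developing maps obtained on the way
extend each other.\<close>

lemma global_extension:
  assumes "coord s z \<alpha> g t"
  obtains P where "developing \<H> P" "\<forall>\<^sub>F z' in nhds z. P z' = s z'"
proof -
  have z: "z \<in> \<H>" by (rule coord_at(3)[OF assms])
  obtain s0 where s0: "developing (ball z (plaque_size * Im z)) s0" "\<forall>\<^sub>F z' in nhds z. s0 z' = s z'"
    using local_extension[OF assms] by blast
  define C where "C n = (hyp_thicken (plaque_size / 4) ^^ n) (ball z (plaque_size * Im z))" for n
  have C0: "C 0 = ball z (plaque_size * Im z)" and CS: "C (Suc n) = hyp_thicken (plaque_size / 4) (C n)" for n
    by (simp_all add: C_def)
  have conv: "convex (C n) \<and> open (C n)" for n
    by (induction n) (simp_all add: C0 CS convex_hyp_thicken open_hyp_thicken)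
  have "\<exists>\<sigma>. \<forall>n. (developing (C n) (\<sigma> n) \<and> (n = 0 \<longrightarrow> \<sigma> n = s0)) \<and> (\<forall>p\<in>C n. \<sigma> (Suc n) p = \<sigma> n p)"
  proof (rule dependent_nat_choice)
    show "\<exists>\<sigma>. developing (C 0) \<sigma> \<and> (0 = (0::nat) \<longrightarrow> \<sigma> = s0)" using s0 C0 by auto
    fix \<sigma> and n :: nat assume "developing (C n) \<sigma> \<and> (n = 0 \<longrightarrow> \<sigma> = s0)"
    then obtain \<sigma>' where "developing (C (Suc n)) \<sigma>'" "\<And>p. p \<in> C n \<Longrightarrow> \<sigma>' p = \<sigma> p"
      using extension_step[of "C n" \<sigma>] conv unfolding CS by blast
    then show "\<exists>\<sigma>'. (developing (C (Suc n)) \<sigma>' \<and> (Suc n = 0 \<longrightarrow> \<sigma>' = s0)) \<and> (\<forall>p\<in>C n. \<sigma>' p = \<sigma> p)"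
      by blast
  qed
  then obtain \<sigma> where \<sigma>: "\<And>n. developing (C n) (\<sigma> n)" "\<sigma> 0 = s0"
      "\<And>n p. p \<in> C n \<Longrightarrow> \<sigma> (Suc n) p = \<sigma> n p" by blast
  have mono: "C n \<subseteq> C (Suc n)" for n
    unfolding CS using plaque_size_bounds developing_upper[OF \<sigma>(1)] by (intro hyp_thicken_superset) auto
  have agree: "\<sigma> (n + k) p = \<sigma> n p \<and> p \<in> C (n + k)" if "p \<in> C n" for n k p
    using that mono by (induction k) (auto simp: \<sigma>(3))
  define P where "P p = \<sigma> (LEAST n. p \<in> C n) p" for p
  have P: "P p = \<sigma> n p" if "p \<in> C n" for n p
  proof -
    have "p \<in> C (LEAST n. p \<in> C n)" "(LEAST n. p \<in> C n) \<le> n"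
      using that by (auto intro: LeastI Least_le)
    then show ?thesis unfolding P_def using agree by (metis le_Suc_ex)
  qed
  have germ: "\<forall>\<^sub>F p' in nhds p. P p' = \<sigma> n p'" if "p \<in> C n" for n p
    using eventually_nhds_in_open[OF conjunct2[OF conv] that] by eventually_elim (rule P)
  have "(\<Union>n. C n) = \<H>"
  proof (rule hyp_thicken_stable)
    show "open (\<Union>n. C n)" using conv by blast
    have "z \<in> C 0" using z plaque_size_bounds by (simp add: C0 upper_half_plane_def)
    then show "(\<Union>n. C n) \<noteq> {}" by blast
    show "(\<Union>n. C n) \<subseteq> \<H>" using developing_upper[OF \<sigma>(1)] by blast
    have "hyp_thicken (plaque_size / 4) (\<Union>n. C n) = (\<Union>n. C (Suc n))"
      by (auto simp: hyp_thicken_def CS)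
    then show "hyp_thicken (plaque_size / 4) (\<Union>n. C n) \<subseteq> (\<Union>n. C n)" by blast
  qed (use plaque_size_bounds in simp)
  then have "developing \<H> P"
    unfolding developing_def using germ coord_cong \<sigma>(1)[unfolded developing_def] by (metis UN_E)
  moreover have "z \<in> C 0" using z plaque_size_bounds by (simp add: C0 upper_half_plane_def)
  with germ have "\<forall>\<^sub>F z' in nhds z. P z' = s0 z'" using \<sigma>(2) by metis
  with s0(2) have "\<forall>\<^sub>F z' in nhds z. P z' = s z'" by eventually_elim simp
  ultimately show ?thesis by (rule that)
qed

end

section \<open>The right action on the unit tangent bundle\<close>

context hyperbolic_lamination
begin

text \<open>The differential of \<open>s\<close> at \<open>p\<close>, given by its coordinates in all charts around the image.\<close>

definition tangent_lift :: "(complex \<Rightarrow> 'a) \<Rightarrow> complex \<times> complex \<Rightarrow> 'a \<times> ('i \<Rightarrow> complex)" where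
  "tangent_lift s p = (s (fst p),
     restrict (\<lambda>\<beta>. deriv (\<lambda>z. fst (\<phi> \<beta> (s z))) (fst p) * snd p) {\<beta> \<in> I. s (fst p) \<in> U \<beta>})"

lemma coord_deriv:
  assumes "coord s z \<alpha> g t"
  shows "deriv (\<lambda>z. fst (\<phi> \<alpha> (s z))) z = deriv (psl_act g) z"
proof (rule deriv_cong_ev)
  show "\<forall>\<^sub>F z in nhds z. fst (\<phi> \<alpha> (s z)) = psl_act g z"
    using coord_eventually[OF assms] by eventually_elim (simp add: coord_at(2))
qed simp

lemma tangent_lift_cong:
  assumes "\<forall>\<^sub>F z in nhds (fst p). s z = s' z"
  shows "tangent_lift s p = tangent_lift s' p"
proof -
  have "deriv (\<lambda>z. fst (\<phi> \<beta> (s z))) (fst p) = deriv (\<lambda>z. fst (\<phi> \<beta> (s' z))) (fst p)" for \<beta>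
    by (rule deriv_cong_ev) (use assms in \<open>eventually_elim, simp, simp\<close>)
  moreover have "s (fst p) = s' (fst p)" using assms by (rule eventually_nhds_x_imp_x)
  ultimately show ?thesis by (simp add: tangent_lift_def)
qed

lemma coord_transition:
  assumes \<beta>: "coord s z \<beta> g t" and \<gamma>: "coord s z \<gamma> h u"
  shows "\<forall>\<^sub>F y in nhds (psl_act h z). lam_transition L \<beta> \<gamma> (y, u) = (psl_act (g * psl_inv h) y, t)"
proof -
  have z: "z \<in> \<H>" by (rule coord_at(3)[OF \<beta>])
  have "\<forall>\<^sub>F z' in nhds (psl_act (psl_inv h) (psl_act h z)). coord s z' \<beta> g t \<and> coord s z' \<gamma> h u"
    using coord_eventually[OF \<beta>] coord_eventually[OF \<gamma>] by (simp add: psl_act_inv z eventually_conj)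
  then have "\<forall>\<^sub>F y in nhds (psl_act h z).
      coord s (psl_act (psl_inv h) y) \<beta> g t \<and> coord s (psl_act (psl_inv h) y) \<gamma> h u"
    by (rule eventually_psl_act[OF psl_act_upper[OF z]])
  with eventually_upper[OF psl_act_upper[OF z, of h]] show ?thesis
  proof eventually_elim
    case (elim y)
    let ?z = "psl_act (psl_inv h) y"
    have "point \<gamma> (y, u) = s ?z"
      using point_chart[of \<gamma> "s ?z"] coord_at[of s ?z \<gamma> h u] elim by (simp add: psl_act_inv)
    then show ?case
      using coord_at(2)[of s ?z \<beta> g t] elim by (simp add: lam_transition_def point_def psl_act_mult)
  qed
qed

text \<open>In the chart \<open>\<alpha>\<close> the differential of \<open>s\<close> is that of \<open>g\<close>. The coordinates in two charts are
compatible by the chain rule.\<close>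

lemma tangent_lift_chart:
  assumes c: "coord s (fst p) \<alpha> g t" and p: "p \<in> unit_tangent_plane"
  shows "tangent_lift s p \<in> unit_bundle_dom L \<alpha>"
    "unit_bundle_chart L \<alpha> (tangent_lift s p) = (psl_differential g p, t)"
proof -
  define x where "x = s (fst p)"
  define \<xi> where "\<xi> = snd (tangent_lift s p)"
  have lift: "tangent_lift s p = (x, \<xi>)" by (simp add: tangent_lift_def x_def \<xi>_def)
  have \<xi>: "\<xi> \<beta> = deriv (psl_act h) (fst p) * snd p" if "coord s (fst p) \<beta> h u" for \<beta> h u
    using coord_at(1,4)[OF that] coord_deriv[OF that] by (simp add: \<xi>_def tangent_lift_def)
  have "\<xi> \<in> unit_tangent_vectors L x"
    unfolding unit_tangent_vectors_def
  proof (intro CollectI conjI ballI impI)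
    show "\<xi> \<in> extensional {\<alpha> \<in> lam_index L. x \<in> lam_dom L \<alpha>}"
      by (simp add: \<xi>_def x_def tangent_lift_def)
  next
    fix \<beta> assume \<beta>: "\<beta> \<in> I" "x \<in> U \<beta>"
    obtain h u where h: "coord s (fst p) \<beta> h u" using coord_change[OF c \<beta>[unfolded x_def]] .
    have "(fst (\<phi> \<beta> x), \<xi> \<beta>) = psl_differential h p"
      using coord_at(2)[OF h] \<xi>[OF h] by (simp add: x_def psl_differential_def case_prod_unfold)
    also have "\<dots> \<in> unit_tangent_plane" by (rule psl_differential_in[OF p])
    finally show "(fst (\<phi> \<beta> x), \<xi> \<beta>) \<in> unit_tangent (D \<beta>)"
      using coord_at(2,6)[OF h] by (simp add: unit_tangent_def x_def)
  next
    fix \<beta> \<gamma> assume i: "\<beta> \<in> I" "\<gamma> \<in> I" "x \<in> U \<beta> \<inter> U \<gamma>"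
    obtain g t where g: "coord s (fst p) \<beta> g t" using coord_change[OF c i(1)] i(3) by (auto simp: x_def)
    obtain h u where h: "coord s (fst p) \<gamma> h u" using coord_change[OF c i(2)] i(3) by (auto simp: x_def)
    note z = coord_at(3)[OF g]
    have "deriv (\<lambda>y. fst (lam_transition L \<beta> \<gamma> (y, u))) (psl_act h (fst p))
        = deriv (psl_act (g * psl_inv h)) (psl_act h (fst p))"
      by (rule deriv_cong_ev) (use coord_transition[OF g h] in \<open>eventually_elim, simp, simp\<close>)
    moreover have "deriv (psl_act (g * psl_inv h)) (psl_act h (fst p)) * deriv (psl_act h) (fst p)
        = deriv (psl_act g) (fst p)"
      using deriv_psl_act_mult[OF z, of "g * psl_inv h" h] by simp
    ultimately show "\<xi> \<beta> = deriv (\<lambda>y. fst (lam_transition L \<beta> \<gamma> (y, snd (\<phi> \<gamma> x)))) (fst (\<phi> \<gamma> x)) * \<xi> \<gamma>"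
      using coord_at(2)[OF h] \<xi>[OF g] \<xi>[OF h] by (simp add: x_def)
  qed
  then show "tangent_lift s p \<in> unit_bundle_dom L \<alpha>"
    using coord_at(1,7)[OF c] by (simp add: lift unit_bundle_dom_def unit_bundle_def x_def)
  show "unit_bundle_chart L \<alpha> (tangent_lift s p) = (psl_differential g p, t)"
    using coord_at(2)[OF c] \<xi>[OF c]
    by (simp add: lift unit_bundle_chart_def x_def psl_differential_def case_prod_unfold)
qed

abbreviation "UB \<equiv> unit_bundle L"

lemma unit_bundle_dom_subset: "w \<in> unit_bundle_dom L \<alpha> \<Longrightarrow> w \<in> UB"
  by (auto simp: unit_bundle_dom_def)

lemma unit_bundle_eqI:
  assumes "\<alpha> \<in> I" "w \<in> unit_bundle_dom L \<alpha>" "w' \<in> unit_bundle_dom L \<alpha>"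
    and "unit_bundle_chart L \<alpha> w = unit_bundle_chart L \<alpha> w'"
  shows "w = w'"
proof -
  obtain x \<xi> where w: "w = (x, \<xi>)" "x \<in> U \<alpha>" "\<xi> \<in> unit_tangent_vectors L x"
    using assms(2) by (auto simp: unit_bundle_dom_def unit_bundle_def)
  obtain x' \<xi>' where w': "w' = (x', \<xi>')" "x' \<in> U \<alpha>" "\<xi>' \<in> unit_tangent_vectors L x'"
    using assms(3) by (auto simp: unit_bundle_dom_def unit_bundle_def)
  have e: "fst (\<phi> \<alpha> x) = fst (\<phi> \<alpha> x')" "snd (\<phi> \<alpha> x) = snd (\<phi> \<alpha> x')" "\<xi> \<alpha> = \<xi>' \<alpha>"
    using assms(4) by (simp_all add: w w' unit_bundle_chart_def)
  then have x: "x = x'" using w w' assms(1) by (intro chart_inj[of \<alpha>]) (auto simp: prod_eq_iff)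
  have "\<xi> \<beta> = \<xi>' \<beta>" for \<beta>
  proof (cases "\<beta> \<in> I \<and> x \<in> U \<beta>")
    case True
    let ?d = "deriv (\<lambda>y. fst (lam_transition L \<beta> \<alpha> (y, snd (\<phi> \<alpha> x)))) (fst (\<phi> \<alpha> x))"
    have "\<xi> \<beta> = ?d * \<xi> \<alpha>" "\<xi>' \<beta> = ?d * \<xi>' \<alpha>"
      using w(2,3) w'(3) x True assms(1) unfolding unit_tangent_vectors_def by blast+
    with e show ?thesis by simp
  next
    case False
    then show ?thesis using w(3) w'(3) x unfolding unit_tangent_vectors_def extensional_def by auto
  qed
  then show ?thesis using w w' x by auto
qed

lemma unit_bundle_coordinates:
  assumes "\<alpha> \<in> I" "w \<in> unit_bundle_dom L \<alpha>"
  obtains k t where "unit_bundle_chart L \<alpha> w = (psl_frame k, t)" "psl_act k \<i> \<in> D \<alpha>" "t \<in> topspace (T \<alpha>)"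
proof -
  obtain x \<xi> where w: "w = (x, \<xi>)" "x \<in> U \<alpha>" "\<xi> \<in> unit_tangent_vectors L x"
    using assms(2) by (auto simp: unit_bundle_dom_def unit_bundle_def)
  have *: "(fst (\<phi> \<alpha> x), \<xi> \<alpha>) \<in> unit_tangent (D \<alpha>)"
    using w assms(1) unfolding unit_tangent_vectors_def by blast
  then have "(fst (\<phi> \<alpha> x), \<xi> \<alpha>) \<in> unit_tangent_plane"
    using disk(3)[OF assms(1)] by (auto simp: unit_tangent_def)
  then obtain k where k: "(fst (\<phi> \<alpha> x), \<xi> \<alpha>) = psl_frame k" by (rule psl_frame_cases)
  show ?thesis
  proof
    show "unit_bundle_chart L \<alpha> w = (psl_frame k, snd (\<phi> \<alpha> x))"
      by (simp add: w unit_bundle_chart_def k)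
    show "psl_act k \<i> \<in> D \<alpha>" "snd (\<phi> \<alpha> x) \<in> topspace (T \<alpha>)"
      using chart_in[OF assms(1) w(2)] k fst_psl_frame[of k] by (auto simp: mem_Times_iff dest: arg_cong[where f=fst])
  qed
qed

lemma unit_bundle_dom_cover:
  assumes "w \<in> UB"
  obtains \<alpha> where "\<alpha> \<in> I" "w \<in> unit_bundle_dom L \<alpha>"
  using assms dom_cover by (fastforce simp: unit_bundle_def unit_bundle_dom_def)

lemma tangent_lift_plaque:
  assumes "\<alpha> \<in> I" "w \<in> unit_bundle_dom L \<alpha>" "unit_bundle_chart L \<alpha> w = (psl_frame k, t)"
  shows "coord (\<lambda>z. point \<alpha> (psl_act k z, t)) \<i> \<alpha> k t"
    "tangent_lift (\<lambda>z. point \<alpha> (psl_act k z, t)) (\<i>, \<i>) = w"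
proof -
  obtain k' t' where "unit_bundle_chart L \<alpha> w = (psl_frame k', t')" "psl_act k' \<i> \<in> D \<alpha>" "t' \<in> topspace (T \<alpha>)"
    using unit_bundle_coordinates[OF assms(1,2)] .
  with assms(3) have "psl_act k \<i> \<in> D \<alpha>" "t \<in> topspace (T \<alpha>)" by simp_all
  then show c: "coord (\<lambda>z. point \<alpha> (psl_act k z, t)) \<i> \<alpha> k t"
    using assms(1) by (intro coord_plaque) auto
  then have c': "coord (\<lambda>z. point \<alpha> (psl_act k z, t)) (fst (\<i>, \<i>)) \<alpha> k t" by simp
  show "tangent_lift (\<lambda>z. point \<alpha> (psl_act k z, t)) (\<i>, \<i>) = w"
    using tangent_lift_chart[OF c' base_frame] assms
    by (intro unit_bundle_eqI[of \<alpha>]) (simp_all add: psl_frame_def)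
qed

lemma ex_leaf_param:
  assumes "w \<in> UB"
  shows "\<exists>P. developing \<H> P \<and> tangent_lift P (\<i>, \<i>) = w"
proof -
  obtain \<alpha> where \<alpha>: "\<alpha> \<in> I" "w \<in> unit_bundle_dom L \<alpha>" using unit_bundle_dom_cover[OF assms] .
  obtain k t where k: "unit_bundle_chart L \<alpha> w = (psl_frame k, t)"
    using unit_bundle_coordinates[OF \<alpha>] by metis
  note pl = tangent_lift_plaque[OF \<alpha> k]
  obtain P where P: "developing \<H> P" "\<forall>\<^sub>F z in nhds \<i>. P z = point \<alpha> (psl_act k z, t)"
    using global_extension[OF pl(1)] by blast
  have "tangent_lift P (\<i>, \<i>) = w" using tangent_lift_cong[where p = "(\<i>, \<i>)" and s = P] P(2) pl(2) by simp
  with P(1) show ?thesis by blast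
qed

text \<open>A developing map is determined by the image of one unit vector, since an isometry is.\<close>

lemma developing_eq_tangent:
  assumes conn: "connected \<Omega>" and dev: "developing \<Omega> s" "developing \<Omega> s'"
    and p: "p \<in> unit_tangent_plane" "fst p \<in> \<Omega>" "tangent_lift s p = tangent_lift s' p"
    and z: "z \<in> \<Omega>"
  shows "\<forall>\<^sub>F z' in nhds z. s z' = s' z'"
proof (rule developing_identity[OF conn dev p(2) _ z])
  obtain \<alpha> g t where c: "coord s (fst p) \<alpha> g t" using dev(1) p(2) unfolding developing_def by blast
  obtain \<beta> g1 t1 where c1: "coord s' (fst p) \<beta> g1 t1" using dev(2) p(2) unfolding developing_def by blast
  have "s (fst p) = s' (fst p)" using p(3) by (simp add: tangent_lift_def)
  then have "s' (fst p) \<in> U \<alpha>" using coord_at(1)[OF c] by simp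
  then obtain g' t' where c': "coord s' (fst p) \<alpha> g' t'"
    using coord_change[OF c1 coord_at(4)[OF c]] by blast
  have "(psl_differential g p, t) = (psl_differential g' p, t')"
    using tangent_lift_chart(2)[OF c p(1)] tangent_lift_chart(2)[OF c' p(1)] p(3) by simp
  then have "g = g'" "t = t'" using psl_differential_eq_iff[OF p(1)] by auto
  with c c' show "\<forall>\<^sub>F z in nhds (fst p). s z = s' z" using coord_same_germ by blast
qed

lemma tangent_lift_in:
  assumes "developing \<H> P" "p \<in> unit_tangent_plane"
  shows "tangent_lift P p \<in> UB"
proof -
  have "fst p \<in> \<H>" using assms(2) by (auto simp: unit_tangent_def)
  then obtain \<alpha> g t where "coord P (fst p) \<alpha> g t" using assms(1) unfolding developing_def by blast
  from tangent_lift_chart(1)[OF this assms(2)] show ?thesis by (rule unit_bundle_dom_subset)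
qed

lemma coord_compose:
  assumes "coord P (psl_act g z) \<alpha> h t" "z \<in> \<H>"
  shows "coord (\<lambda>z. P (psl_act g z)) z \<alpha> (h * g) t"
proof -
  have "\<forall>\<^sub>F z' in nhds z. coord P (psl_act g z') \<alpha> h t"
    by (rule eventually_psl_act[OF assms(2) coord_eventually[OF assms(1)]])
  with eventually_upper[OF assms(2)]
  have "\<forall>\<^sub>F z' in nhds z. P (psl_act g z') \<in> U \<alpha> \<and> \<phi> \<alpha> (P (psl_act g z')) = (psl_act (h * g) z', t)"
    by eventually_elim (simp add: coord_at(1,2) psl_act_mult)
  then show ?thesis using assms coord_at(4)[OF assms(1)] by (simp add: coord_def)
qed

lemma developing_compose:
  assumes "developing \<H> P"
  shows "developing \<H> (\<lambda>z. P (psl_act g z))"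
    "p \<in> unit_tangent_plane \<Longrightarrow> tangent_lift (\<lambda>z. P (psl_act g z)) p = tangent_lift P (psl_differential g p)"
proof -
  have c: "\<exists>\<alpha> h t. coord P (psl_act g z) \<alpha> h t" if "z \<in> \<H>" for z
    using assms psl_act_upper[OF that] unfolding developing_def by blast
  show "developing \<H> (\<lambda>z. P (psl_act g z))"
    unfolding developing_def using c coord_compose by metis
  assume p: "p \<in> unit_tangent_plane"
  have z: "fst p \<in> \<H>" using p by (auto simp: unit_tangent_def)
  obtain \<alpha> h t where c: "coord P (psl_act g (fst p)) \<alpha> h t" using c[OF z] by blast
  note c' = coord_compose[OF c z]
  have f: "fst (psl_differential g p) = psl_act g (fst p)" by (simp add: psl_differential_def case_prod_unfold)
  note l = tangent_lift_chart[OF c[folded f] psl_differential_in[OF p]]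
  note l' = tangent_lift_chart[OF c' p]
  show "tangent_lift (\<lambda>z. P (psl_act g z)) p = tangent_lift P (psl_differential g p)"
    by (rule unit_bundle_eqI[OF coord_at(4)[OF c] l'(1) l(1)]) (simp add: l l' psl_differential_mult[OF p])
qed

definition leaf_param :: "'a \<times> ('i \<Rightarrow> complex) \<Rightarrow> complex \<Rightarrow> 'a" where
  "leaf_param w = (SOME P. developing \<H> P \<and> tangent_lift P (\<i>, \<i>) = w)"

lemma leaf_param:
  assumes "w \<in> UB"
  shows "developing \<H> (leaf_param w)" "tangent_lift (leaf_param w) (\<i>, \<i>) = w"
  using someI_ex[OF ex_leaf_param[OF assms]] unfolding leaf_param_def by auto

text \<open>If \<open>P\<close> is the developing map that sends the base vector to \<open>w\<close>, then \<open>P \<circ> g\<close> is the one for \<open>w g\<close>.\<close>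

definition act :: "'a \<times> ('i \<Rightarrow> complex) \<Rightarrow> psl2 \<Rightarrow> 'a \<times> ('i \<Rightarrow> complex)" where
  "act w g = tangent_lift (leaf_param w) (psl_frame g)"

lemma act_in: "w \<in> UB \<Longrightarrow> act w g \<in> UB"
  unfolding act_def by (intro tangent_lift_in leaf_param psl_frame_in)

lemma act_one: "w \<in> UB \<Longrightarrow> act w 1 = w"
  by (simp add: act_def frame_one leaf_param)

text \<open>The group law for \<open>act\<close>: by uniqueness, precomposing with an isometry changes the developing
map of one vector into that of another.\<close>

lemma act_tangent_lift:
  assumes P: "developing \<H> P"
  shows "act (tangent_lift P (psl_frame h)) g = tangent_lift P (psl_frame (h * g))"
proof -
  let ?w = "tangent_lift P (psl_frame h)"
  have w: "?w \<in> UB" by (intro tangent_lift_in P psl_frame_in)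
  have "\<forall>\<^sub>F z in nhds (fst (psl_frame g)). leaf_param ?w z = P (psl_act h z)"
  proof (rule developing_eq_tangent[OF convex_connected[OF convex_upper_half_plane]])
    show "tangent_lift (leaf_param ?w) (\<i>, \<i>) = tangent_lift (\<lambda>z. P (psl_act h z)) (\<i>, \<i>)"
      by (rule trans[OF leaf_param(2)[OF w]])
         (simp only: developing_compose(2)[OF P base_frame] psl_frame_def)
    show "fst (psl_frame g) \<in> \<H>" by (simp add: fst_psl_frame psl_act_upper)
  qed (simp_all add: leaf_param[OF w] developing_compose[OF P])
  then have "act ?w g = tangent_lift (\<lambda>z. P (psl_act h z)) (psl_frame g)"
    unfolding act_def by (rule tangent_lift_cong)
  also have "\<dots> = tangent_lift P (psl_frame (h * g))"
    by (simp add: developing_compose[OF P] psl_frame_mult)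
  finally show ?thesis .
qed

lemma act_mult: "w \<in> UB \<Longrightarrow> act (act w g) h = act w (g * h)"
  unfolding act_def[of w] by (rule act_tangent_lift[OF leaf_param(1)])

lemma coord_propagate:
  assumes P: "developing \<H> P" and c: "coord P z \<alpha> k t"
    and \<Omega>: "connected \<Omega>" "\<Omega> \<subseteq> \<H>" "z \<in> \<Omega>" "\<And>z. z \<in> \<Omega> \<Longrightarrow> psl_act k z \<in> D \<alpha>"
    and z': "z' \<in> \<Omega>"
  shows "coord P z' \<alpha> k t"
proof -
  let ?s = "\<lambda>z. point \<alpha> (psl_act k z, t)"
  have s: "coord ?s y \<alpha> k t" if "y \<in> \<Omega>" for y
    using that \<Omega> coord_at[OF c] by (intro coord_plaque) auto
  have "\<forall>\<^sub>F z'' in nhds z'. P z'' = ?s z''"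
  proof (rule developing_identity[OF \<Omega>(1) _ _ \<Omega>(3) _ z'])
    show "developing \<Omega> P" using P \<Omega>(2) by (rule developing_subset)
    show "developing \<Omega> ?s" unfolding developing_def using s by blast
    show "\<forall>\<^sub>F z in nhds z. P z = ?s z" using coord_same_germ[OF c s[OF \<Omega>(3)]] .
  qed
  then show ?thesis by (rule coord_cong[OF s[OF z']])
qed

text \<open>Each elementary step of the right action takes place in one plaque. There the developing map of \<open>w\<close>
agrees with the inverse chart, as the preimage of the disk under \<open>k\<close> is connected, and so the step
leads to \<open>act w g\<close>.\<close>

lemma right_action_rel_imp_act:
  assumes "right_action_rel L w g w'"
  shows "w \<in> UB \<and> w' = act w g"
  using assms
proof induction
  case (chart \<alpha> w w' k t g)
  have w: "w \<in> UB" using chart(2) by (rule unit_bundle_dom_subset)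
  let ?P = "leaf_param w"
  note P = leaf_param[OF w]
  let ?s = "\<lambda>z. point \<alpha> (psl_act k z, t)"
  note s = tangent_lift_plaque[OF chart(1,2,4)]
  have "\<forall>\<^sub>F z in nhds \<i>. ?P z = ?s z"
  proof (rule developing_eq_tangent[where \<Omega> = "{\<i>}" and p = "(\<i>, \<i>)"])
    show "developing {\<i>} ?P" using P(1) by (rule developing_subset) simp
    show "developing {\<i>} ?s" using s(1) by (auto simp: developing_def)
  qed (simp_all add: s P)
  then have c: "coord ?P \<i> \<alpha> k t" by (rule coord_cong[OF s(1)])
  obtain k' t' where "unit_bundle_chart L \<alpha> w' = (psl_frame k', t')" "psl_act k' \<i> \<in> D \<alpha>"
    using unit_bundle_coordinates[OF chart(1,3)] .
  with chart(5) have "psl_act (k * g) \<i> \<in> D \<alpha>" by simp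
  then have kg: "psl_act k (psl_act g \<i>) \<in> D \<alpha>" by (simp add: psl_act_mult)
  have "coord ?P (psl_act g \<i>) \<alpha> k t"
    by (rule coord_propagate[OF P(1) c connected_psl_vimage[of "D \<alpha>" k]])
       (use disk[OF chart(1)] kg coord_at(6)[OF c] in \<open>auto simp: psl_act_upper convex_connected\<close>)
  then have c': "coord ?P (fst (psl_frame g)) \<alpha> k t" by (simp add: fst_psl_frame)
  show ?case
    using w unit_bundle_eqI[OF chart(1,3) tangent_lift_chart(1)[OF c' psl_frame_in]]
      tangent_lift_chart(2)[OF c' psl_frame_in] chart(5)
    by (simp add: act_def psl_frame_mult)
next
  case (comp w g w' h w'')
  then show ?case by (simp add: act_mult)
qed

lemma coord_ball:
  assumes w: "w \<in> UB"
  obtains \<alpha> k t where "\<alpha> \<in> I" "w \<in> unit_bundle_dom L \<alpha>" "unit_bundle_chart L \<alpha> w = (psl_frame k, t)"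
    "\<And>z. z \<in> ball \<i> plaque_size \<Longrightarrow> coord (leaf_param w) z \<alpha> k t"
proof -
  note P = leaf_param[OF w]
  obtain \<beta> h u where "coord (leaf_param w) \<i> \<beta> h u" using P(1) i_in_upper unfolding developing_def by blast
  then obtain \<alpha> k t where c: "coord (leaf_param w) \<i> \<alpha> k t"
      "\<And>z'. z' \<in> ball \<i> (plaque_size * Im \<i>) \<Longrightarrow> psl_act k z' \<in> D \<alpha>"
    using coord_wide by blast
  have c': "coord (leaf_param w) (fst (\<i>, \<i>)) \<alpha> k t" using c(1) by simp
  show ?thesis
  proof
    show "\<alpha> \<in> I" by (rule coord_at(4)[OF c(1)])
    show "w \<in> unit_bundle_dom L \<alpha>" "unit_bundle_chart L \<alpha> w = (psl_frame k, t)"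
      using tangent_lift_chart[OF c' base_frame] by (simp_all add: P psl_frame_def)
    show "coord (leaf_param w) z \<alpha> k t" if "z \<in> ball \<i> plaque_size" for z
      by (rule coord_propagate[OF P(1) c(1), of "ball \<i> plaque_size"])
         (use c(2) plaque_size_bounds plaque_size_ball[of \<i>] that in \<open>auto simp: convex_connected\<close>)
  qed
qed

text \<open>Some plaque through the base point of \<open>w\<close> contains the ball of this radius, so one step in a single
chart suffices.\<close>

lemma right_action_rel_near:
  assumes w: "w \<in> UB" and g: "dist \<i> (psl_act g \<i>) < plaque_size"
  shows "right_action_rel L w g (act w g)"
proof -
  obtain \<alpha> k t where *: "\<alpha> \<in> I" "w \<in> unit_bundle_dom L \<alpha>" "unit_bundle_chart L \<alpha> w = (psl_frame k, t)"
    "\<And>z. z \<in> ball \<i> plaque_size \<Longrightarrow> coord (leaf_param w) z \<alpha> k t"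
    using coord_ball[OF w] by blast
  have "coord (leaf_param w) (fst (psl_frame g)) \<alpha> k t"
    using *(4) g by (simp add: fst_psl_frame)
  note l = tangent_lift_chart[OF this psl_frame_in]
  show ?thesis
    using right_action_rel.chart[OF *(1,2) l(1) *(3)] l(2) by (simp add: act_def psl_frame_mult)
qed

lemma right_action_rel_act:
  "w \<in> UB \<Longrightarrow> right_action_rel L w g (act w g)"
proof -
  have "\<forall>w\<in>UB. right_action_rel L w g (act w g)"
  proof (rule psl2_generated_near_stabilizer[where P = "\<lambda>g. \<forall>w\<in>UB. right_action_rel L w g (act w g)" and e = plaque_size])
    fix g h
    assume *: "\<forall>w\<in>UB. right_action_rel L w g (act w g)" "\<forall>w\<in>UB. right_action_rel L w h (act w h)"
    show "\<forall>w\<in>UB. right_action_rel L w (g * h) (act w (g * h))"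
      using * right_action_rel.comp by (metis act_in act_mult)
  qed (auto simp: plaque_size_bounds intro: right_action_rel_near)
  then show "w \<in> UB \<Longrightarrow> right_action_rel L w g (act w g)" by blast
qed

lemma right_action_eq: "w \<in> UB \<Longrightarrow> right_action L w g = act w g"
  unfolding right_action_def using right_action_rel_act right_action_rel_imp_act by (intro the_equality) auto

end

section \<open>Continuity of the right action\<close>

lemma continuous_map_locally:
  assumes "\<And>x. x \<in> topspace X \<Longrightarrow> \<exists>N. openin X N \<and> x \<in> N \<and> continuous_map (subtopology X N) Y f"
  shows "continuous_map X Y f"
proof -
  obtain N where N: "\<And>x. x \<in> topspace X \<Longrightarrow> openin X (N x) \<and> x \<in> N x \<and> continuous_map (subtopology X (N x)) Y f"
    using assms by metis
  show ?thesis
    by (rule pasting_lemma[where I = "topspace X" and T = N and f = "\<lambda>_. f"]) (use N in auto)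
qed

context hyperbolic_lamination
begin

abbreviation "X \<equiv> unit_bundle_topology L"
abbreviation "plaques \<alpha> \<equiv> prod_topology (top_of_set (D \<alpha>)) (T \<alpha>)"
abbreviation "frames \<alpha> \<equiv> prod_topology (top_of_set (unit_tangent (D \<alpha>))) (T \<alpha>)"
abbreviation "bdom \<alpha> \<equiv> unit_bundle_dom L \<alpha>"
abbreviation "bchart \<alpha> \<equiv> unit_bundle_chart L \<alpha>"

lemma topspace_X [simp]: "topspace X = UB"
  by (rule topspace_unit_bundle_topology[OF lam])

lemma chart_in_frames: "\<alpha> \<in> I \<Longrightarrow> w \<in> bdom \<alpha> \<Longrightarrow> bchart \<alpha> w \<in> topspace (frames \<alpha>)"
proof -
  assume *: "\<alpha> \<in> I" "w \<in> bdom \<alpha>"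
  obtain k t where k: "bchart \<alpha> w = (psl_frame k, t)" "psl_act k \<i> \<in> D \<alpha>" "t \<in> topspace (T \<alpha>)"
    using unit_bundle_coordinates[OF *] .
  have "psl_frame k \<in> unit_tangent (D \<alpha>)"
    using psl_frame_in[of k] k(2) unfolding fst_psl_frame[symmetric] by (auto simp: unit_tangent_def)
  with k show ?thesis by simp
qed

lemma unit_tangent_disk: "\<alpha> \<in> I \<Longrightarrow> unit_tangent (D \<alpha>) \<subseteq> unit_tangent_plane"
  using disk(3) by (fastforce simp: unit_tangent_def)

lemma openin_chart_vimage:
  assumes "\<alpha> \<in> I" "openin (frames \<alpha>) W"
  shows "openin X {w \<in> bdom \<alpha>. bchart \<alpha> w \<in> W}"
  unfolding unit_bundle_topology_def by (rule topology_generated_by_Basis) (use assms in blast)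

lemma openin_dom_X:
  assumes "\<alpha> \<in> I"
  shows "openin X (bdom \<alpha>)"
proof -
  have "{w \<in> bdom \<alpha>. bchart \<alpha> w \<in> topspace (frames \<alpha>)} = bdom \<alpha>"
    using chart_in_frames[OF assms] by blast
  then show ?thesis using openin_chart_vimage[OF assms openin_topspace] by simp
qed

lemma dom_UB: "bdom \<alpha> \<subseteq> UB"
  by (auto simp: unit_bundle_dom_def)

lemma continuous_unit_bundle_chart:
  assumes "\<alpha> \<in> I"
  shows "continuous_map (subtopology X (bdom \<alpha>)) (frames \<alpha>) (bchart \<alpha>)"
proof -
  have dom: "topspace (subtopology X (bdom \<alpha>)) = bdom \<alpha>" using dom_UB by auto
  show ?thesis
    unfolding continuous_map_def dom
  proof (intro conjI allI impI)
    show "bchart \<alpha> \<in> bdom \<alpha> \<rightarrow> topspace (frames \<alpha>)" using chart_in_frames[OF assms] by blast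
    fix W assume "openin (frames \<alpha>) W"
    then show "openin (subtopology X (bdom \<alpha>)) {w \<in> bdom \<alpha>. bchart \<alpha> w \<in> W}"
      using openin_chart_vimage[OF assms] by (simp add: openin_open_subtopology[OF openin_dom_X[OF assms]] subset_iff)
  qed
qed

definition bundle_point :: "'i \<Rightarrow> (complex \<times> complex) \<times> 't \<Rightarrow> 'a \<times> ('i \<Rightarrow> complex)" where
  "bundle_point \<alpha> = inv_into (bdom \<alpha>) (bchart \<alpha>)"

lemma bundle_point:
  assumes "\<alpha> \<in> I" "q \<in> topspace (frames \<alpha>)"
  shows "bundle_point \<alpha> q \<in> bdom \<alpha>" "bchart \<alpha> (bundle_point \<alpha> q) = q"
proof -
  obtain p t where q: "q = (p, t)" "p \<in> unit_tangent (D \<alpha>)" "t \<in> topspace (T \<alpha>)" using assms(2) by auto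
  obtain k where k: "p = psl_frame k" using q(2) unit_tangent_disk[OF assms(1)] psl_frame_cases by blast
  have "fst (psl_frame k) \<in> D \<alpha>" using q(2) unfolding k by (auto simp: unit_tangent_def)
  then have "coord (\<lambda>z. point \<alpha> (psl_act k z, t)) (fst (\<i>, \<i>)) \<alpha> k t"
    using assms(1) q(3) by (intro coord_plaque) (auto simp: fst_psl_frame)
  from tangent_lift_chart[OF this base_frame] have "q \<in> bchart \<alpha> ` bdom \<alpha>"
    unfolding q k psl_frame_def by (metis imageI)
  then show "bundle_point \<alpha> q \<in> bdom \<alpha>" "bchart \<alpha> (bundle_point \<alpha> q) = q"
    unfolding bundle_point_def by (rule inv_into_into, rule f_inv_into_f)
qed

definition overlap :: "'i \<Rightarrow> 'i \<Rightarrow> (complex \<times> 't) set" where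
  "overlap \<beta> \<alpha> = {p \<in> topspace (plaques \<alpha>). point \<alpha> p \<in> U \<beta>}"

definition transition_deriv :: "'i \<Rightarrow> 'i \<Rightarrow> complex \<times> 't \<Rightarrow> complex" where
  "transition_deriv \<beta> \<alpha> p = deriv (\<lambda>y. fst (lam_transition L \<beta> \<alpha> (y, snd p))) (fst p)"

lemma openin_overlap: "\<alpha> \<in> I \<Longrightarrow> \<beta> \<in> I \<Longrightarrow> openin (plaques \<alpha>) (overlap \<beta> \<alpha>)"
  unfolding overlap_def by (rule openin_continuous_map_preimage[OF continuous_point openin_dom])

lemma continuous_transition:
  assumes "\<alpha> \<in> I" "\<beta> \<in> I"
  shows "continuous_map (subtopology (plaques \<alpha>) (overlap \<beta> \<alpha>)) (plaques \<beta>) (lam_transition L \<beta> \<alpha>)"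
proof -
  have "continuous_map (subtopology (plaques \<alpha>) (overlap \<beta> \<alpha>)) (subtopology M (U \<beta>)) (point \<alpha>)"
    using continuous_map_from_subtopology[OF continuous_point[OF assms(1)]]
    by (auto simp: continuous_map_in_subtopology overlap_def)
  from continuous_map_compose[OF this continuous_chart[OF assms(2)]]
  show ?thesis by (simp add: o_def lam_transition_def[abs_def] point_def)
qed

text \<open>The derivatives in the definition of the unit tangent bundle are those of the isometries
\<open>g t\<close>, as the overlap of two charts is open.\<close>

lemma transition_isometry:
  assumes "\<alpha> \<in> I" "\<beta> \<in> I"
  obtains g h where "\<And>y t. (y, t) \<in> overlap \<beta> \<alpha> \<Longrightarrow> lam_transition L \<beta> \<alpha> (y, t) = (psl_act (g t) y, h t)"
    "\<And>y t. (y, t) \<in> overlap \<beta> \<alpha> \<Longrightarrow> transition_deriv \<beta> \<alpha> (y, t) = deriv (psl_act (g t)) y"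
proof -
  obtain g h where gh: "\<And>x. x \<in> U \<beta> \<Longrightarrow> x \<in> U \<alpha> \<Longrightarrow>
      \<phi> \<beta> x = (psl_act (g (snd (\<phi> \<alpha> x))) (fst (\<phi> \<alpha> x)), h (snd (\<phi> \<alpha> x)))"
    using transition[OF assms(2,1)] by blast
  have 1: "lam_transition L \<beta> \<alpha> (y, t) = (psl_act (g t) y, h t)" if "(y, t) \<in> overlap \<beta> \<alpha>" for y t
    using that gh[of "point \<alpha> (y, t)"] point_in[OF assms(1), of y t]
    by (simp add: overlap_def lam_transition_def point_def)
  have 2: "transition_deriv \<beta> \<alpha> (y, t) = deriv (psl_act (g t)) y" if *: "(y, t) \<in> overlap \<beta> \<alpha>" for y t
  proof -
    have "open {y \<in> D \<alpha>. point \<alpha> (y, t) \<in> U \<beta>}"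
      using * assms by (intro open_point_vimage openin_dom) (auto simp: overlap_def)
    then have "\<forall>\<^sub>F y in nhds y. y \<in> {y \<in> D \<alpha>. point \<alpha> (y, t) \<in> U \<beta>}"
      by (rule eventually_nhds_in_open) (use * in \<open>auto simp: overlap_def\<close>)
    then have "\<forall>\<^sub>F y in nhds y. fst (lam_transition L \<beta> \<alpha> (y, t)) = psl_act (g t) y"
      by eventually_elim (use * 1 in \<open>auto simp: overlap_def\<close>)
    then show ?thesis unfolding transition_deriv_def fst_conv snd_conv by (rule deriv_cong_ev) simp
  qed
  show ?thesis by (rule that[of g h]) (fact 1 2)+
qed

text \<open>The transition maps are continuous by hypothesis, and by \<open>deriv_psl_act_two_points\<close> their leafwise
derivatives are continuous expressions in their values at \<open>(y, t)\<close> and at \<open>(y\<^sub>1, t)\<close> for a fixed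
\<open>y\<^sub>1\<close> near \<open>y\<close>.\<close>

lemma continuous_transition_deriv:
  assumes "\<alpha> \<in> I" "\<beta> \<in> I"
  shows "continuous_map (subtopology (plaques \<alpha>) (overlap \<beta> \<alpha>)) euclidean (transition_deriv \<beta> \<alpha>)"
proof (rule continuous_map_locally)
  let ?O = "overlap \<beta> \<alpha>" and ?Z = "subtopology (plaques \<alpha>) (overlap \<beta> \<alpha>)"
  let ?\<tau> = "lam_transition L \<beta> \<alpha>"
  have sub: "?O \<subseteq> D \<alpha> \<times> topspace (T \<alpha>)" by (auto simp: overlap_def)
  have topZ: "topspace ?Z = ?O" using sub by auto
  fix p assume "p \<in> topspace ?Z"
  then obtain y0 t0 where p: "p = (y0, t0)" "(y0, t0) \<in> ?O" using topZ by (cases p) auto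
  obtain g h where gh: "\<And>y t. (y, t) \<in> ?O \<Longrightarrow> ?\<tau> (y, t) = (psl_act (g t) y, h t)"
    "\<And>y t. (y, t) \<in> ?O \<Longrightarrow> transition_deriv \<beta> \<alpha> (y, t) = deriv (psl_act (g t)) y"
    using transition_isometry[OF assms] by blast
  obtain y1 where y1: "y1 \<noteq> y0" "(y1, t0) \<in> ?O"
  proof -
    have "open {y \<in> D \<alpha>. point \<alpha> (y, t0) \<in> U \<beta>}"
      using p assms by (intro open_point_vimage openin_dom) (auto simp: overlap_def)
    moreover have "y0 \<in> {y \<in> D \<alpha>. point \<alpha> (y, t0) \<in> U \<beta>}" using p by (auto simp: overlap_def)
    ultimately obtain e where e: "e > 0" "ball y0 e \<subseteq> {y \<in> D \<alpha>. point \<alpha> (y, t0) \<in> U \<beta>}"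
      by (auto simp: open_contains_ball)
    have "y0 + of_real (e / 2) \<in> ball y0 e" using e(1) by (simp add: dist_norm)
    with e p have "(y0 + of_real (e / 2), t0) \<in> ?O" by (auto simp: overlap_def)
    then show ?thesis using e(1) by (intro that) auto
  qed
  have y1D: "y1 \<in> D \<alpha>" using y1 sub by auto
  have cshift: "continuous_map (plaques \<alpha>) (plaques \<alpha>) (\<lambda>q. (y1, snd q))"
    using y1D by (intro continuous_map_pairedI continuous_map_snd) (auto simp: continuous_map_const)
  define N where "N = ?O \<inter> {q \<in> topspace (plaques \<alpha>). (y1, snd q) \<in> ?O} \<inter> {q \<in> topspace (plaques \<alpha>). fst q \<in> - {y1}}"
  have fst_c: "continuous_map (plaques \<alpha>) euclidean fst"
    using continuous_map_fst continuous_map_into_fulltopology by blast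
  have "openin (plaques \<alpha>) {q \<in> topspace (plaques \<alpha>). (y1, snd q) \<in> ?O}"
    by (rule openin_continuous_map_preimage[OF cshift openin_overlap[OF assms]])
  moreover have "openin (plaques \<alpha>) {q \<in> topspace (plaques \<alpha>). fst q \<in> - {y1}}"
    by (rule openin_continuous_map_preimage[OF fst_c]) auto
  ultimately have oN: "openin (plaques \<alpha>) N"
    unfolding N_def by (intro openin_Int openin_overlap assms)
  have NO: "N \<subseteq> ?O" by (auto simp: N_def)
  have ZN: "subtopology ?Z N = subtopology (plaques \<alpha>) N"
    using NO by (simp add: subtopology_subtopology Int_absorb1)
  define F where "F = (\<lambda>(u, v, y). complex_of_real (Im v / Im y) * ((u - v) / (u - cnj v)) * ((y1 - cnj y) / (y1 - y)))"
  let ?S = "\<H> \<times> \<H> \<times> (\<H> - {y1})"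
  have y1H: "y1 \<in> \<H>" using y1D disk(3)[OF assms(1)] by blast
  have "u - cnj v \<noteq> 0" if "u \<in> \<H>" "v \<in> \<H>" for u v
    using that by (auto simp: upper_half_plane_def complex_eq_iff)
  then have F: "continuous_on ?S F"
    unfolding F_def case_prod_unfold
    by (intro continuous_intros) (auto simp: upper_half_plane_def)
  have \<tau>: "continuous_map (subtopology (plaques \<alpha>) N) (top_of_set \<H>) (\<lambda>q. fst (?\<tau> q))"
  proof -
    have "continuous_map (subtopology (plaques \<alpha>) N) (plaques \<beta>) ?\<tau>"
      using continuous_map_from_subtopology_mono[OF continuous_transition[OF assms] NO] .
    from continuous_map_compose[OF this continuous_map_fst]
    have "continuous_map (subtopology (plaques \<alpha>) N) (top_of_set (D \<beta>)) (\<lambda>q. fst (?\<tau> q))" by (simp add: o_def)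
    then show ?thesis
      using disk(3)[OF assms(2)] by (auto simp: continuous_map_in_subtopology)
  qed
  have \<tau>1: "continuous_map (subtopology (plaques \<alpha>) N) (top_of_set \<H>) (\<lambda>q. fst (?\<tau> (y1, snd q)))"
  proof -
    have "continuous_map (subtopology (plaques \<alpha>) N) (subtopology (plaques \<alpha>) ?O) (\<lambda>q. (y1, snd q))"
      using continuous_map_from_subtopology[OF cshift] by (auto simp: continuous_map_in_subtopology N_def)
    from continuous_map_compose[OF continuous_map_compose[OF this continuous_transition[OF assms]] continuous_map_fst]
    have "continuous_map (subtopology (plaques \<alpha>) N) (top_of_set (D \<beta>)) (\<lambda>q. fst (?\<tau> (y1, snd q)))" by (simp add: o_def)
    then show ?thesis
      using disk(3)[OF assms(2)] by (auto simp: continuous_map_in_subtopology)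
  qed
  have y: "continuous_map (subtopology (plaques \<alpha>) N) (top_of_set (\<H> - {y1})) fst"
    using continuous_map_from_subtopology[OF fst_c, of N] disk(3)[OF assms(1)] sub
    by (auto simp: continuous_map_in_subtopology N_def)
  have "continuous_map (subtopology (plaques \<alpha>) N) (prod_topology (top_of_set \<H>) (prod_topology (top_of_set \<H>) (top_of_set (\<H> - {y1}))))
      (\<lambda>q. (fst (?\<tau> (y1, snd q)), fst (?\<tau> q), fst q))"
    by (intro continuous_map_pairedI \<tau> \<tau>1 y)
  then have 1: "continuous_map (subtopology (plaques \<alpha>) N) (top_of_set ?S)
      (\<lambda>q. (fst (?\<tau> (y1, snd q)), fst (?\<tau> q), fst q))"
    by (simp add: subtopology_Times[symmetric] euclidean_product_topology[symmetric] del: euclidean_product_topology)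
  have "continuous_map (subtopology (plaques \<alpha>) N) euclidean (F \<circ> (\<lambda>q. (fst (?\<tau> (y1, snd q)), fst (?\<tau> q), fst q)))"
    by (rule continuous_map_compose[OF 1]) (use F in simp)
  moreover have "(F \<circ> (\<lambda>q. (fst (?\<tau> (y1, snd q)), fst (?\<tau> q), fst q))) q = transition_deriv \<beta> \<alpha> q"
    if qN: "q \<in> topspace (subtopology (plaques \<alpha>) N)" for q
  proof -
    obtain y t where q: "q = (y, t)" "(y, t) \<in> ?O" "(y1, t) \<in> ?O" "y \<noteq> y1"
      using qN by (cases q) (auto simp: N_def)
    have "y \<in> \<H>" using q(2) sub disk(3)[OF assms(1)] by auto
    from deriv_psl_act_two_points[OF this y1H, of "g t"]
    show ?thesis using q by (simp add: F_def gh)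
  qed
  ultimately have "continuous_map (subtopology (plaques \<alpha>) N) euclidean (transition_deriv \<beta> \<alpha>)"
    by (rule continuous_map_eq)
  moreover have "p \<in> N" using p y1 sub by (auto simp: N_def)
  moreover have "openin ?Z N" using oN NO openin_overlap[OF assms] by (simp add: openin_open_subtopology)
  ultimately show "\<exists>N. openin ?Z N \<and> p \<in> N \<and> continuous_map (subtopology ?Z N) euclidean (transition_deriv \<beta> \<alpha>)"
    using ZN by metis
qed

end

context hyperbolic_lamination
begin

lemma bundle_point_transition:
  assumes "\<alpha> \<in> I" "\<beta> \<in> I" and q: "((y, v), t) \<in> topspace (frames \<alpha>)" and o: "(y, t) \<in> overlap \<beta> \<alpha>"
  shows "bundle_point \<alpha> ((y, v), t) \<in> bdom \<beta>"
    "bchart \<beta> (bundle_point \<alpha> ((y, v), t)) =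
      ((fst (lam_transition L \<beta> \<alpha> (y, t)), transition_deriv \<beta> \<alpha> (y, t) * v), snd (lam_transition L \<beta> \<alpha> (y, t)))"
proof -
  note b = bundle_point[OF assms(1) q]
  obtain x \<xi> where w: "bundle_point \<alpha> ((y, v), t) = (x, \<xi>)" by fastforce
  have x: "x \<in> U \<alpha>" "\<xi> \<in> unit_tangent_vectors L x" "x \<in> topspace M"
    using b(1) by (auto simp: w unit_bundle_dom_def unit_bundle_def)
  have c: "\<phi> \<alpha> x = (y, t)" "\<xi> \<alpha> = v"
    using b(2) by (auto simp: w unit_bundle_chart_def prod_eq_iff)
  then have px: "point \<alpha> (y, t) = x" using point_chart[OF assms(1) x(1)] by simp
  with o have x\<beta>: "x \<in> U \<beta>" by (simp add: overlap_def)
  then show "bundle_point \<alpha> ((y, v), t) \<in> bdom \<beta>"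
    using b(1) by (simp add: w unit_bundle_dom_def)
  have "\<xi> \<beta> = deriv (\<lambda>y. fst (lam_transition L \<beta> \<alpha> (y, snd (\<phi> \<alpha> x)))) (fst (\<phi> \<alpha> x)) * \<xi> \<alpha>"
    using x x\<beta> assms(1,2) unfolding unit_tangent_vectors_def by blast
  moreover have "lam_transition L \<beta> \<alpha> (y, t) = \<phi> \<beta> x"
    using px by (simp add: lam_transition_def point_def)
  ultimately show "bchart \<beta> (bundle_point \<alpha> ((y, v), t)) =
      ((fst (lam_transition L \<beta> \<alpha> (y, t)), transition_deriv \<beta> \<alpha> (y, t) * v), snd (lam_transition L \<beta> \<alpha> (y, t)))"
    by (simp add: w unit_bundle_chart_def transition_deriv_def c)
qed

text \<open>The charts of the unit tangent bundle are homeomorphisms: the topology generated by all charts is no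
finer on a chart domain than the chart itself prescribes, because the transition maps between the
bundle charts are continuous.\<close>

lemma continuous_bundle_point:
  assumes "\<alpha> \<in> I"
  shows "continuous_map (frames \<alpha>) X (bundle_point \<alpha>)"
  unfolding unit_bundle_topology_def
proof (rule continuous_on_generated_topo)
  let ?G = "{{w \<in> unit_bundle_dom L \<alpha>. unit_bundle_chart L \<alpha> w \<in> W} |\<alpha> W. \<alpha> \<in> I \<and> openin (frames \<alpha>) W}"
  have "bundle_point \<alpha> ` topspace (frames \<alpha>) \<subseteq> topspace X"
  proof (rule image_subsetI)
    fix q assume "q \<in> topspace (frames \<alpha>)"
    from subsetD[OF dom_UB bundle_point(1)[OF assms this]] show "bundle_point \<alpha> q \<in> topspace X" by simp
  qed
  then show "bundle_point \<alpha> ` topspace (frames \<alpha>) \<subseteq> \<Union> ?G"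
    unfolding unit_bundle_topology_def topology_generated_by_topspace .
  fix V assume "V \<in> ?G"
  then obtain \<beta> W where V: "V = {w \<in> bdom \<beta>. bchart \<beta> w \<in> W}" "\<beta> \<in> I" "openin (frames \<beta>) W" by blast
  define r where "r = (\<lambda>q :: (complex \<times> complex) \<times> 't. (fst (fst q), snd q))"
  have r: "continuous_map (frames \<alpha>) (plaques \<alpha>) r"
  proof -
    have "continuous_map (frames \<alpha>) (top_of_set (unit_tangent (D \<alpha>))) fst" by (rule continuous_map_fst)
    moreover have "continuous_map (top_of_set (unit_tangent (D \<alpha>))) (top_of_set (D \<alpha>)) fst"
      by (auto simp: unit_tangent_def intro!: continuous_intros)
    ultimately have "continuous_map (frames \<alpha>) (top_of_set (D \<alpha>)) (fst \<circ> fst)"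
      by (rule continuous_map_compose)
    then have "continuous_map (frames \<alpha>) (top_of_set (D \<alpha>)) (\<lambda>q. fst (fst q))" by (simp add: o_def)
    then show ?thesis unfolding r_def by (intro continuous_map_pairedI continuous_map_snd)
  qed
  define N where "N = {q \<in> topspace (frames \<alpha>). r q \<in> overlap \<beta> \<alpha>}"
  have oN: "openin (frames \<alpha>) N"
    unfolding N_def by (rule openin_continuous_map_preimage[OF r openin_overlap[OF assms V(2)]])
  have rN: "continuous_map (subtopology (frames \<alpha>) N) (subtopology (plaques \<alpha>) (overlap \<beta> \<alpha>)) r"
    using continuous_map_from_subtopology[OF r] by (auto simp: continuous_map_in_subtopology N_def)
  let ?t = "lam_transition L \<beta> \<alpha>"
  define H where "H = (\<lambda>q. ((fst (?t (r q)), transition_deriv \<beta> \<alpha> (r q) * snd (fst q)), snd (?t (r q))))"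
  have HN: "bundle_point \<alpha> q \<in> bdom \<beta> \<and> bchart \<beta> (bundle_point \<alpha> q) = H q" if "q \<in> N" for q
    using that bundle_point_transition[OF assms V(2)]
    by (cases q) (auto simp: H_def r_def N_def)
  have t: "continuous_map (subtopology (frames \<alpha>) N) (plaques \<beta>) (\<lambda>q. ?t (r q))"
    using continuous_map_compose[OF rN continuous_transition[OF assms V(2)]] by (simp add: o_def)
  have t1: "continuous_map (subtopology (frames \<alpha>) N) (top_of_set (D \<beta>)) (\<lambda>q. fst (?t (r q)))"
    using continuous_map_compose[OF t continuous_map_fst] by (simp add: o_def)
  have t2: "continuous_map (subtopology (frames \<alpha>) N) (T \<beta>) (\<lambda>q. snd (?t (r q)))"
    using continuous_map_compose[OF t continuous_map_snd] by (simp add: o_def)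
  have d: "continuous_map (subtopology (frames \<alpha>) N) euclidean (\<lambda>q. transition_deriv \<beta> \<alpha> (r q))"
    using continuous_map_compose[OF rN continuous_transition_deriv[OF assms V(2)]] by (simp add: o_def)
  have v: "continuous_map (subtopology (frames \<alpha>) N) euclidean (\<lambda>q. snd (fst q))"
  proof -
    have "continuous_map (top_of_set (unit_tangent (D \<alpha>))) euclidean snd"
      by (auto intro!: continuous_intros)
    from continuous_map_compose[OF continuous_map_fst this]
    have "continuous_map (frames \<alpha>) euclidean (\<lambda>q. snd (fst q))" by (simp add: o_def)
    then show ?thesis by (rule continuous_map_from_subtopology)
  qed
  have "continuous_map (subtopology (frames \<alpha>) N) (prod_topology euclidean euclidean)
      (\<lambda>q. (transition_deriv \<beta> \<alpha> (r q), snd (fst q)))"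
    by (intro continuous_map_pairedI d v)
  then have "continuous_map (subtopology (frames \<alpha>) N) euclidean (\<lambda>q. (transition_deriv \<beta> \<alpha> (r q), snd (fst q)))"
    by simp
  from continuous_map_compose[OF this, of euclidean "\<lambda>(a, b). a * b"]
  have dv: "continuous_map (subtopology (frames \<alpha>) N) euclidean (\<lambda>q. transition_deriv \<beta> \<alpha> (r q) * snd (fst q))"
    by (simp add: o_def case_prod_unfold continuous_intros)
  have "continuous_map (subtopology (frames \<alpha>) N) (prod_topology euclidean euclidean)
      (\<lambda>q. (fst (?t (r q)), transition_deriv \<beta> \<alpha> (r q) * snd (fst q)))"
    by (intro continuous_map_pairedI dv continuous_map_into_fulltopology[OF t1])
  then have "continuous_map (subtopology (frames \<alpha>) N) euclidean
      (\<lambda>q. (fst (?t (r q)), transition_deriv \<beta> \<alpha> (r q) * snd (fst q)))" by simp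
  moreover have "(fst (?t (r q)), transition_deriv \<beta> \<alpha> (r q) * snd (fst q)) \<in> unit_tangent (D \<beta>)"
    if "q \<in> N" for q
    using HN[OF that] chart_in_frames[OF V(2), of "bundle_point \<alpha> q"] by (simp add: H_def)
  ultimately have "continuous_map (subtopology (frames \<alpha>) N) (top_of_set (unit_tangent (D \<beta>)))
      (\<lambda>q. (fst (?t (r q)), transition_deriv \<beta> \<alpha> (r q) * snd (fst q)))"
    by (simp add: continuous_map_in_subtopology image_subset_iff_funcset[symmetric] image_subset_iff)
  then have H: "continuous_map (subtopology (frames \<alpha>) N) (frames \<beta>) H"
    unfolding H_def by (intro continuous_map_pairedI t2)
  have "openin (subtopology (frames \<alpha>) N) {q \<in> topspace (subtopology (frames \<alpha>) N). H q \<in> W}"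
    by (rule openin_continuous_map_preimage[OF H V(3)])
  then have "openin (frames \<alpha>) {q \<in> topspace (subtopology (frames \<alpha>) N). H q \<in> W}"
    using oN openin_trans_full by blast
  moreover have "{q \<in> topspace (subtopology (frames \<alpha>) N). H q \<in> W} = bundle_point \<alpha> -` V \<inter> topspace (frames \<alpha>)"
  proof -
    have "q \<in> N" if "q \<in> topspace (frames \<alpha>)" "bundle_point \<alpha> q \<in> bdom \<beta>" for q
    proof -
      obtain y v t where q: "q = ((y, v), t)" by (metis prod.collapse)
      obtain x \<xi> where w: "bundle_point \<alpha> q = (x, \<xi>)" by fastforce
      note b = bundle_point[OF assms that(1)]
      have "x \<in> U \<alpha>" "x \<in> U \<beta>" using b(1) that(2) by (auto simp: w unit_bundle_dom_def)
      moreover have "\<phi> \<alpha> x = (y, t)" using b(2) by (auto simp: w[unfolded q] q unit_bundle_chart_def prod_eq_iff)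
      ultimately have "point \<alpha> (y, t) \<in> U \<beta>" "(y, t) \<in> D \<alpha> \<times> topspace (T \<alpha>)"
        using point_chart[OF assms, of x] chart_in[OF assms, of x] by auto
      then show ?thesis using that(1) by (simp add: N_def overlap_def q r_def)
    qed
    then show ?thesis using HN by (auto simp: V(1) N_def)
  qed
  ultimately show "openin (frames \<alpha>) (bundle_point \<alpha> -` V \<inter> topspace (frames \<alpha>))" by simp
qed

lemma act_in_chart:
  assumes "\<alpha> \<in> I" "w \<in> bdom \<alpha>" "p \<in> unit_tangent_plane"
    and D: "fst (frame_mult (fst (bchart \<alpha> w)) p) \<in> D \<alpha>"
  shows "(frame_mult (fst (bchart \<alpha> w)) p, snd (bchart \<alpha> w)) \<in> topspace (frames \<alpha>)"
    "act w (psl_of_frame p) = bundle_point \<alpha> (frame_mult (fst (bchart \<alpha> w)) p, snd (bchart \<alpha> w))"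
proof -
  obtain k t where k: "bchart \<alpha> w = (psl_frame k, t)" "t \<in> topspace (T \<alpha>)"
    using unit_bundle_coordinates[OF assms(1,2)] by metis
  obtain g where g: "p = psl_frame g" using assms(3) by (rule psl_frame_cases)
  have m: "frame_mult (fst (bchart \<alpha> w)) p = psl_frame (k * g)"
    using psl_differential_eq_frame_mult(1)[OF assms(3), of k] by (simp add: k g psl_frame_mult)
  have "psl_frame (k * g) \<in> unit_tangent (D \<alpha>)"
    using D psl_frame_in[of "k * g"] unfolding m by (auto simp: unit_tangent_def)
  then show F: "(frame_mult (fst (bchart \<alpha> w)) p, snd (bchart \<alpha> w)) \<in> topspace (frames \<alpha>)"
    unfolding m by (simp add: k)
  note b = bundle_point[OF assms(1) F]
  have "bchart \<alpha> (bundle_point \<alpha> (frame_mult (fst (bchart \<alpha> w)) p, snd (bchart \<alpha> w))) = (psl_frame (k * g), t)"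
    by (rule trans[OF b(2)]) (unfold m, simp add: k)
  note bc = this
  have "right_action_rel L w g (bundle_point \<alpha> (frame_mult (fst (bchart \<alpha> w)) p, snd (bchart \<alpha> w)))"
    by (rule right_action_rel.chart[OF assms(1,2) b(1) k(1) bc])
  then show "act w (psl_of_frame p) = bundle_point \<alpha> (frame_mult (fst (bchart \<alpha> w)) p, snd (bchart \<alpha> w))"
    using right_action_rel_imp_act by (simp add: g)
qed

text \<open>For \<open>g\<close> moving \<open>\<i>\<close> by less than \<open>plaque_size\<close> the action near \<open>(w, g)\<close> is right multiplication in a
single chart.\<close>

lemma continuous_act_near:
  assumes w0: "w0 \<in> UB" and p0: "p0 \<in> unit_tangent_plane" "dist \<i> (fst p0) < plaque_size"
  obtains N where "openin (prod_topology X psl_topology) N" "(w0, p0) \<in> N"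
    "continuous_map (subtopology (prod_topology X psl_topology) N) X (\<lambda>(w, p). act w (psl_of_frame p))"
proof -
  obtain \<alpha> k t where c: "\<alpha> \<in> I" "w0 \<in> bdom \<alpha>" "bchart \<alpha> w0 = (psl_frame k, t)"
    "\<And>z. z \<in> ball \<i> plaque_size \<Longrightarrow> coord (leaf_param w0) z \<alpha> k t"
    using coord_ball[OF w0] by blast
  let ?Z = "prod_topology X psl_topology"
  let ?N0 = "bdom \<alpha> \<times> unit_tangent_plane"
  define m where "m = (\<lambda>(w, p). frame_mult (fst (bchart \<alpha> w)) p)"
  have oN0: "openin ?Z ?N0" using openin_dom_X[OF c(1)] by (simp add: openin_prod_Times_iff)
  have ch: "continuous_map (subtopology ?Z ?N0) (frames \<alpha>) (\<lambda>x. bchart \<alpha> (fst x))"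
  proof -
    have "continuous_map (subtopology ?Z ?N0) (subtopology X (bdom \<alpha>)) fst"
      using continuous_map_from_subtopology[OF continuous_map_fst, of X psl_topology ?N0]
      by (auto simp: continuous_map_in_subtopology)
    from continuous_map_compose[OF this continuous_unit_bundle_chart[OF c(1)]] show ?thesis by (simp add: o_def)
  qed
  have ch1: "continuous_map (subtopology ?Z ?N0) psl_topology (\<lambda>x. fst (bchart \<alpha> (fst x)))"
    using continuous_map_compose[OF ch continuous_map_fst] unit_tangent_disk[OF c(1)]
    by (auto simp: o_def continuous_map_in_subtopology)
  have ch2: "continuous_map (subtopology ?Z ?N0) (T \<alpha>) (\<lambda>x. snd (bchart \<alpha> (fst x)))"
    using continuous_map_compose[OF ch continuous_map_snd] by (simp add: o_def)
  have sn: "continuous_map (subtopology ?Z ?N0) psl_topology snd"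
    by (rule continuous_map_from_subtopology[OF continuous_map_snd])
  have "continuous_map (subtopology ?Z ?N0) (prod_topology psl_topology psl_topology) (\<lambda>x. (fst (bchart \<alpha> (fst x)), snd x))"
    by (intro continuous_map_pairedI ch1 sn)
  then have "continuous_map (subtopology ?Z ?N0) (top_of_set (unit_tangent_plane \<times> unit_tangent_plane)) (\<lambda>x. (fst (bchart \<alpha> (fst x)), snd x))"
    by (simp add: subtopology_Times[symmetric] euclidean_product_topology[symmetric] del: euclidean_product_topology)
  from continuous_map_compose[OF this, of euclidean "\<lambda>(p, q). frame_mult p q"]
  have m: "continuous_map (subtopology ?Z ?N0) euclidean m"
    using continuous_on_frame_mult by (simp add: o_def m_def case_prod_unfold)
  define N where "N = {x \<in> topspace (subtopology ?Z ?N0). m x \<in> D \<alpha> \<times> UNIV}"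
  have "openin (subtopology ?Z ?N0) N"
    unfolding N_def by (rule openin_continuous_map_preimage[OF m]) (simp add: open_Times disk c)
  then have oN: "openin ?Z N" using oN0 openin_trans_full by blast
  have N: "act w (psl_of_frame p) = bundle_point \<alpha> (m (w, p), snd (bchart \<alpha> w))"
      "(m (w, p), snd (bchart \<alpha> w)) \<in> topspace (frames \<alpha>)" if "(w, p) \<in> N" for w p
    using that act_in_chart[OF c(1), of w p] by (auto simp: N_def m_def case_prod_unfold mem_Times_iff)
  have NN0: "N \<subseteq> ?N0" by (auto simp: N_def)
  have "continuous_map (subtopology ?Z N) (frames \<alpha>) (\<lambda>x. (m x, snd (bchart \<alpha> (fst x))))"
  proof (rule continuous_map_pairedI)
    show "continuous_map (subtopology ?Z N) (T \<alpha>) (\<lambda>x. snd (bchart \<alpha> (fst x)))"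
      by (rule continuous_map_from_subtopology_mono[OF ch2 NN0])
    show "continuous_map (subtopology ?Z N) (top_of_set (unit_tangent (D \<alpha>))) m"
      using continuous_map_from_subtopology_mono[OF m NN0] N(2)
      by (auto simp: continuous_map_in_subtopology)
  qed
  from continuous_map_compose[OF this continuous_bundle_point[OF c(1)]]
  have "continuous_map (subtopology ?Z N) X (\<lambda>x. bundle_point \<alpha> (m x, snd (bchart \<alpha> (fst x))))" by (simp add: o_def)
  then have cont: "continuous_map (subtopology ?Z N) X (\<lambda>(w, p). act w (psl_of_frame p))"
    by (rule continuous_map_eq) (use N(1) in auto)
  have "(w0, p0) \<in> N"
  proof -
    obtain g where g: "p0 = psl_frame g" using p0(1) by (rule psl_frame_cases)
    have "psl_act g \<i> \<in> ball \<i> plaque_size" using p0(2) by (simp add: g fst_psl_frame)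
    from coord_at(6)[OF c(4)[OF this]] have "psl_act k (psl_act g \<i>) \<in> D \<alpha>" .
    moreover have "m (w0, p0) = psl_frame (k * g)"
      using psl_differential_eq_frame_mult(1)[OF p0(1), of k] by (simp add: m_def c(3) g psl_frame_mult)
    ultimately have "fst (m (w0, p0)) \<in> D \<alpha>" by (simp add: fst_psl_frame psl_act_mult)
    then show ?thesis using c(2) w0 p0(1) by (simp add: N_def mem_Times_iff)
  qed
  with oN cont show ?thesis by (intro that)
qed

lemma continuous_act_fixed: "continuous_map X X (\<lambda>w. act w g)"
proof (rule psl2_generated_near_stabilizer[where P = "\<lambda>g. continuous_map X X (\<lambda>w. act w g)" and e = plaque_size])
  fix g h assume *: "continuous_map X X (\<lambda>w. act w g)" "continuous_map X X (\<lambda>w. act w h)"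
  have "continuous_map X X (\<lambda>w. act (act w g) h)"
    using continuous_map_compose[OF *] by (simp add: o_def)
  then show "continuous_map X X (\<lambda>w. act w (g * h))"
    by (rule continuous_map_eq) (simp add: act_mult)
next
  fix g assume g: "dist \<i> (psl_act g \<i>) < plaque_size"
  show "continuous_map X X (\<lambda>w. act w g)"
  proof (rule continuous_map_locally)
    fix w0 assume "w0 \<in> topspace X"
    then have w0: "w0 \<in> UB" by simp
    obtain N where N: "openin (prod_topology X psl_topology) N" "(w0, psl_frame g) \<in> N"
      "continuous_map (subtopology (prod_topology X psl_topology) N) X (\<lambda>(w, p). act w (psl_of_frame p))"
      using continuous_act_near[OF w0 psl_frame_in] g by (auto simp: fst_psl_frame)
    have i: "continuous_map X (prod_topology X psl_topology) (\<lambda>w. (w, psl_frame g))"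
      by (intro continuous_map_pairedI) (auto simp: continuous_map_const)
    let ?N = "{w \<in> topspace X. (w, psl_frame g) \<in> N}"
    have "continuous_map (subtopology X ?N) (subtopology (prod_topology X psl_topology) N) (\<lambda>w. (w, psl_frame g))"
      using continuous_map_from_subtopology[OF i] by (auto simp: continuous_map_in_subtopology)
    from continuous_map_compose[OF this N(3)]
    have "continuous_map (subtopology X ?N) X (\<lambda>w. act w g)" by (simp add: o_def)
    moreover have "openin X ?N" by (rule openin_continuous_map_preimage[OF i N(1)])
    ultimately show "\<exists>N. openin X N \<and> w0 \<in> N \<and> continuous_map (subtopology X N) X (\<lambda>w. act w g)"
      using w0 N(2) by (intro exI[of _ ?N]) simp
  qed
qed (rule plaque_size_bounds)

lemma continuous_on_psl_differential:
  "continuous_on unit_tangent_plane (psl_differential g)"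
proof -
  have "continuous_on unit_tangent_plane (\<lambda>p. (\<lambda>(p, q). frame_mult p q) (psl_frame g, p))"
    by (rule continuous_on_compose2[OF continuous_on_frame_mult]) (auto intro!: continuous_intros)
  then show ?thesis
    by (rule continuous_on_eq) (simp add: psl_differential_eq_frame_mult(1))
qed

text \<open>Write \<open>w g = (w g\<^sub>0) (g\<^sub>0\<^sup>-\<^sup>1 g)\<close>. For \<open>g\<close> near \<open>g\<^sub>0\<close> the second factor is near 1.\<close>

theorem continuous_act:
  "continuous_map (prod_topology X psl_topology) X (\<lambda>(w, p). act w (psl_of_frame p))"
proof (rule continuous_map_locally)
  let ?Z = "prod_topology X psl_topology"
  fix x assume "x \<in> topspace ?Z"
  then obtain w0 p0 where x: "x = (w0, p0)" "w0 \<in> UB" "p0 \<in> unit_tangent_plane" by auto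
  define g where "g = psl_of_frame p0"
  have p0: "p0 = psl_frame g" using x(3) by (simp add: g_def psl_frame_of_frame)
  define s where "s = (\<lambda>(w, p). (act w g, psl_differential (psl_inv g) p))"
  have s: "continuous_map ?Z ?Z s"
  proof -
    have "continuous_map psl_topology psl_topology (psl_differential (psl_inv g))"
      using continuous_on_psl_differential psl_differential_in by (auto simp: continuous_map_in_subtopology)
    from continuous_map_compose[OF continuous_map_snd this]
    have "continuous_map ?Z psl_topology (\<lambda>x. psl_differential (psl_inv g) (snd x))" by (simp add: o_def)
    moreover have "continuous_map ?Z X (\<lambda>x. act (fst x) g)"
      using continuous_map_compose[OF continuous_map_fst continuous_act_fixed] by (simp add: o_def)
    ultimately show ?thesis unfolding s_def case_prod_unfold by (intro continuous_map_pairedI)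
  qed
  have "psl_differential (psl_inv g) p0 = (\<i>, \<i>)"
    by (simp add: p0 psl_inv frame_one flip: psl_frame_mult)
  then obtain N where N: "openin ?Z N" "s x \<in> N" "continuous_map (subtopology ?Z N) X (\<lambda>(w, p). act w (psl_of_frame p))"
    using continuous_act_near[OF act_in[OF x(2), of g] base_frame] plaque_size_bounds by (auto simp: x s_def)
  let ?N = "{x \<in> topspace ?Z. s x \<in> N}"
  have "continuous_map (subtopology ?Z ?N) (subtopology ?Z N) s"
    using continuous_map_from_subtopology[OF s] by (auto simp: continuous_map_in_subtopology)
  from continuous_map_compose[OF this N(3)]
  have "continuous_map (subtopology ?Z ?N) X (\<lambda>x. (\<lambda>(w, p). act w (psl_of_frame p)) (s x))" by (simp add: o_def)
  moreover have "(\<lambda>(w, p). act w (psl_of_frame p)) (s y) = (\<lambda>(w, p). act w (psl_of_frame p)) y"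
    if yZ: "y \<in> topspace ?Z" for y
  proof -
    obtain w h where y: "y = (w, psl_frame h)" "w \<in> UB" using yZ by (auto elim: psl_frame_cases)
    then show ?thesis by (simp add: s_def act_mult flip: psl_frame_mult)
  qed
  ultimately have "continuous_map (subtopology ?Z ?N) X (\<lambda>(w, p). act w (psl_of_frame p))"
    by (rule continuous_map_eq) auto
  moreover have "openin ?Z ?N" by (rule openin_continuous_map_preimage[OF s N(1)])
  ultimately show "\<exists>N. openin ?Z N \<and> x \<in> N \<and> continuous_map (subtopology ?Z N) X (\<lambda>(w, p). act w (psl_of_frame p))"
    using x N(2) by (intro exI[of _ ?N]) simp
qed

end

section \<open>Closed geodesics in leaves\<close>

lemma simply_connected_space_homeomorphic:
  assumes X: "simply_connected_space X" and fg: "homeomorphic_maps X Y f g"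
  shows "simply_connected_space Y"
  unfolding simply_connected_space_def
proof (intro allI impI, elim conjE)
  fix p q :: "real \<Rightarrow> 'b" assume p: "pathin Y p" "p 1 = p 0" and q: "pathin Y q" "q 1 = q 0"
  have f: "continuous_map X Y f" and g: "continuous_map Y X g" and fg': "\<And>y. y \<in> topspace Y \<Longrightarrow> f (g y) = y"
    using fg by (auto simp: homeomorphic_maps_def)
  have "pathin X (g \<circ> p)" "pathin X (g \<circ> q)"
    using p q continuous_map_compose[OF _ g] by (auto simp: pathin_def)
  then have "homotopic_with (\<lambda>r. r 1 = r 0) (top_of_set {0..1}) X (g \<circ> p) (g \<circ> q)"
    using X p q unfolding simply_connected_space_def by simp
  then have hom: "homotopic_with (\<lambda>r. r 1 = r 0) (top_of_set {0..1}) Y (f \<circ> (g \<circ> p)) (f \<circ> (g \<circ> q))"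
    by (rule homotopic_with_compose_continuous_map_left[OF _ f]) simp
  have "f (g (r x)) = r x" if "pathin Y r" "x \<in> {0..1}" for r x
    using that continuous_map_image_subset_topspace[of "top_of_set {0..1}" Y r]
    by (intro fg') (auto simp: pathin_def)
  with p(1) q(1) show "homotopic_with (\<lambda>r. r 1 = r 0) (top_of_set {0..1}) Y p q"
    by (intro homotopic_with_eq[OF hom]) auto
qed

context hyperbolic_lamination
begin

abbreviation "\<L> \<equiv> leaf_topology L"

lemma openin_plaque:
  assumes "\<alpha> \<in> I" "open V" "V \<subseteq> D \<alpha>" "t \<in> topspace (T \<alpha>)"
  shows "openin \<L> {x \<in> U \<alpha>. fst (\<phi> \<alpha> x) \<in> V \<and> snd (\<phi> \<alpha> x) = t}"
proof -
  have "openin (top_of_set (D \<alpha>)) V"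
    using assms disk by (simp add: openin_open_eq)
  then show ?thesis
    unfolding leaf_topology_def using assms by (intro topology_generated_by_Basis) blast
qed

lemma topspace_leaf_topology: "topspace \<L> = topspace M"
proof
  show "topspace \<L> \<subseteq> topspace M"
    unfolding leaf_topology_def topology_generated_by_topspace using dom_subset by blast
  show "topspace M \<subseteq> topspace \<L>"
  proof
    fix x assume "x \<in> topspace M"
    then obtain \<alpha> where \<alpha>: "\<alpha> \<in> I" "x \<in> U \<alpha>" using dom_cover by blast
    have "x \<in> {x' \<in> U \<alpha>. fst (\<phi> \<alpha> x') \<in> D \<alpha> \<and> snd (\<phi> \<alpha> x') = snd (\<phi> \<alpha> x)}"
      using \<alpha> chart_in[OF \<alpha>] by auto
    moreover have "openin \<L> {x' \<in> U \<alpha>. fst (\<phi> \<alpha> x') \<in> D \<alpha> \<and> snd (\<phi> \<alpha> x') = snd (\<phi> \<alpha> x)}"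
      using \<alpha> chart_in[OF \<alpha>] by (intro openin_plaque disk) auto
    ultimately show "x \<in> topspace \<L>" using openin_subset by blast
  qed
qed

lemma continuous_developing:
  assumes P: "developing \<H> P"
  shows "continuous_map (top_of_set \<H>) \<L> P"
proof -
  let ?G = "{{x \<in> U \<alpha>. fst (\<phi> \<alpha> x) \<in> V \<and> snd (\<phi> \<alpha> x) = t} | \<alpha> V t.
       \<alpha> \<in> I \<and> openin (top_of_set (D \<alpha>)) V \<and> t \<in> topspace (T \<alpha>)}"
  have "P z \<in> topspace M" if "z \<in> \<H>" for z
    using P that coord_at(7) unfolding developing_def by blast
  then have im: "P ` topspace (top_of_set \<H>) \<subseteq> \<Union> ?G"
    using topspace_leaf_topology unfolding leaf_topology_def topology_generated_by_topspace by auto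
  have "openin (top_of_set \<H>) (P -` O' \<inter> topspace (top_of_set \<H>))" if O': "O' \<in> ?G" for O'
  proof -
    obtain \<alpha> V t where V: "O' = {x \<in> U \<alpha>. fst (\<phi> \<alpha> x) \<in> V \<and> snd (\<phi> \<alpha> x) = t}"
       "\<alpha> \<in> I" "openin (top_of_set (D \<alpha>)) V" using O' by blast
    have oV: "open V" using V(3) disk(1)[OF V(2)] openin_open_trans by blast
    define S where "S = P -` O' \<inter> \<H>"
    have "\<exists>T. open T \<and> z \<in> T \<and> T \<subseteq> S" if "z \<in> S" for z
    proof -
      have z: "P z \<in> O'" "z \<in> \<H>" using that by (auto simp: S_def)
      obtain \<beta> h u where "coord P z \<beta> h u" using P z(2) unfolding developing_def by blast
      then obtain g t' where c: "coord P z \<alpha> g t'" using coord_change[of P z \<beta> h u \<alpha>] V z(1) by blast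
      then have t': "t' = t" "psl_act g z \<in> V" using coord_at(2)[OF c] z(1) by (auto simp: V(1))
      have "\<forall>\<^sub>F z' in nhds z. psl_act g z' \<in> V"
        by (rule eventually_psl_act[OF z(2) eventually_nhds_in_open[OF oV t'(2)]])
      with coord_eventually[OF c] have "\<forall>\<^sub>F z' in nhds z. z' \<in> S"
        by eventually_elim (use coord_at t' in \<open>auto simp: S_def V(1)\<close>)
      then show ?thesis unfolding eventually_nhds by blast
    qed
    then have "open S" by (subst open_subopen) blast
    then show ?thesis using S_def by (simp add: openin_open_eq open_upper_half_plane)
  qed
  then show ?thesis
    unfolding leaf_topology_def by (intro continuous_on_generated_topo im)
qed

lemma open_map_developing:
  assumes P: "developing \<H> P" and V: "open V" "V \<subseteq> \<H>"
  shows "openin \<L> (P ` V)"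
proof (subst openin_subopen, intro ballI)
  fix x assume "x \<in> P ` V"
  then obtain z where z: "z \<in> V" "x = P z" by blast
  obtain \<alpha> g t where c: "coord P z \<alpha> g t" using P V z unfolding developing_def by blast
  have "\<forall>\<^sub>F z' in nhds z. z' \<in> V \<and> coord P z' \<alpha> g t"
    using eventually_nhds_in_open[OF V(1) z(1)] coord_eventually[OF c] by (rule eventually_conj)
  then obtain S where S: "open S" "z \<in> S" "\<And>z'. z' \<in> S \<Longrightarrow> z' \<in> V \<and> coord P z' \<alpha> g t"
    unfolding eventually_nhds by blast
  have SH: "S \<subseteq> \<H>" using S(3) V(2) by blast
  have "P ` S = {x \<in> U \<alpha>. fst (\<phi> \<alpha> x) \<in> psl_act g ` S \<and> snd (\<phi> \<alpha> x) = t}"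
  proof (intro equalityI subsetI)
    fix x assume "x \<in> P ` S"
    then show "x \<in> {x \<in> U \<alpha>. fst (\<phi> \<alpha> x) \<in> psl_act g ` S \<and> snd (\<phi> \<alpha> x) = t}"
      using S(3) coord_at(1,2) by fastforce
  next
    fix x assume "x \<in> {x \<in> U \<alpha>. fst (\<phi> \<alpha> x) \<in> psl_act g ` S \<and> snd (\<phi> \<alpha> x) = t}"
    then obtain z' where z': "x \<in> U \<alpha>" "z' \<in> S" "\<phi> \<alpha> x = (psl_act g z', t)" by (auto simp: prod_eq_iff)
    have "coord P z' \<alpha> g t" using S(3) z'(2) by blast
    then have "x = P z'" using z' by (intro chart_inj[of \<alpha>]) (simp_all add: coord_at)
    then show "x \<in> P ` S" using z'(2) by blast
  qed
  moreover have "openin \<L> {x \<in> U \<alpha>. fst (\<phi> \<alpha> x) \<in> psl_act g ` S \<and> snd (\<phi> \<alpha> x) = t}"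
    using coord_at(6)[OF conjunct2[OF S(3)]] coord_at(4,5)[OF c]
    by (intro openin_plaque open_psl_image S(1) SH) auto
  ultimately show "\<exists>T. openin \<L> T \<and> x \<in> T \<and> T \<subseteq> P ` V"
    using S(2,3) z(2) by (intro exI[of _ "P ` S"]) auto
qed

text \<open>Developing maps with a common value differ by an isometry, which is read off in a chart around this
value.\<close>

lemma developing_deck:
  assumes P: "developing \<H> P" and Q: "developing \<H> Q"
    and z: "z \<in> \<H>" "z' \<in> \<H>" "P z = Q z'"
  obtains g where "psl_act g z' = z" "\<And>y. y \<in> \<H> \<Longrightarrow> Q y = P (psl_act g y)"
proof -
  obtain \<alpha> k t where c: "coord P z \<alpha> k t" using P z(1) unfolding developing_def by blast
  obtain \<beta> h' u' where "coord Q z' \<beta> h' u'" using Q z(2) unfolding developing_def by blast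
  then obtain h u where c': "coord Q z' \<alpha> h u"
    using coord_change[of Q z' \<beta> h' u' \<alpha>] coord_at(1,4)[OF c] z(3) by metis
  have e: "t = u" "psl_act k z = psl_act h z'"
    using coord_at(2)[OF c] coord_at(2)[OF c'] z(3) by auto
  let ?g = "psl_inv k * h"
  have g: "psl_act ?g z' = z" by (simp add: psl_act_mult psl_act_inv z flip: e)
  have "coord (\<lambda>y. P (psl_act ?g y)) z' \<alpha> (k * ?g) t"
    using c g z(2) by (intro coord_compose) simp_all
  then have c'': "coord (\<lambda>y. P (psl_act ?g y)) z' \<alpha> h u" using e(1) by simp
  have "Q y = P (psl_act ?g y)" if "y \<in> \<H>" for y
    using developing_identity[OF convex_connected[OF convex_upper_half_plane] Q developing_compose(1)[OF P] z(2)
        coord_same_germ[OF c' c''] that]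
    by (rule eventually_nhds_x_imp_x)
  with g show ?thesis by (rule that)
qed

lemma ex_developing_through:
  assumes "x \<in> topspace M"
  obtains P where "developing \<H> P" "P \<i> = x"
proof -
  obtain \<alpha> where \<alpha>: "\<alpha> \<in> I" "x \<in> U \<alpha>" using dom_cover[OF assms] by blast
  obtain y t where y: "\<phi> \<alpha> x = (y, t)" "y \<in> D \<alpha>" "t \<in> topspace (T \<alpha>)" using chart_in[OF \<alpha>] by auto
  have yH: "y \<in> \<H>" using y(2) disk(3)[OF \<alpha>(1)] by blast
  obtain a r where b: "psl_act (horocycle_subgroup a * geodesic_subgroup r) \<i> = y" using upper_affine_transitive[OF yH] .
  let ?k = "horocycle_subgroup a * geodesic_subgroup r"
  have "coord (\<lambda>z. point \<alpha> (psl_act ?k z, t)) \<i> \<alpha> ?k t"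
    by (intro coord_plaque \<alpha> y) (simp_all only: b y i_in_upper)
  then obtain P where P: "developing \<H> P" "\<forall>\<^sub>F z in nhds \<i>. P z = point \<alpha> (psl_act ?k z, t)"
    by (rule global_extension)
  have "P \<i> = point \<alpha> (psl_act ?k \<i>, t)" using P(2) by (rule eventually_nhds_x_imp_x)
  also have "\<dots> = x" unfolding b y(1)[symmetric] by (rule point_chart[OF \<alpha>])
  finally show ?thesis using P(1) by (intro that)
qed

text \<open>The images of developing maps are open and connected in the leaf topology, and two of them are either
equal or disjoint. So they are the connected components.\<close>

lemma leaf_eq_developing_image:
  assumes F: "F \<in> leaves L" and P: "developing \<H> P" "P \<i> \<in> F"
  shows "F = P ` \<H>"
proof
  have conn: "connectedin \<L> F" using F unfolding leaves_def by (rule connectedin_connected_components_of)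
  have "connectedin \<L> (P ` \<H>)"
    using connectedin_continuous_map_image[OF continuous_developing[OF P(1)], of \<H>]
      convex_connected[OF convex_upper_half_plane] by (simp add: connectedin_subtopology)
  moreover have "\<not> disjnt F (P ` \<H>)" using P(2) by (auto simp: disjnt_iff intro!: imageI)
  ultimately show "P ` \<H> \<subseteq> F"
    using F unfolding leaves_def by (intro connected_components_of_maximal)
  define E where "E = \<Union> {Q ` \<H> | Q. developing \<H> Q \<and> Q ` \<H> \<inter> P ` \<H> = {}}"
  have oE: "openin \<L> E" unfolding E_def
    by (rule openin_Union) (auto intro: open_map_developing open_upper_half_plane)
  have oP: "openin \<L> (P ` \<H>)" by (rule open_map_developing[OF P(1) open_upper_half_plane order_refl])
  have cover: "x \<in> P ` \<H> \<union> E" if "x \<in> F" for x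
  proof -
    have "x \<in> topspace M" using that connectedin_subset_topspace[OF conn] topspace_leaf_topology by blast
    then obtain Q where Q: "developing \<H> Q" "Q \<i> = x" by (rule ex_developing_through)
    show ?thesis
    proof (cases "Q ` \<H> \<inter> P ` \<H> = {}")
      case True
      then have "Q ` \<H> \<subseteq> E" unfolding E_def using Q(1) by (intro Union_upper) blast
      moreover have "x \<in> Q ` \<H>" using Q(2) i_in_upper by (metis imageI)
      ultimately show ?thesis by blast
    next
      case False
      then obtain z z' where "z \<in> \<H>" "z' \<in> \<H>" "P z = Q z'"
        unfolding disjoint_iff by (metis imageE)
      from developing_deck[OF P(1) Q(1) this] obtain g where "Q \<i> = P (psl_act g \<i>)" by (metis i_in_upper)
      then show ?thesis using Q(2) psl_act_upper[OF i_in_upper, of g] by auto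
    qed
  qed
  have "E \<inter> F = {}"
  proof (rule ccontr)
    assume "E \<inter> F \<noteq> {}"
    moreover have "P ` \<H> \<inter> F \<noteq> {}" using P(2) imageI[OF i_in_upper, of P] by blast
    moreover have "P ` \<H> \<inter> E \<inter> F = {}" by (auto simp: E_def)
    moreover have "F \<subseteq> P ` \<H> \<union> E" using cover by blast
    ultimately show False using connectedinD[OF conn oP oE] by blast
  qed
  with cover show "F \<subseteq> P ` \<H>" by blast
qed

text \<open>An injective developing map is a homeomorphism from the half plane onto the leaf.\<close>

lemma simply_connected_if_inj:
  assumes F: "F \<in> leaves L" and P: "developing \<H> P" "P \<i> \<in> F" "inj_on P \<H>"
  shows "simply_connected_space (subtopology \<L> F)"
proof -
  have FP: "F = P ` \<H>" by (rule leaf_eq_developing_image[OF F P(1,2)])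
  have F': "F \<subseteq> topspace \<L>" using F connected_components_of_subset unfolding leaves_def by blast
  have "homeomorphic_map (top_of_set \<H>) (subtopology \<L> F) P"
  proof (rule bijective_open_imp_homeomorphic_map)
    show "continuous_map (top_of_set \<H>) (subtopology \<L> F) P"
      using continuous_developing[OF P(1)] by (auto simp: continuous_map_in_subtopology FP)
    show "open_map (top_of_set \<H>) (subtopology \<L> F) P"
      unfolding open_map_def
    proof (intro allI impI)
      fix V assume "openin (top_of_set \<H>) V"
      then have "open V" "V \<subseteq> \<H>" using open_upper_half_plane openin_open_eq by auto
      then have "openin \<L> (P ` V)" "P ` V \<subseteq> F" using open_map_developing[OF P(1)] FP by auto
      then show "openin (subtopology \<L> F) (P ` V)" by (metis Int_absorb2 openin_subtopology)
    qed
    show "P ` topspace (top_of_set \<H>) = topspace (subtopology \<L> F)" using FP F' by auto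
  qed (use P(3) in simp)
  then obtain g where "homeomorphic_maps (top_of_set \<H>) (subtopology \<L> F) P g"
    using homeomorphic_map_maps by blast
  moreover have "simply_connected_space (top_of_set \<H>)"
    by (simp add: simply_connected_space_top_of_set convex_imp_simply_connected convex_upper_half_plane)
  ultimately show ?thesis by (rule simply_connected_space_homeomorphic[rotated])
qed

text \<open>A lower bound for the injectivity radius of all leaves. It excludes cusps.\<close>

lemma developing_inj_on_ball:
  assumes P: "developing \<H> P" and z: "z \<in> \<H>"
  shows "inj_on P (ball z (plaque_size * Im z))"
proof
  let ?B = "ball z (plaque_size * Im z)"
  obtain \<beta> h u where "coord P z \<beta> h u" using P z unfolding developing_def by blast
  then obtain \<alpha> k t where c: "coord P z \<alpha> k t" "\<And>z'. z' \<in> ?B \<Longrightarrow> psl_act k z' \<in> D \<alpha>"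
    using coord_wide by blast
  have B: "coord P y \<alpha> k t" if "y \<in> ?B" for y
  proof (rule coord_propagate[OF P c(1) _ _ _ c(2) that])
    show "z \<in> ?B" using z plaque_size_bounds by (simp add: upper_half_plane_def)
    show "?B \<subseteq> \<H>" using plaque_size_ball[OF z] by blast
  qed (simp_all add: convex_connected)
  fix x y assume xy: "x \<in> ?B" "y \<in> ?B" "P x = P y"
  then have "psl_act k x = psl_act k y" using coord_at(2)[OF B] by (metis prod.inject)
  then show "x = y" using psl_act_inv(2) plaque_size_ball[OF z] xy by metis
qed

text \<open>A developing map \<open>P\<close> of the leaf is not injective, so \<open>P \<circ> g = P\<close> for some \<open>g \<noteq> 1\<close>. The cases of an
elliptic or parabolic \<open>g\<close> are contradictory. A hyperbolic \<open>g\<close> is conjugate to an element of the geodesic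
subgroup, which then fixes the image of the base vector under a translate of \<open>P\<close>.\<close>

theorem ex_closed_geodesic:
  assumes F: "F \<in> leaves L" "\<not> simply_connected_space (subtopology \<L> F)"
  obtains w r where "w \<in> UB" "0 < r" "act w (geodesic_subgroup r) = w"
proof -
  obtain x where x: "x \<in> F" "x \<in> topspace M"
    using F(1) nonempty_connected_components_of connected_components_of_subset topspace_leaf_topology
    unfolding leaves_def by blast
  obtain P where P: "developing \<H> P" "P \<i> = x" using ex_developing_through[OF x(2)] .
  have "\<not> inj_on P \<H>" using simply_connected_if_inj[OF F(1) P(1)] F(2) x(1) P(2) by blast
  then obtain z z' where z: "z \<in> \<H>" "z' \<in> \<H>" "P z = P z'" "z \<noteq> z'" by (auto simp: inj_on_def)
  obtain g where g: "psl_act g z' = z" "\<And>y. y \<in> \<H> \<Longrightarrow> P y = P (psl_act g y)"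
    using developing_deck[OF P(1) P(1) z(1-3)] by blast
  have "g \<noteq> 1" using g(1) z(4) by auto
  have conj: "P (psl_act k (psl_act (psl_inv k * g * k) y)) = P (psl_act k y)" if y: "y \<in> \<H>" for k y
  proof -
    have "psl_act k (psl_act (psl_inv k * g * k) y) = psl_act (k * (psl_inv k * g * k)) y"
      using y by (simp only: psl_act_mult)
    also have "k * (psl_inv k * g * k) = g * k" by (simp add: mult.assoc)
    finally show ?thesis using g(2)[OF psl_act_upper[OF y, of k]] y by (simp add: psl_act_mult)
  qed
  from \<open>g \<noteq> 1\<close> show ?thesis
  proof (cases rule: psl2_trichotomy)
    case (elliptic y)
    obtain \<alpha> k t where c: "coord P y \<alpha> k t" using P(1) elliptic(1) unfolding developing_def by blast
    have "coord (\<lambda>z. P (psl_act g z)) y \<alpha> (k * g) t"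
      using c elliptic by (intro coord_compose) simp_all
    then have "coord P y \<alpha> (k * g) t"
      by (rule coord_cong) (use eventually_upper[OF elliptic(1)] g(2) in \<open>auto elim: eventually_mono\<close>)
    then have "k * g = k" using coord_unique(1)[OF _ c] by blast
    then have "g = 1" by (metis psl_inv(2) psl_inv_cancel(2))
    with \<open>g \<noteq> 1\<close> show ?thesis by contradiction
  next
    case (parabolic k a)
    let ?Q = "\<lambda>y. P (psl_act k y)"
    have Q: "developing \<H> ?Q" by (rule developing_compose(1)[OF P(1)])
    \<comment> \<open>So high up in the half plane, a translation by \<open>a\<close> is shorter than the
      injectivity radius.\<close>
    define y where "y = (\<bar>a\<bar> + 1) / plaque_size"
    have y: "y > 0" "plaque_size * y = \<bar>a\<bar> + 1" using plaque_size_bounds(1) by (auto simp: y_def)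
    have iy: "\<i> * of_real y \<in> \<H>" using y by (simp add: upper_half_plane_def)
    have "?Q (\<i> * of_real y + of_real a) = ?Q (\<i> * of_real y)"
      using conj[OF iy, of k] by (simp add: parabolic(2) psl_act_horocycle)
    moreover have "\<i> * of_real y \<in> ball (\<i> * of_real y) (plaque_size * Im (\<i> * of_real y))"
      "\<i> * of_real y + of_real a \<in> ball (\<i> * of_real y) (plaque_size * Im (\<i> * of_real y))"
      using y by (simp_all add: dist_norm)
    ultimately have "\<i> * of_real y + of_real a = \<i> * of_real y"
      using inj_onD[OF developing_inj_on_ball[OF Q iy]] by blast
    with parabolic(1) show ?thesis by simp
  next
    case (hyperbolic k r)
    let ?Q = "\<lambda>y. P (psl_act k y)"
    have Q: "developing \<H> ?Q" by (rule developing_compose(1)[OF P(1)])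
    define w where "w = tangent_lift ?Q (psl_frame 1)"
    have w: "w \<in> UB" unfolding w_def by (rule tangent_lift_in[OF Q psl_frame_in])
    have "act w (geodesic_subgroup r) = tangent_lift ?Q (psl_frame (geodesic_subgroup r * 1))"
      unfolding w_def act_tangent_lift[OF Q] by simp
    also have "\<dots> = tangent_lift (\<lambda>y. ?Q (psl_act (geodesic_subgroup r) y)) (psl_frame 1)"
      by (simp only: developing_compose(2)[OF Q psl_frame_in] psl_frame_mult)
    also have "\<dots> = w"
      unfolding w_def
    proof (rule tangent_lift_cong)
      have "fst (psl_frame 1) \<in> \<H>" by (simp add: fst_psl_frame)
      from eventually_upper[OF this]
      show "\<forall>\<^sub>F z in nhds (fst (psl_frame 1)). ?Q (psl_act (geodesic_subgroup r) z) = ?Q z"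
        by eventually_elim (use conj[of _ k] in \<open>simp add: hyperbolic(2)\<close>)
    qed
    finally have per: "act w (geodesic_subgroup r) = w" .
    have "act w (geodesic_subgroup (- r)) = act (act w (geodesic_subgroup r)) (geodesic_subgroup (- r))"
      by (simp add: per)
    also have "\<dots> = w" by (simp add: act_mult w act_one flip: geodesic_subgroup_add)
    finally have "act w (geodesic_subgroup (- r)) = w" .
    with per w hyperbolic(1) that[of w r] that[of w "- r"] show ?thesis by linarith
  qed
qed

end

section \<open>Horocycle orbits in \<open>PSL(2,\<real>)\<close>-spaces\<close>

lemma continuous_on_psl_frame_psl_of:
  fixes a b c d :: "'b::topological_space \<Rightarrow> real"
  assumes "continuous_on S a" "continuous_on S b" "continuous_on S c" "continuous_on S d"
    and det: "\<And>x. x \<in> S \<Longrightarrow> a x * d x - b x * c x = 1"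
  shows "continuous_on S (\<lambda>x. psl_frame (psl_of (a x) (b x) (c x) (d x)))"
proof -
  have nz: "of_real (c x) * \<i> + of_real (d x) \<noteq> 0" if "x \<in> S" for x
    using psl_denominator_nonzero[OF det[OF that], of \<i>] by simp
  have "continuous_on S (\<lambda>x. ((a x * \<i> + b x) / (c x * \<i> + d x), \<i> / (c x * \<i> + d x)\<^sup>2))"
    by (intro continuous_intros assms) (auto simp: nz)
  then show ?thesis
    by (rule continuous_on_eq) (simp add: psl_frame_psl_of det)
qed

lemma continuous_on_psl_frame_geodesic:
  assumes "continuous_on S f"
  shows "continuous_on S (\<lambda>x. psl_frame (geodesic_subgroup (f x)))"
  unfolding geodesic_subgroup_def
  by (rule continuous_on_psl_frame_psl_of) (auto intro!: continuous_intros assms simp flip: exp_add)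

text \<open>The infimum of the positive elements is a generator, and it is positive unless the subgroup is dense.\<close>

lemma closed_real_subgroup:
  fixes K :: "real set"
  assumes cl: "closed K" and add: "\<And>x y. x \<in> K \<Longrightarrow> y \<in> K \<Longrightarrow> x + y \<in> K"
    and neg: "\<And>x. x \<in> K \<Longrightarrow> - x \<in> K" and l: "l \<in> K" "l > 0" and ne: "K \<noteq> UNIV"
  obtains s where "s > 0" "\<And>x. x \<in> K \<Longrightarrow> \<exists>n::int. x = of_int n * s"
proof -
  have zero: "0 \<in> K" using add[OF l(1) neg[OF l(1)]] by simp
  have nat: "of_nat n * x \<in> K" if "x \<in> K" for n :: nat and x
    using that by (induction n) (auto simp: zero algebra_simps intro: add)
  have int: "of_int n * x \<in> K" if "x \<in> K" for n :: int and x
    using nat[OF that, of "nat n"] neg[OF nat[OF that, of "nat (- n)"]] by (cases "n \<ge> 0") simp_all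
  define Q where "Q = {x \<in> K. x > 0}"
  define s where "s = Inf Q"
  have Q: "Q \<noteq> {}" "bdd_below Q" using l by (auto simp: Q_def intro: bdd_belowI[of _ 0])
  have "s \<ge> 0" unfolding s_def using Q by (intro cInf_greatest) (auto simp: Q_def)
  have "s \<noteq> 0"
  proof
    assume s0: "s = 0"
    have "x \<in> K" for x
    proof -
      have "\<exists>y\<in>K. dist y x < e" if "e > 0" for e
      proof -
        have "Inf Q < e" using s0 that by (simp add: s_def)
        then obtain r where r: "r \<in> Q" "r < e" using cInf_lessD[OF Q(1)] by blast
        then have r': "r \<in> K" "r > 0" by (auto simp: Q_def)
        let ?n = "\<lfloor>x / r\<rfloor>"
        have "of_int ?n * r \<le> x" "x < of_int ?n * r + r"
          using floor_divide_lower[OF r'(2), of x] floor_divide_upper[OF r'(2), of x] by (simp_all add: algebra_simps)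
        then have "dist (of_int ?n * r) x < e" using r(2) by (simp add: dist_real_def)
        with int[OF r'(1)] show ?thesis by blast
      qed
      then show ?thesis using cl by (meson closed_approachable)
    qed
    with ne show False by blast
  qed
  with \<open>s \<ge> 0\<close> have s: "s > 0" by simp
  have "s \<in> closure Q" unfolding s_def by (rule closure_contains_Inf[OF Q])
  also have "closure Q \<subseteq> K" using cl by (intro closure_minimal) (auto simp: Q_def)
  finally have sK: "s \<in> K" .
  have "\<exists>n::int. x = of_int n * s" if x: "x \<in> K" for x
  proof -
    let ?n = "\<lfloor>x / s\<rfloor>"
    define y where "y = x - of_int ?n * s"
    have y: "0 \<le> y" "y < s"
      using floor_divide_lower[OF s, of x] floor_divide_upper[OF s, of x] by (simp_all add: y_def algebra_simps)
    have "y \<in> K" using add[OF x neg[OF int[OF sK, of ?n]]] by (simp add: y_def)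
    then have "\<not> y > 0" using y(2) cInf_lower[OF _ Q(2), of y] by (auto simp: Q_def s_def)
    with y(1) have "x = of_int ?n * s" by (simp add: y_def)
    then show ?thesis by blast
  qed
  with s show ?thesis by (rule that)
qed

text \<open>The first column of a matrix determines it up to right multiplication by the horocycle subgroup, and
the geodesic subgroup rescales this column.\<close>

lemma psl_of_scaled_column:
  assumes "a * d - b * c = 1" "(n * a) * d' - b' * (n * c) = 1" "n > 0"
  shows "psl_of (n * a) b' (n * c) d' =
    psl_of a b c d * (horocycle_subgroup (n * (d * b' - b * d')) * geodesic_subgroup (ln n))"
proof -
  let ?x = "d * b' - b * d'"
  have c: "n * y * inverse n = y" for y using assms(3) by simp
  have "horocycle_subgroup (n * ?x) * geodesic_subgroup (ln n) = psl_of n ?x 0 (inverse n)"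
    unfolding horocycle_subgroup_def geodesic_subgroup_def using assms(3)
    by (subst psl_of_mult) (simp_all add: exp_minus c)
  moreover have "psl_of a b c d * psl_of n ?x 0 (inverse n) = psl_of (n * a) b' (n * c) d'"
  proof -
    have inv: "inverse n = a * d' - b' * c"
      using assms(2,3) by (simp add: field_simps)
    have "a * ?x + b * inverse n = (a * d - b * c) * b'" "c * ?x + d * inverse n = (a * d - b * c) * d'"
      unfolding inv by (simp_all add: algebra_simps)
    then show ?thesis
      using assms(1,3) by (subst psl_of_mult) (simp_all add: mult.commute)
  qed
  ultimately show ?thesis by simp
qed

locale psl2_space =
  fixes X :: "'x topology" and act :: "'x \<Rightarrow> psl2 \<Rightarrow> 'x"
  assumes act_closed: "x \<in> topspace X \<Longrightarrow> act x g \<in> topspace X"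
    and act_1: "x \<in> topspace X \<Longrightarrow> act x 1 = x"
    and act_act: "x \<in> topspace X \<Longrightarrow> act (act x g) h = act x (g * h)"
    and continuous_action: "continuous_map (prod_topology X psl_topology) X (\<lambda>(x, p). act x (psl_of_frame p))"
begin

lemma continuous_act_comp:
  assumes "continuous_map Z X f" "continuous_map Z psl_topology (\<lambda>z. psl_frame (\<gamma> z))"
  shows "continuous_map Z X (\<lambda>z. act (f z) (\<gamma> z))"
  using continuous_map_compose[OF continuous_map_pairedI[OF assms] continuous_action] by (simp add: o_def)

lemma continuous_act_const: "continuous_map X X (\<lambda>x. act x g)"
  by (rule continuous_act_comp) (auto simp: continuous_map_const)

lemma continuous_map_psl_frame:
  "continuous_on S (\<lambda>z. psl_frame (\<gamma> z)) \<Longrightarrow> continuous_map (top_of_set S) psl_topology (\<lambda>z. psl_frame (\<gamma> z))"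
  by (auto simp: continuous_map_in_subtopology)

definition horocycle_invariant :: "'x set \<Rightarrow> bool" where
  "horocycle_invariant Z \<longleftrightarrow> closedin X Z \<and> (\<forall>x\<in>Z. \<forall>t. act x (horocycle_subgroup t) \<in> Z)"

lemma horocycle_invariant_vimage:
  assumes "horocycle_invariant Z"
  shows "horocycle_invariant {x \<in> topspace X. act x (geodesic_subgroup r) \<in> Z}"
  unfolding horocycle_invariant_def
proof (intro conjI ballI allI)
  show "closedin X {x \<in> topspace X. act x (geodesic_subgroup r) \<in> Z}"
    using assms by (intro closedin_continuous_map_preimage[OF continuous_act_const])
      (simp add: horocycle_invariant_def)
  fix x t assume x: "x \<in> {x \<in> topspace X. act x (geodesic_subgroup r) \<in> Z}"
  then have "act (act x (horocycle_subgroup t)) (geodesic_subgroup r)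
      = act (act x (geodesic_subgroup r)) (horocycle_subgroup (t * exp (- 2 * r)))"
    by (simp add: act_act horocycle_geodesic_commute)
  also have "\<dots> \<in> Z" using x assms unfolding horocycle_invariant_def by blast
  finally show "act x (horocycle_subgroup t) \<in> {x \<in> topspace X. act x (geodesic_subgroup r) \<in> Z}"
    using x by (simp add: act_closed)
qed

lemma horocycle_invariant_Int:
  "horocycle_invariant Z \<Longrightarrow> horocycle_invariant Z' \<Longrightarrow> horocycle_invariant (Z \<inter> Z')"
  by (auto simp: horocycle_invariant_def)

lemma horocycle_invariant_closure:
  assumes "w \<in> topspace X"
  shows "horocycle_invariant (X closure_of (range (\<lambda>t. act w (horocycle_subgroup t))))"
  unfolding horocycle_invariant_def
proof (intro conjI ballI allI)
  let ?O = "range (\<lambda>t. act w (horocycle_subgroup t))"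
  fix x t assume "x \<in> X closure_of ?O"
  then have "act x (horocycle_subgroup t) \<in> X closure_of ((\<lambda>x. act x (horocycle_subgroup t)) ` ?O)"
    using continuous_map_image_closure_subset[OF continuous_act_const, of "horocycle_subgroup t" ?O] by blast
  also have "(\<lambda>x. act x (horocycle_subgroup t)) ` ?O \<subseteq> ?O"
    using assms by (auto simp: act_act simp flip: horocycle_subgroup_add)
  then have "X closure_of ((\<lambda>x. act x (horocycle_subgroup t)) ` ?O) \<subseteq> X closure_of ?O"
    by (rule closure_of_mono)
  finally show "act x (horocycle_subgroup t) \<in> X closure_of ?O" .
qed simp

lemma horocycle_invariant_minimal:
  assumes "horocycle_invariant Z" "w \<in> Z"
  shows "X closure_of (range (\<lambda>t. act w (horocycle_subgroup t))) \<subseteq> Z"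
  using assms by (intro closure_of_minimal) (auto simp: horocycle_invariant_def)

text \<open>The set of all \<open>x\<close> in question is closed, as the projection along a compact interval is a closed map.
It contains an orbit of the affine group: for \<open>z \<in> Z\<close>, a point \<open>z h a\<^sub>r\<close> lies in \<open>Z a\<^sub>r\<close>, and \<open>r\<close> can be
reduced modulo \<open>l\<close>.\<close>

lemma geodesic_translates_cover:
  assumes minimal: "\<And>x. x \<in> topspace X \<Longrightarrow> X closure_of (act x ` affine_group) = topspace X"
    and Z: "horocycle_invariant Z" "Z \<noteq> {}" and l: "l > 0"
    and per: "\<And>x. x \<in> Z \<Longrightarrow> act x (geodesic_subgroup l) \<in> Z" "\<And>x. x \<in> Z \<Longrightarrow> act x (geodesic_subgroup (- l)) \<in> Z"
    and x: "x \<in> topspace X"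
  shows "\<exists>r\<in>{0..l}. act x (geodesic_subgroup (- r)) \<in> Z"
proof -
  have ZX: "Z \<subseteq> topspace X" using Z(1) closedin_subset by (auto simp: horocycle_invariant_def)
  obtain z where z: "z \<in> Z" using Z(2) by blast
  let ?I = "top_of_set {0..l}"
  let ?f = "\<lambda>q. act (fst q) (geodesic_subgroup (- snd q))"
  define C where "C = {q \<in> topspace (prod_topology X ?I). ?f q \<in> Z}"
  have "continuous_map ?I psl_topology (\<lambda>r. psl_frame (geodesic_subgroup (- r)))"
    by (intro continuous_map_psl_frame continuous_on_psl_frame_geodesic continuous_intros)
  from continuous_map_compose[OF continuous_map_snd this]
  have "continuous_map (prod_topology X ?I) psl_topology (\<lambda>q. psl_frame (geodesic_subgroup (- snd q)))"
    by (simp add: o_def)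
  then have "continuous_map (prod_topology X ?I) X ?f"
    by (intro continuous_act_comp continuous_map_fst)
  then have "closedin (prod_topology X ?I) C"
    unfolding C_def using Z(1) by (intro closedin_continuous_map_preimage) (auto simp: horocycle_invariant_def)
  moreover have "closed_map (prod_topology X ?I) X fst"
    by (rule Abstract_Topological_Spaces.closed_map_fst) (simp add: compact_space_subtopology)
  ultimately have cl: "closedin X (fst ` C)" unfolding closed_map_def by blast
  have geo: "act y (geodesic_subgroup (of_int n * l)) \<in> Z" if y: "y \<in> Z" for y n
  proof -
    have pos: "act y (geodesic_subgroup (of_nat n * l)) \<in> Z \<and> act y (geodesic_subgroup (- (of_nat n * l))) \<in> Z" for n
    proof (induction n)
      case 0
      show ?case using y ZX by (auto simp: act_1)
    next
      case (Suc n)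
      have "geodesic_subgroup (of_nat (Suc n) * l) = geodesic_subgroup (of_nat n * l) * geodesic_subgroup l"
        by (simp add: algebra_simps flip: geodesic_subgroup_add)
      moreover have "geodesic_subgroup (- (of_nat (Suc n) * l)) = geodesic_subgroup (- (of_nat n * l)) * geodesic_subgroup (- l)"
        by (simp add: algebra_simps flip: geodesic_subgroup_add)
      moreover have "y \<in> topspace X" using y ZX by blast
      ultimately show ?case using per Suc by (simp flip: act_act)
    qed
    show ?thesis using pos[of "nat n"] pos[of "nat (- n)"] by (cases "n \<ge> 0") simp_all
  qed
  have "act z ` affine_group \<subseteq> fst ` C"
  proof
    fix y assume "y \<in> act z ` affine_group"
    then obtain t \<rho> where y: "y = act z (horocycle_subgroup t * geodesic_subgroup \<rho>)"
      unfolding affine_group_eq by blast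
    let ?n = "\<lfloor>\<rho> / l\<rfloor>"
    define r where "r = \<rho> - of_int ?n * l"
    have r: "r \<in> {0..l}"
      using floor_divide_lower[OF l, of \<rho>] floor_divide_upper[OF l, of \<rho>] by (simp add: r_def algebra_simps)
    have zX: "z \<in> topspace X" using z ZX by blast
    have "act y (geodesic_subgroup (- r)) = act z (horocycle_subgroup t * geodesic_subgroup (\<rho> + - r))"
      unfolding geodesic_subgroup_add[of \<rho> "- r"] by (simp add: y act_act zX mult.assoc)
    also have "\<rho> + - r = of_int ?n * l" by (simp add: r_def)
    also have "act z (horocycle_subgroup t * geodesic_subgroup (of_int ?n * l))
        = act (act z (horocycle_subgroup t)) (geodesic_subgroup (of_int ?n * l))" by (simp add: act_act zX)
    also have "\<dots> \<in> Z" using geo Z(1) z unfolding horocycle_invariant_def by blast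
    finally have "(y, r) \<in> C" using r zX by (simp add: C_def y act_closed)
    then show "y \<in> fst ` C" by force
  qed
  then have "X closure_of (act z ` affine_group) \<subseteq> fst ` C" using cl by (rule closure_of_minimal)
  then have "x \<in> fst ` C" using minimal[of z] z ZX x by blast
  then show ?thesis by (force simp: C_def)
qed

text \<open>Suppose that the closure \<open>Y\<close> of the horocycle orbit of \<open>w\<close> is not everything. Then its translates
under the geodesic flow are the fibers of a map to a circle \<open>\<real>/s\<int>\<close>. The path \<open>c \<tau> = w (g \<tau>)\<close> leads
from \<open>w\<close> to the vector opposite to \<open>w\<close>; the first column of \<open>g \<tau>\<close> is \<open>(1 - \<tau>, \<tau>)\<close>, and multiplication
by \<open>a\<^sub>l\<close> from the left changes the direction of this column from that of \<open>\<tau>\<close> to that of \<open>\<sigma> \<tau>\<close> and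
rescales it by \<open>n \<tau>\<close>. As \<open>w a\<^sub>l = w\<close>, the circle coordinates of \<open>c \<tau>\<close> and \<open>c (\<sigma> \<tau>)\<close> differ by
\<open>ln (n \<tau>)\<close>, which goes from \<open>l\<close> to \<open>-l\<close> while \<open>\<sigma>\<close> fixes both ends of the path.\<close>

theorem horocycle_orbit_dense:
  assumes minimal: "\<And>x. x \<in> topspace X \<Longrightarrow> X closure_of (act x ` affine_group) = topspace X"
    and w: "w \<in> topspace X" and l: "l > 0" and per: "act w (geodesic_subgroup l) = w"
  shows "X closure_of (range (\<lambda>t. act w (horocycle_subgroup t))) = topspace X"
proof -
  define Y where "Y = X closure_of (range (\<lambda>t. act w (horocycle_subgroup t)))"
  let ?a = geodesic_subgroup and ?h = horocycle_subgroup
  have Y: "horocycle_invariant Y" unfolding Y_def by (rule horocycle_invariant_closure[OF w])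
  have Yh: "act y (?h t) \<in> Y" if "y \<in> Y" for y t using Y that by (auto simp: horocycle_invariant_def)
  have YX: "Y \<subseteq> topspace X" by (simp add: Y_def closure_of_subset_topspace)
  have orbit: "range (\<lambda>t. act w (?h t)) \<subseteq> topspace X" using w act_closed by blast
  have wY: "w \<in> Y"
  proof -
    have "act w (?h 0) \<in> Y" unfolding Y_def using closure_of_subset[OF orbit] by blast
    then show ?thesis by (simp add: act_1 w)
  qed
  \<comment> \<open>As \<open>Y\<close> is the smallest closed horocycle invariant set containing
    \<open>w\<close>, these are the \<open>r\<close> for which the translate of \<open>Y\<close> by
    \<open>r\<close> is contained in \<open>Y\<close>.\<close>
  define K where "K = {r. act w (?a r) \<in> Y}"
  have K: "act y (?a r) \<in> Y" if "r \<in> K" "y \<in> Y" for r y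
  proof -
    have "Y \<subseteq> {x \<in> topspace X. act x (?a r) \<in> Y}"
      unfolding Y_def[symmetric] using w that(1)
      by (subst Y_def, intro horocycle_invariant_minimal horocycle_invariant_vimage Y) (simp add: K_def)
    then show ?thesis using that(2) by blast
  qed
  have aa: "act (act x (?a r)) (?a s) = act x (?a (r + s))" if "x \<in> topspace X" for x r s
    using that by (simp add: act_act geodesic_subgroup_add)
  have Kadd: "r + s \<in> K" if "r \<in> K" "s \<in> K" for r s
    using K[OF that(2), of "act w (?a r)"] that(1) by (simp add: K_def aa w)
  have Kl: "l \<in> K" by (simp add: K_def per wY)
  have per': "act w (?a (- l)) = w"
    using aa[OF w, of l "- l"] by (simp add: per act_1 w)
  then have Kml: "- l \<in> K" by (simp add: K_def wY)
  have Kclosed: "closed K"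
  proof -
    have "continuous_map (top_of_set UNIV) X (\<lambda>r. act w (?a r))"
      by (intro continuous_act_comp continuous_map_psl_frame continuous_on_psl_frame_geodesic continuous_intros)
         (simp add: w)
    from closedin_continuous_map_preimage[OF this, of Y] Y
    show ?thesis by (simp add: K_def horocycle_invariant_def)
  qed
  have Knat: "of_nat n * r \<in> K" if "r \<in> K" for n :: nat and r
  proof (induction n)
    case 0
    show ?case by (simp add: K_def act_1 w wY)
  next
    case (Suc n)
    then show ?case using Kadd[OF that Suc] by (simp add: algebra_simps)
  qed
  \<comment> \<open>A closed subsemigroup of \<open>\<real>\<close> that contains \<open>l\<close> and
    \<open>-l\<close> is a group: some multiple \<open>k r\<close> with \<open>k > 0\<close> is close to a
    multiple of \<open>l\<close>, so \<open>(k - 1) r\<close> is close to \<open>-r\<close> modulo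
    \<open>l\<close>.\<close>
  have Kneg: "- r \<in> K" if r: "r \<in> K" for r
  proof -
    have "\<exists>q\<in>K. dist q (- r) < e" if e: "e > 0" for e
    proof -
      obtain N :: nat where N: "l / e < real N" using reals_Archimedean2 by blast
      then have Npos: "N > 0" using l e by (cases N) (auto simp: divide_less_0_iff)
      obtain h k where hk: "0 < k" "\<bar>of_int k * (r / l) - of_int h\<bar> < 1 / N"
        using Dirichlet_approx[OF Npos, of "r / l"] by metis
      define q where "q = of_int (k - 1) * r - of_int h * l"
      have "of_int (k - 1) * r \<in> K"
        using Knat[OF r, of "nat (k - 1)"] hk(1) by simp
      moreover have "- (of_int h * l) \<in> K"
      proof (cases "h \<ge> 0")
        case True
        then show ?thesis using Knat[OF Kml, of "nat h"] by simp
      next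
        case False
        then show ?thesis using Knat[OF Kl, of "nat (- h)"] by simp
      qed
      ultimately have "q \<in> K" unfolding q_def using Kadd by fastforce
      moreover have "dist q (- r) = l * \<bar>of_int k * (r / l) - of_int h\<bar>"
      proof -
        have "q + r = l * (of_int k * (r / l) - of_int h)" using l by (simp add: q_def algebra_simps)
        then show ?thesis using l by (simp add: dist_real_def abs_mult)
      qed
      moreover have "l * \<bar>of_int k * (r / l) - of_int h\<bar> < l * (1 / N)" using hk l by (intro mult_strict_left_mono) auto
      moreover have "l * (1 / N) < e" using N Npos e by (simp add: field_simps)
      ultimately show ?thesis by (intro bexI[of _ q]) linarith+
    qed
    then show ?thesis using Kclosed by (meson closed_approachable)
  qed
  have cover: "\<exists>r\<in>{0..l}. act x (?a (- r)) \<in> Y" if "x \<in> topspace X" for x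
    by (rule geodesic_translates_cover[OF minimal Y _ l _ _ that]) (use K Kl Kml wY in auto)
  \<comment> \<open>If \<open>Y\<close> and a translate of \<open>Y\<close> meet, their intersection
    \<open>Y'\<close> is as good as \<open>Y\<close>. So \<open>w a\<close> lies in \<open>Y'\<close> for some
    element \<open>a\<close> of the geodesic subgroup, say with parameter \<open>-q\<close>, and then both
    \<open>-q\<close> and \<open>-q + (r - s)\<close> belong to \<open>K\<close>.\<close>
  have unique: "r - s \<in> K" if x: "x \<in> topspace X" and r: "act x (?a (- r)) \<in> Y" and s: "act x (?a (- s)) \<in> Y" for x r s
  proof -
    define Y' where "Y' = Y \<inter> {x \<in> topspace X. act x (?a (r - s)) \<in> Y}"
    have Y': "horocycle_invariant Y'"
      unfolding Y'_def by (intro horocycle_invariant_Int horocycle_invariant_vimage Y)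
    have "act x (?a (- r)) \<in> Y'" using r s x by (simp add: Y'_def aa act_closed)
    moreover have inv: "act y (?a q) \<in> Y'" if "y \<in> Y'" "q \<in> K" for y q
    proof -
      have y: "y \<in> Y" "y \<in> topspace X" "act y (?a (r - s)) \<in> Y" using that(1) by (auto simp: Y'_def)
      have "act (act y (?a q)) (?a (r - s)) = act (act y (?a (r - s))) (?a q)"
        by (simp add: aa y add.commute)
      then show ?thesis using K[OF that(2)] y by (simp add: Y'_def act_closed)
    qed
    ultimately obtain q where "act w (?a (- q)) \<in> Y'"
      using geodesic_translates_cover[OF minimal Y' _ l inv[OF _ Kl] inv[OF _ Kml] w] by blast
    then have "- q \<in> K" "- q + (r - s) \<in> K" by (auto simp: Y'_def K_def aa w)
    then have "- (- q) + (- q + (r - s)) \<in> K" using Kadd Kneg by blast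
    then show ?thesis by simp
  qed
  show ?thesis
  proof (cases "K = UNIV")
    case True
    have "x \<in> Y" if x: "x \<in> topspace X" for x
    proof -
      obtain r where r: "act x (?a (- r)) \<in> Y" using cover[OF x] by blast
      have "act (act x (?a (- r))) (?a r) \<in> Y" using K[OF _ r] True by blast
      then show ?thesis using x by (simp add: aa act_1)
    qed
    with YX show ?thesis unfolding Y_def by blast
  next
    case False
    obtain s where s: "s > 0" "\<And>x. x \<in> K \<Longrightarrow> \<exists>n::int. x = of_int n * s"
      using closed_real_subgroup[OF Kclosed Kadd Kneg Kl l False] by blast
    define N where "N \<tau> = (1 - \<tau>)\<^sup>2 + \<tau>\<^sup>2" for \<tau> :: real
    have Npos: "N \<tau> > 0" for \<tau> unfolding N_def by (cases "\<tau> = 0") (auto simp: add_nonneg_pos)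
    \<comment> \<open>The second column is orthogonal to the first, scaled to make the determinant 1.\<close>
    define g where "g \<tau> = psl_of (1 - \<tau>) (- \<tau> / N \<tau>) \<tau> ((1 - \<tau>) / N \<tau>)" for \<tau>
    have gdet: "(1 - \<tau>) * ((1 - \<tau>) / N \<tau>) - (- \<tau> / N \<tau>) * \<tau> = 1" for \<tau>
    proof -
      have "(1 - \<tau>) * ((1 - \<tau>) / N \<tau>) - (- \<tau> / N \<tau>) * \<tau> = ((1 - \<tau>)\<^sup>2 + \<tau>\<^sup>2) / N \<tau>"
        by (simp add: power2_eq_square add_divide_distrib)
      also have "\<dots> = 1" unfolding N_def[symmetric] using Npos[of \<tau>] by simp
      finally show ?thesis .
    qed
    have gcont: "continuous_on S (\<lambda>\<tau>. psl_frame (g \<tau>))" for S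
      unfolding g_def
      by (rule continuous_on_psl_frame_psl_of)
         (use gdet Npos in \<open>auto simp: N_def less_le intro!: continuous_intros\<close>)
    define c where "c \<tau> = act w (g \<tau>)" for \<tau>
    have cX: "c \<tau> \<in> topspace X" for \<tau> by (simp add: c_def act_closed w)
    define n where "n \<tau> = exp l * (1 - \<tau>) + exp (- l) * \<tau>" for \<tau> :: real
    define \<sigma> where "\<sigma> \<tau> = exp (- l) * \<tau> / n \<tau>" for \<tau> :: real
    have npos: "n \<tau> > 0" if "\<tau> \<in> {0..1}" for \<tau>
      unfolding n_def using that by (cases "\<tau> = 0") (auto intro!: add_nonneg_pos)
    have \<sigma>: "n \<tau> * \<sigma> \<tau> = exp (- l) * \<tau>" "n \<tau> * (1 - \<sigma> \<tau>) = exp l * (1 - \<tau>)" if "\<tau> \<in> {0..1}" for \<tau>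
    proof -
      show 1: "n \<tau> * \<sigma> \<tau> = exp (- l) * \<tau>" using npos[OF that] by (simp add: \<sigma>_def)
      show "n \<tau> * (1 - \<sigma> \<tau>) = exp l * (1 - \<tau>)"
        unfolding right_diff_distrib 1 by (simp add: n_def algebra_simps)
    qed
    have \<sigma>01: "\<sigma> \<tau> \<in> {0..1}" if "\<tau> \<in> {0..1}" for \<tau>
    proof -
      have "exp (- l) * \<tau> \<le> n \<tau>" using that by (simp add: n_def)
      then show ?thesis using that npos[OF that] by (simp add: \<sigma>_def)
    qed
    have ag: "\<exists>t. ?a l * g \<tau> = g (\<sigma> \<tau>) * (?h t * ?a (ln (n \<tau>)))" if \<tau>: "\<tau> \<in> {0..1}" for \<tau>
    proof -
      let ?b = "exp l * (- \<tau> / N \<tau>)" and ?d = "exp (- l) * ((1 - \<tau>) / N \<tau>)"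
      have ag: "?a l * g \<tau> = psl_of (n \<tau> * (1 - \<sigma> \<tau>)) ?b (n \<tau> * \<sigma> \<tau>) ?d"
        unfolding geodesic_subgroup_def g_def \<sigma>[OF \<tau>]
        using gdet[of \<tau>] by (subst psl_of_mult) (simp_all flip: exp_add)
      have "exp l * (1 - \<tau>) * ?d - ?b * (exp (- l) * \<tau>)
          = (exp l * exp (- l)) * ((1 - \<tau>) * ((1 - \<tau>) / N \<tau>) - (- \<tau> / N \<tau>) * \<tau>)"
        by (simp only: algebra_simps)
      also have "\<dots> = 1" unfolding gdet by (simp flip: exp_add)
      finally have "(n \<tau> * (1 - \<sigma> \<tau>)) * ?d - ?b * (n \<tau> * \<sigma> \<tau>) = 1" unfolding \<sigma>[OF \<tau>] .
      from psl_of_scaled_column[OF gdet[of "\<sigma> \<tau>"] this npos[OF \<tau>]]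
      show ?thesis unfolding ag by (metis g_def)
    qed
    have shift: "act (c (\<sigma> \<tau>)) (?a (- (r - ln (n \<tau>)))) \<in> Y" if \<tau>: "\<tau> \<in> {0..1}" and r: "act (c \<tau>) (?a (- r)) \<in> Y" for \<tau> r
    proof -
      obtain t where t: "?a l * g \<tau> = g (\<sigma> \<tau>) * (?h t * ?a (ln (n \<tau>)))" using ag[OF \<tau>] by blast
      let ?q = "ln (n \<tau>) - r"
      have "c \<tau> = act (act w (?a l)) (g \<tau>)" by (simp add: c_def per)
      also have "\<dots> = act (c (\<sigma> \<tau>)) (?h t * ?a (ln (n \<tau>)))" by (simp add: c_def act_act w t)
      finally have "act (c \<tau>) (?a (- r)) = act (c (\<sigma> \<tau>)) (?h t * (?a (ln (n \<tau>)) * ?a (- r)))"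
        by (simp add: act_act cX mult.assoc)
      also have "\<dots> = act (c (\<sigma> \<tau>)) (?h t * ?a ?q)" by (simp flip: geodesic_subgroup_add)
      also have "\<dots> = act (act (c (\<sigma> \<tau>)) (?a ?q)) (?h (t * exp (- 2 * ?q)))"
        by (simp add: act_act cX horocycle_geodesic_commute)
      finally have "act (act (act (c (\<sigma> \<tau>)) (?a ?q)) (?h (t * exp (- 2 * ?q)))) (?h (- (t * exp (- 2 * ?q)))) \<in> Y"
        using r Yh by simp
      also have "act (act (act (c (\<sigma> \<tau>)) (?a ?q)) (?h (t * exp (- 2 * ?q)))) (?h (- (t * exp (- 2 * ?q))))
          = act (c (\<sigma> \<tau>)) (?a ?q)"
        by (simp add: act_act[OF act_closed] act_closed cX act_1 flip: horocycle_subgroup_add)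
      finally show ?thesis by simp
    qed
    \<comment> \<open>\<open>R \<tau>\<close> represents the circle coordinate of \<open>c \<tau>\<close>. It
      need not be continuous in \<open>\<tau>\<close>, but its class modulo \<open>s\<close> is, since the
      graph of the class is compact.\<close>
    have "\<forall>\<tau>. \<exists>r. r \<in> {0..l} \<and> act (c \<tau>) (?a (- r)) \<in> Y" using cover cX by blast
    then obtain R where R: "\<And>\<tau>. R \<tau> \<in> {0..l}" "\<And>\<tau>. act (c \<tau>) (?a (- R \<tau>)) \<in> Y" by metis
    define e where "e r = cis (2 * pi * r / s)" for r
    have e_cong: "e r = e r'" if rK: "r - r' \<in> K" for r r'
    proof -
      obtain m :: int where "r - r' = of_int m * s" using s(2)[OF rK] by blast
      then have r: "r = r' + of_int m * s" by simp
      have "2 * pi * r / s = 2 * pi * r' / s + 2 * pi * of_int m" using s(1) unfolding r by (simp add: field_simps)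
      then have "e r = e r' * cis (2 * pi * of_int m)" unfolding e_def cis_mult by (rule arg_cong)
      also have "cis (2 * pi * of_int m) = 1" by (rule cis_multiple_2pi) simp
      finally show ?thesis by simp
    qed
    have "continuous_on {0..1} (\<lambda>\<tau>. e (R \<tau>))"
    proof (rule continuous_from_closed_graph[of "sphere 0 1"])
      let ?B = "{0..1} \<times> {0..l}"
      let ?G = "{q \<in> ?B. act (c (fst q)) (?a (- snd q)) \<in> Y}"
      have c': "continuous_map (top_of_set ?B) X (\<lambda>q. c (fst q))"
        unfolding c_def
        by (intro continuous_act_comp continuous_map_psl_frame continuous_on_compose2[OF gcont] continuous_intros)
           (auto simp: w)
      have "continuous_map (top_of_set ?B) X (\<lambda>q. act (c (fst q)) (?a (- snd q)))"
        by (intro continuous_act_comp c' continuous_map_psl_frame continuous_on_psl_frame_geodesic continuous_intros)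
      from closedin_continuous_map_preimage[OF this, of Y]
      have "closedin (top_of_set ?B) ?G" using Y by (simp add: horocycle_invariant_def)
      then have "compact ?G" by (rule closedin_compact[OF compact_Times[OF compact_Icc compact_Icc]])
      then have "compact ((\<lambda>q. (fst q, e (snd q))) ` ?G)"
        by (rule compact_continuous_image[rotated]) (use s(1) in \<open>auto simp: e_def intro!: continuous_intros\<close>)
      moreover have "(\<lambda>q. (fst q, e (snd q))) ` ?G = (\<lambda>\<tau>. (\<tau>, e (R \<tau>))) ` {0..1}"
      proof (intro equalityI subsetI)
        fix p assume "p \<in> (\<lambda>q. (fst q, e (snd q))) ` ?G"
        then obtain \<tau> r where p: "p = (\<tau>, e r)" "\<tau> \<in> {0..1}" "act (c \<tau>) (?a (- r)) \<in> Y" by auto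
        have "e r = e (R \<tau>)" by (rule e_cong[OF unique[OF cX p(3) R(2)]])
        with p show "p \<in> (\<lambda>\<tau>. (\<tau>, e (R \<tau>))) ` {0..1}" by blast
      next
        fix p assume "p \<in> (\<lambda>\<tau>. (\<tau>, e (R \<tau>))) ` {0..1}"
        then obtain \<tau> where "\<tau> \<in> {0..1}" "p = (\<tau>, e (R \<tau>))" by blast
        then show "p \<in> (\<lambda>q. (fst q, e (snd q))) ` ?G" using R by (intro image_eqI[of _ _ "(\<tau>, R \<tau>)"]) auto
      qed
      ultimately show "closed ((\<lambda>\<tau>. (\<tau>, e (R \<tau>))) ` {0..1})" by (simp add: compact_imp_closed)
    qed (auto simp: e_def)
    then obtain f where f: "continuous_on {0..1} f" "\<And>\<tau>. \<tau> \<in> {0..1} \<Longrightarrow> e (R \<tau>) = exp (f \<tau>)"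
      by (rule continuous_logarithm_on_contractible)
         (auto simp: e_def convex_imp_contractible)
    \<comment> \<open>A continuous real lift of the circle coordinate along the path.\<close>
    define F where "F \<tau> = Im (f \<tau>) * s / (2 * pi)" for \<tau>
    have F: "\<exists>m::int. F \<tau> = R \<tau> + of_int m * s" if "\<tau> \<in> {0..1}" for \<tau>
    proof -
      have "exp (f \<tau>) = exp (\<i> * of_real (2 * pi * R \<tau> / s))"
        using f(2)[OF that] by (simp add: e_def cis_conv_exp)
      then obtain m :: int where "f \<tau> = \<i> * of_real (2 * pi * R \<tau> / s) + (of_int (2 * m) * pi) * \<i>"
        unfolding exp_eq by blast
      then have "Im (f \<tau>) = 2 * pi * R \<tau> / s + 2 * of_int m * pi" by simp
      then have "F \<tau> = R \<tau> + of_int m * s" using s(1) by (simp add: F_def field_simps)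
      then show ?thesis by blast
    qed
    define E where "E \<tau> = F \<tau> - F (\<sigma> \<tau>) - ln (n \<tau>)" for \<tau>
    have EZ: "\<exists>m::int. E \<tau> = of_int m * s" if \<tau>: "\<tau> \<in> {0..1}" for \<tau>
    proof -
      obtain i j k :: int where "F \<tau> = R \<tau> + of_int i * s" "F (\<sigma> \<tau>) = R (\<sigma> \<tau>) + of_int j * s"
          "R \<tau> - ln (n \<tau>) - R (\<sigma> \<tau>) = of_int k * s"
        using F[OF \<tau>] F[OF \<sigma>01[OF \<tau>]] s(2)[OF unique[OF cX shift[OF \<tau> R(2)] R(2)]] by blast
      then have "E \<tau> = of_int (i - j + k) * s" by (simp add: E_def algebra_simps)
      then show ?thesis by blast
    qed
    \<comment> \<open>By continuity, \<open>E\<close> is constant on the path. But it takes the values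
      \<open>-l\<close> and \<open>l\<close> at the ends.\<close>
    have Ec: "continuous_on {0..1} E"
    proof -
      have nc: "continuous_on {0..1} n" unfolding n_def by (intro continuous_intros)
      have n0: "\<forall>\<tau>\<in>{0..1}. n \<tau> \<noteq> 0" using npos by (simp add: less_imp_neq[symmetric])
      have "continuous_on {0..1} \<sigma>" unfolding \<sigma>_def by (intro continuous_intros nc n0)
      moreover have "continuous_on {0..1} F" unfolding F_def by (intro continuous_intros f) simp
      moreover have "continuous_on {0..1} (\<lambda>\<tau>. F (\<sigma> \<tau>))"
        using \<sigma>01 by (intro continuous_on_compose2[OF calculation(2,1)]) auto
      ultimately show ?thesis unfolding E_def using n0 by (intro continuous_intros nc) auto
    qed
    have E0: "E 0 = - l" by (simp add: E_def \<sigma>_def n_def)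
    have E1: "E 1 = l" by (simp add: E_def \<sigma>_def n_def)
    obtain m :: int where m: "l = of_int m * s" using EZ[of 1] E1 by auto
    have "of_int m > (0::real)" using l s(1) m by (simp add: zero_less_mult_iff)
    then have "s \<le> l" unfolding m using s(1) by simp
    then obtain \<tau> where \<tau>: "0 \<le> \<tau>" "\<tau> \<le> 1" "E \<tau> = - l + s / 2"
      using IVT'[of E 0 "- l + s / 2" 1] Ec E0 E1 s(1) by auto
    then obtain k :: int where "- l + s / 2 = of_int k * s" using EZ[of \<tau>] by auto
    then have "(of_int (2 * (k + m)) - 1) * s = 0" unfolding m by (simp add: algebra_simps)
    then have "of_int (2 * (k + m)) = (of_int 1 :: real)" using s(1) by simp
    then have "2 * (k + m) = 1" by (simp only: of_int_eq_iff)
    then have False by presburger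
    then show ?thesis ..
  qed
qed

end

section \<open>Transitivity of the laminated horocycle flow\<close>

context hyperbolic_lamination
begin

sublocale unit_bundle: psl2_space X act
  by unfold_locales (simp_all add: act_in act_one act_mult continuous_act)

end

theorem theorem6:
  fixes L :: "('a, 'i, 't) lamination"
  assumes "compact_hyperbolic_lamination L"
    and "minimal_lamination L"
    and "minimal_affine_action L"
    and "\<exists>F\<in>leaves L. \<not> simply_connected_space (subtopology (leaf_topology L) F)"
  shows "topologically_transitive_flow (unit_bundle_topology L) (horocycle_flow L)"
proof -
  interpret hyperbolic_lamination L by unfold_locales (rule assms(1))
  obtain F where "F \<in> leaves L" "\<not> simply_connected_space (subtopology \<L> F)"
    using assms(4) by blast
  then obtain w r where w: "w \<in> UB" "0 < r" "act w (geodesic_subgroup r) = w"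
    by (rule ex_closed_geodesic)
  have "X closure_of (act x ` affine_group) = topspace X" if "x \<in> topspace X" for x
  proof -
    have "right_action L x ` affine_group = act x ` affine_group"
      using that by (simp add: right_action_eq)
    moreover have "X closure_of (right_action L x ` affine_group) = UB"
      using assms(3) that by (simp add: minimal_affine_action_def)
    ultimately show ?thesis by simp
  qed
  then have "X closure_of (range (\<lambda>t. act w (horocycle_subgroup t))) = topspace X"
    using w by (intro unit_bundle.horocycle_orbit_dense) simp_all
  then show ?thesis
    using w(1) unfolding topologically_transitive_flow_def horocycle_flow_def
    by (intro bexI[of _ w]) (simp_all add: right_action_eq)
qed

end
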